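(* Let $k$ be an algebraically closed field of characteristic two, let $A=kQ_8$ be the group algebra of the quaternion group of order $8$, and let $[\ ,\ ]$ be the Gerstenhaber bracket on $HH^*(A)$. Let $\mathcal{X}=\{p_1,p_2,p_2',p_3,u_1,u_1',v_1,v_2,v_2',z\}$ be the set of algebra generators of $HH^*(A)$ specified in the context. Then the bracket is zero for all pairs of generators from $\mathcal{X}$ except (up to the order of the two arguments) the following: $$[p_1,u_1]=[p_3,u_1]=[p_2,u_1']=p_2',\qquad [p_2,u_1]=[p_2',u_1']=p_1,$$ $$[p_2',u_1]=[p_1,u_1']=[p_3,u_1']=p_2,\qquad [u_1,v_1]=[u_1',v_2']=(u_1')^2+v_2,$$ $$[u_1',v_1]=[u_1,v_2]=u_1^2+v_2',\qquad [u_1',v_2]=[u_1,v_2']=v_1.$$ Together with the presentation of the algebra $HH^*(A)$ given in the context, this completely determines the Gerstenhaber algebra structure on $HH^*(A)$.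
   Context: **The algebra.** $A=kQ_8$ is identified with $k\langle x,y\rangle/(x^2+yxy,\ y^2+xyx,\ x^4,\ y^4)$, with $k$-basis $\mathcal{B}=\{1,x,y,xy,yx,xyx,yxy,xyxy\}$. For $b\in\mathcal{B}$ define $1^*=xyxy$, $x^*=yxy$, $y^*=xyx$, $(xy)^*=xy$, $(yx)^*=yx$, $(xyx)^*=y$, $(yxy)^*=x$, $(xyxy)^*=1$. All tensor products are over $k$; $A^e=A\otimes A^{op}$. **Structures on Hochschild cohomology.** $HH^n(A)=\mathrm{Ext}^n_{A^e}(A,A)$ is the cohomology of $C^n(A)=\mathrm{Hom}_k(A^{\otimes n},A)$ (the bar complex, or its normalized version). The cup product is $(\alpha\smile\beta)(a_1\otimes\cdots\otimes a_{n+m})=\alpha(a_1\otimes\cdots\otimes a_n)\beta(a_{n+1}\otimes\cdots\otimes a_{n+m})$, written by juxtaposition. The Gerstenhaber bracket of $\alpha\in C^n(A)$, $\beta\in C^m(A)$ is $[\alpha,\beta]=\alpha\circ\beta-(-1)^{(n-1)(m-1)}\beta\circ\alpha\in C^{n+m-1}(A)$, where $\alpha\circ\beta=\sum_{i=1}^n(-1)^{(m-1)(i-1)}\alpha\circ_i\beta$ and $\alpha\circ_i\beta$ inserts $\beta$ in the $i$-th argument of $\alpha$ (for $m=0$, $\beta\in A$ is inserted as the $i$-th argument; if $n=0$, $\alpha\circ\beta=0$). These make $HH^*(A)$ a Gerstenhaber algebra; in particular the Poisson rule $[ab,c]=[a,c]b+(-1)^{|a|(|c|-1)}a[b,c]$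 holds. **The resolution.** Let $Q_1=\{x,y\}$, $Q_1^*=\{r_x,r_y\}$ ($r_x=x^2+yxy$, $r_y=y^2+xyx$). The 4-periodic minimal $A^e$-projective resolution $P_*$ of $A$ has $P_0=P_3=A\otimes A$, $P_1=A\otimes kQ_1\otimes A$, $P_2=A\otimes kQ_1^*\otimes A$, $P_{4n+i}=P_i$, augmentation $d_0:P_0\to A$ the multiplication, and bimodule differentials $d_1(1\otimes a\otimes1)=a\otimes1+1\otimes a$ for $a\in Q_1$; $d_2(1\otimes r_x\otimes1)=1\otimes x\otimes x+x\otimes x\otimes1+1\otimes y\otimes xy+y\otimes x\otimes y+yx\otimes y\otimes1$; $d_2(1\otimes r_y\otimes1)=1\otimes y\otimes y+y\otimes y\otimes1+1\otimes x\otimes yx+x\otimes y\otimes x+xy\otimes x\otimes1$; $d_3(1\otimes1)=x\otimes r_x\otimes1+1\otimes r_x\otimes x+y\otimes r_y\otimes1+1\otimes r_y\otimes y$; $d_4=\rho d_0$ with $\rho:A\to P_3$ the bimodule map $\rho(1)=\sum_{b\in\mathcal{B}}b^*\otimes b$; and $d_{4n+i+1}=d_{i+1}$ for $n\ge1$, $0\le i\le3$. **Notation for classes.** $HH^n(A)$ is also $H^n(\mathrm{Hom}_{A^e}(P_*,A))$. If $P_n=A\otimes A$, then $a\in A$ denotes the map $1\otimes1\mapsto a$; if $P_n=A\otimes kQ_1\otimes A$ (resp. $A\otimes kQ_1^*\otimes A$), then $(a,b)$ denotes the map with $1\otimes x\otimes1\mapsto a$, $1\otimes y\otimes1\mapsto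 b$ (resp. $1\otimes r_x\otimes1\mapsto a$, $1\otimes r_y\otimes1\mapsto b$). The same symbols denote cohomology classes. **Generators and relations (Generalov).** In degree 0: $p_1=xy+yx$, $p_2=xyx$, $p_2'=yxy$, $p_3=xyxy$; in degree 1: $u_1=(1+xy,x)$, $u_1'=(y,1+yx)$; in degree 2: $v_1=(y,x)$, $v_2=(x,0)$, $v_2'=(0,y)$; in degree 4: $z=1$. One has $HH^*(A)\cong k[\mathcal{X}]/I$, where $I$ is generated by: degree 0: $p_1^2,p_2^2,(p_2')^2,p_1p_2,p_1p_2',p_2p_2',p_3^2,p_1p_3,p_2p_3,p_2'p_3$; degree 1: $p_2u_1-p_2'u_1'$, $p_2'u_1-p_1u_1'$, $p_1u_1-p_2u_1'$; degree 2: $p_1v_1,p_2v_2,p_2'v_2',p_3v_1,p_3v_2,p_3v_2',u_1u_1'$, $p_2v_1-p_1v_2'$, $p_2v_1-p_2'v_2$, $p_2v_1-p_3u_1^2$, $p_2'v_1-p_1v_2$, $p_2'v_1-p_2v_2'$, $p_2'v_1-p_3(u_1')^2$; degree 3: $u_1'v_2-u_1v_2'$, $u_1'v_1-u_1v_2$, $u_1v_1-u_1'v_2'$, $u_1^3-(u_1')^3$; degree 4: $v_1^2,v_2^2,(v_2')^2,v_1v_2,v_1v_2',v_2v_2'$. *)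

theory Defs
  imports "HOL-Library.Poly_Mapping" "HOL-Computational_Algebra.Polynomial"
    "HOL-Algebra.QuotRing"
begin

section \<open>The group algebra of the quaternion group\<close>

text \<open>
  The product of \<open>'g \<Rightarrow>\<^sub>0 'k\<close> in \<open>Poly_Mapping\<close> is the convolution product of the monoid algebra
  of an additively written, not necessarily commutative, monoid.  The quaternion group is
  therefore written additively; \<open>Q8 s u\<close> stands for the quaternion \<open>-u\<close> if \<open>s\<close> holds, and
  for \<open>u\<close> otherwise.
\<close>

datatype quat = QE | QI | QJ | QK

datatype q8 = Q8 bool quat

fun quat_mult :: "quat \<Rightarrow> quat \<Rightarrow> q8" where
  "quat_mult QE u = Q8 False u"
| "quat_mult u QE = Q8 False u"
| "quat_mult QI QI = Q8 True QE"
| "quat_mult QJ QJ = Q8 True QE"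
| "quat_mult QK QK = Q8 True QE"
| "quat_mult QI QJ = Q8 False QK"
| "quat_mult QJ QK = Q8 False QI"
| "quat_mult QK QI = Q8 False QJ"
| "quat_mult QJ QI = Q8 True QK"
| "quat_mult QK QJ = Q8 True QI"
| "quat_mult QI QK = Q8 True QJ"

instantiation q8 :: group_add
begin

definition zero_q8 :: q8 where
  "0 = Q8 False QE"

fun plus_q8 :: "q8 \<Rightarrow> q8 \<Rightarrow> q8" where
  "Q8 s u + Q8 t v = (case quat_mult u v of Q8 r w \<Rightarrow> Q8 ((s \<noteq> t) \<noteq> r) w)"

fun uminus_q8 :: "q8 \<Rightarrow> q8" where
  "- Q8 s u = Q8 (if u = QE then s else \<not> s) u"

definition minus_q8 :: "q8 \<Rightarrow> q8 \<Rightarrow> q8" where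
  "(a :: q8) - b = a + - b"

instance
proof
  fix a b c :: q8
  obtain s u where a: "a = Q8 s u" by (cases a)
  obtain t v where b: "b = Q8 t v" by (cases b)
  obtain r w where c: "c = Q8 r w" by (cases c)
  show "a + b + c = a + (b + c)"
    unfolding a b c by (cases u; cases v; cases w) auto
  show "0 + a = a"
    by (simp add: a zero_q8_def)
  show "a + 0 = a"
    unfolding a zero_q8_def by (cases u) auto
  show "- a + a = 0"
    unfolding a zero_q8_def by (cases u) auto
  show "a + - b = a - b"
    by (simp add: minus_q8_def)
qed

end

lemma UNIV_quat: "(UNIV :: quat set) = {QE, QI, QJ, QK}"
  using quat.exhaust by auto

instance quat :: finite
  by standard (simp add: UNIV_quat)

instance q8 :: finite
proof
  have "(UNIV :: q8 set) \<subseteq> (\<lambda>(s, u). Q8 s u) ` UNIV"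
    by (auto simp: image_iff intro: q8.nchotomy[rule_format])
  then show "finite (UNIV :: q8 set)"
    by (rule finite_subset) simp
qed

definition vscale :: "'k::field \<Rightarrow> ('b \<Rightarrow>\<^sub>0 'k) \<Rightarrow> ('b \<Rightarrow>\<^sub>0 'k)" where
  "vscale c = Poly_Mapping.map ((*) c)"

lemma lookup_vscale: "Poly_Mapping.lookup (vscale c f) b = c * Poly_Mapping.lookup f b"
  by (simp add: vscale_def Poly_Mapping.map.rep_eq when_def)

lemma vector_space_vscale: "vector_space vscale"
  by standard (auto intro!: poly_mapping_eqI simp: lookup_vscale lookup_add algebra_simps)

type_synonym 'k kQ8 = "q8 \<Rightarrow>\<^sub>0 'k"

text \<open>
  An identification of \<open>kQ\<^sub>8\<close> with \<open>k\<langle>x, y\<rangle>/(x\<^sup>2 + yxy, y\<^sup>2 + xyx, x\<^sup>4, y\<^sup>4)\<close> is given by the images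
  of \<open>x\<close> and \<open>y\<close>: they satisfy the relations, and the eight monomials of the standard basis of
  the quotient are mapped to a basis of \<open>kQ\<^sub>8\<close>.
\<close>

definition std_basis :: "'a::ring_1 \<Rightarrow> 'a \<Rightarrow> 'a list" where
  "std_basis x y = [1, x, y, x*y, y*x, x*y*x, y*x*y, x*y*x*y]"

definition dual_basis :: "'a::ring_1 \<Rightarrow> 'a \<Rightarrow> 'a list" where
  "dual_basis x y = [x*y*x*y, y*x*y, x*y*x, x*y, y*x, y, x, 1]"

definition identification :: "'k::field kQ8 \<Rightarrow> 'k kQ8 \<Rightarrow> bool" where
  "identification x y \<longleftrightarrow>
     x^2 + y*x*y = 0 \<and> y^2 + x*y*x = 0 \<and> x^4 = 0 \<and> y^4 = 0 \<and>
     distinct (std_basis x y) \<and>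
     \<not> module.dependent vscale (set (std_basis x y)) \<and>
     module.span vscale (set (std_basis x y)) = UNIV"


section \<open>Hochschild cohomology of an algebra\<close>

text \<open>
  Throughout, \<open>s :: 'k \<Rightarrow> 'a \<Rightarrow> 'a\<close> is the scalar multiplication of a \<open>k\<close>-algebra \<open>'a\<close>.
  An element of \<open>\<Oplus>\<^sub>n Hom\<^sub>k (A\<^sup>\<otimes>\<^sup>n, A)\<close> is a function on lists: its restriction to lists of length
  \<open>n\<close> is the \<open>k\<close>-multilinear map corresponding to the component of degree \<open>n\<close>, and only finitely
  many components are nonzero.
\<close>

definition multilinear ::
    "('k::field \<Rightarrow> 'a::ab_group_add \<Rightarrow> 'a) \<Rightarrow> ('k \<Rightarrow> 'b::ab_group_add \<Rightarrow> 'b) \<Rightarrow> ('a list \<Rightarrow> 'b) \<Rightarrow> bool" where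
  "multilinear s t f \<longleftrightarrow>
     (\<forall>xs i. i < length xs \<longrightarrow> Vector_Spaces.linear s t (\<lambda>a. f (xs[i := a])))"

definition cochains :: "('k::field \<Rightarrow> 'a::ring_1 \<Rightarrow> 'a) \<Rightarrow> ('a list \<Rightarrow> 'a) set" where
  "cochains s = {f. multilinear s s f \<and> (\<exists>N. \<forall>xs. length xs > N \<longrightarrow> f xs = 0)}"

definition homogeneous :: "nat \<Rightarrow> ('a list \<Rightarrow> 'a::zero) \<Rightarrow> bool" where
  "homogeneous n f \<longleftrightarrow> (\<forall>xs. length xs \<noteq> n \<longrightarrow> f xs = 0)"

definition alt :: "nat \<Rightarrow> 'a::ab_group_add \<Rightarrow> 'a" where
  "alt n a = (if even n then a else - a)"

text \<open>
  For a function \<open>f\<close> on lists with values in a bimodule (with left and right actions \<open>L\<close> and \<open>R\<close>),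
  i.e. for a family of bimodule maps defined on \<open>A \<otimes> A\<^sup>\<otimes>\<^sup>n \<otimes> A\<close>, this is \<open>f\<close> composed with the bar
  differential, evaluated at \<open>1 \<otimes> a\<^sub>1 \<otimes> \<dots> \<otimes> a\<^sub>n \<otimes> 1\<close>.
\<close>

definition bar_diff ::
    "('a::ring_1 \<Rightarrow> 'm::ab_group_add \<Rightarrow> 'm) \<Rightarrow> ('m \<Rightarrow> 'a \<Rightarrow> 'm) \<Rightarrow> ('a list \<Rightarrow> 'm) \<Rightarrow> 'a list \<Rightarrow> 'm" where
  "bar_diff L R f xs =
     L (hd xs) (f (tl xs))
     + (\<Sum>i<length xs - 1. alt (i + 1) (f (take i xs @ (xs ! i * xs ! (i + 1)) # drop (i + 2) xs)))
     + alt (length xs) (R (f (butlast xs)) (last xs))"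

definition hoch_diff :: "('a::ring_1 list \<Rightarrow> 'a) \<Rightarrow> 'a list \<Rightarrow> 'a" where
  "hoch_diff f xs = (if xs = [] then 0 else bar_diff (*) (*) f xs)"

definition cup :: "('a::ring_1 list \<Rightarrow> 'a) \<Rightarrow> ('a list \<Rightarrow> 'a) \<Rightarrow> 'a list \<Rightarrow> 'a" where
  "cup f g xs = (\<Sum>n\<le>length xs. f (take n xs) * g (drop n xs))"

text \<open>
  \<open>circ n m f g\<close> is \<open>\<alpha> \<circ> \<beta>\<close> for the components \<open>\<alpha>\<close> of degree \<open>n\<close> of \<open>f\<close> and \<open>\<beta>\<close> of degree \<open>m\<close> of
  \<open>g\<close>.  The insertion positions are counted from \<open>0\<close>, and in exponents of \<open>-1\<close> the number
  \<open>m - 1\<close> is replaced by \<open>m + 1\<close>, which has the same parity and is a natural number for \<open>m = 0\<close>.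
\<close>

definition circ :: "nat \<Rightarrow> nat \<Rightarrow> ('a::ring_1 list \<Rightarrow> 'a) \<Rightarrow> ('a list \<Rightarrow> 'a) \<Rightarrow> 'a list \<Rightarrow> 'a" where
  "circ n m f g xs =
     (if length xs + 1 = n + m
      then \<Sum>i<n. alt ((m + 1) * i) (f (take i xs @ g (take m (drop i xs)) # drop (i + m) xs))
      else 0)"

text \<open>
  The bilinear extension of the Gerstenhaber bracket: only the components of degrees
  \<open>n\<close> and \<open>m\<close> with \<open>n + m - 1 = length xs\<close> contribute to the value at \<open>xs\<close>.
\<close>

definition bracket :: "('a::ring_1 list \<Rightarrow> 'a) \<Rightarrow> ('a list \<Rightarrow> 'a) \<Rightarrow> 'a list \<Rightarrow> 'a" where
  "bracket f g xs =
     (\<Sum>n\<le>length xs + 1. let m = length xs + 1 - n in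
        circ n m f g xs - alt ((n + 1) * (m + 1)) (circ m n g f xs))"

definition cocycle_ring :: "('k::field \<Rightarrow> 'a::ring_1 \<Rightarrow> 'a) \<Rightarrow> ('a list \<Rightarrow> 'a) ring" where
  "cocycle_ring s =
     \<lparr>carrier = {f \<in> cochains s. hoch_diff f = (\<lambda>_. 0)},
      monoid.mult = cup,
      one = (\<lambda>xs. if xs = [] then 1 else 0),
      zero = (\<lambda>_. 0),
      add = (\<lambda>f g xs. f xs + g xs)\<rparr>"

definition coboundaries :: "('k::field \<Rightarrow> 'a::ring_1 \<Rightarrow> 'a) \<Rightarrow> ('a list \<Rightarrow> 'a) set" where
  "coboundaries s = hoch_diff ` cochains s"

definition HH :: "('k::field \<Rightarrow> 'a::ring_1 \<Rightarrow> 'a) \<Rightarrow> ('a list \<Rightarrow> 'a) set ring" where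
  "HH s = cocycle_ring s Quot coboundaries s"

definition hh_class :: "('k::field \<Rightarrow> 'a::ring_1 \<Rightarrow> 'a) \<Rightarrow> ('a list \<Rightarrow> 'a) \<Rightarrow> ('a list \<Rightarrow> 'a) set" where
  "hh_class s f = coboundaries s +>\<^bsub>cocycle_ring s\<^esub> f"

definition HH_deg :: "('k::field \<Rightarrow> 'a::ring_1 \<Rightarrow> 'a) \<Rightarrow> nat \<Rightarrow> ('a list \<Rightarrow> 'a) set set" where
  "HH_deg s n = hh_class s ` {f \<in> carrier (cocycle_ring s). homogeneous n f}"

definition hh_scale ::
    "('k::field \<Rightarrow> 'a::ring_1 \<Rightarrow> 'a) \<Rightarrow> 'k \<Rightarrow> ('a list \<Rightarrow> 'a) set \<Rightarrow> ('a list \<Rightarrow> 'a) set" where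
  "hh_scale s c a = (\<Union>f\<in>a. hh_class s (\<lambda>xs. s c (f xs)))"

text \<open>Defined on cosets in the same way as \<open>rcoset_mult\<close>.\<close>

definition hh_bracket ::
    "('k::field \<Rightarrow> 'a::ring_1 \<Rightarrow> 'a) \<Rightarrow> ('a list \<Rightarrow> 'a) set \<Rightarrow> ('a list \<Rightarrow> 'a) set \<Rightarrow> ('a list \<Rightarrow> 'a) set" where
  "hh_bracket s a b = (\<Union>f\<in>a. \<Union>g\<in>b. hh_class s (bracket f g))"


section \<open>Gerstenhaber brackets on a graded algebra\<close>

definition ralt :: "('c, 'd) ring_scheme \<Rightarrow> nat \<Rightarrow> 'c \<Rightarrow> 'c" where
  "ralt R n a = (if even n then a else \<ominus>\<^bsub>R\<^esub> a)"

text \<open>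
  \<open>R\<close> is a graded algebra with scalar multiplication \<open>sc\<close> and homogeneous components \<open>D n\<close>;
  \<open>br\<close> is a bilinear operation of degree \<open>-1\<close> which is a graded Lie bracket after shifting the
  degrees by one, and satisfies the Poisson rule.  As above, \<open>n + 1\<close> is
  used for the parity of \<open>n - 1\<close>.
\<close>

definition is_gerstenhaber_bracket ::
    "('c, 'd) ring_scheme \<Rightarrow> ('k \<Rightarrow> 'c \<Rightarrow> 'c) \<Rightarrow> (nat \<Rightarrow> 'c set) \<Rightarrow> ('c \<Rightarrow> 'c \<Rightarrow> 'c) \<Rightarrow> bool" where
  "is_gerstenhaber_bracket R sc D br \<longleftrightarrow>
     (\<forall>a\<in>carrier R. \<forall>b\<in>carrier R. br a b \<in> carrier R) \<and>
     (\<forall>a\<in>carrier R. \<forall>b\<in>carrier R. \<forall>c\<in>carrier R.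
        br (a \<oplus>\<^bsub>R\<^esub> b) c = br a c \<oplus>\<^bsub>R\<^esub> br b c \<and>
        br c (a \<oplus>\<^bsub>R\<^esub> b) = br c a \<oplus>\<^bsub>R\<^esub> br c b) \<and>
     (\<forall>t. \<forall>a\<in>carrier R. \<forall>b\<in>carrier R.
        br (sc t a) b = sc t (br a b) \<and> br a (sc t b) = sc t (br a b)) \<and>
     (\<forall>n m. \<forall>a\<in>D n. \<forall>b\<in>D m.
        (if n + m = 0 then br a b = \<zero>\<^bsub>R\<^esub> else br a b \<in> D (n + m - 1))) \<and>
     (\<forall>n m. \<forall>a\<in>D n. \<forall>b\<in>D m.
        br a b = \<ominus>\<^bsub>R\<^esub> ralt R ((n + 1) * (m + 1)) (br b a)) \<and>
     (\<forall>n m l. \<forall>a\<in>D n. \<forall>b\<in>D m. \<forall>c\<in>D l.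
        br a (br b c) =
          br (br a b) c \<oplus>\<^bsub>R\<^esub> ralt R ((n + 1) * (m + 1)) (br b (br a c))) \<and>
     (\<forall>n m l. \<forall>a\<in>D n. \<forall>b\<in>D m. \<forall>c\<in>D l.
        br (a \<otimes>\<^bsub>R\<^esub> b) c =
          (br a c \<otimes>\<^bsub>R\<^esub> b) \<oplus>\<^bsub>R\<^esub> ralt R (n * (l + 1)) (a \<otimes>\<^bsub>R\<^esub> br b c))"


section \<open>The minimal resolution\<close>

text \<open>
  The free generators of the bimodules: \<open>P\<^sub>0 = P\<^sub>3 = A \<otimes> A\<close> has the generator \<open>1 \<otimes> 1\<close>, written
  \<open>1 \<otimes> Pt \<otimes> 1\<close>; the others are indexed by \<open>Q\<^sub>1 = {x, y}\<close> and \<open>Q\<^sub>1\<^sup>* = {r\<^sub>x, r\<^sub>y}\<close>.  Since \<open>Q\<^sub>8\<close> is a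
  basis of \<open>A\<close>, the vector space \<open>A \<otimes> kS \<otimes> A\<close> has the basis \<open>g \<otimes> s \<otimes> h\<close> with \<open>g, h \<in> Q\<^sub>8\<close>, \<open>s \<in> S\<close>.
\<close>

datatype cell = Pt | Gx | Gy | Rx | Ry

lemma UNIV_cell: "(UNIV :: cell set) = {Pt, Gx, Gy, Rx, Ry}"
  using cell.exhaust by auto

instance cell :: finite
  by standard (simp add: UNIV_cell)

type_synonym 'k bimod = "(q8 \<times> cell \<times> q8) \<Rightarrow>\<^sub>0 'k"

definition cells :: "nat \<Rightarrow> cell set" where
  "cells n = (if n mod 4 = 1 then {Gx, Gy} else if n mod 4 = 2 then {Rx, Ry} else {Pt})"

definition res :: "nat \<Rightarrow> 'k::field bimod set" where
  "res n = {p. \<forall>(g, s, h) \<in> Poly_Mapping.keys p. s \<in> cells n}"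

text \<open>The element \<open>a \<otimes> s \<otimes> b\<close>.\<close>

definition tens :: "'k::field kQ8 \<Rightarrow> cell \<Rightarrow> 'k kQ8 \<Rightarrow> 'k bimod" where
  "tens a s b = (\<Sum>g\<in>UNIV. \<Sum>h\<in>UNIV. Poly_Mapping.single (g, s, h) (Poly_Mapping.lookup a g * Poly_Mapping.lookup b h))"

text \<open>The bimodule action \<open>a p b\<close>.\<close>

definition act :: "'k::field kQ8 \<Rightarrow> 'k bimod \<Rightarrow> 'k kQ8 \<Rightarrow> 'k bimod" where
  "act a p b =
     (\<Sum>(g, s, h)\<in>UNIV. vscale (Poly_Mapping.lookup p (g, s, h))
        (tens (a * Poly_Mapping.single g 1) s (Poly_Mapping.single h 1 * b)))"

text \<open>
  The bimodule maps with \<open>1 \<otimes> s \<otimes> 1 \<mapsto> v s\<close>, with values in a free bimodule and in \<open>A\<close>, respectively.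
\<close>

definition bimod_map :: "(cell \<Rightarrow> 'k::field bimod) \<Rightarrow> 'k bimod \<Rightarrow> 'k bimod" where
  "bimod_map v p =
     (\<Sum>(g, s, h)\<in>UNIV. vscale (Poly_Mapping.lookup p (g, s, h))
        (act (Poly_Mapping.single g 1) (v s) (Poly_Mapping.single h 1)))"

definition alg_map :: "(cell \<Rightarrow> 'k::field kQ8) \<Rightarrow> 'k bimod \<Rightarrow> 'k kQ8" where
  "alg_map w p =
     (\<Sum>(g, s, h)\<in>UNIV. vscale (Poly_Mapping.lookup p (g, s, h))
        (Poly_Mapping.single g 1 * w s * Poly_Mapping.single h 1))"

definition augmentation :: "'k::field bimod \<Rightarrow> 'k kQ8" where
  "augmentation = alg_map (\<lambda>_. 1)"

text \<open>
  \<open>diff_gen x y n s\<close> is \<open>d\<^sub>n (1 \<otimes> s \<otimes> 1)\<close> for \<open>n \<ge> 1\<close> and \<open>s \<in> cells n\<close>.  If \<open>4\<close> divides \<open>n\<close>, the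
  bimodule map \<open>d\<^sub>n = \<rho> d\<^sub>0\<close> is determined by \<open>1 \<otimes> 1 \<mapsto> \<rho> 1\<close>.
\<close>

definition diff_gen :: "'k::field kQ8 \<Rightarrow> 'k kQ8 \<Rightarrow> nat \<Rightarrow> cell \<Rightarrow> 'k bimod" where
  "diff_gen x y n s =
     (if n mod 4 = 1 then
        (case s of
           Gx \<Rightarrow> tens x Pt 1 + tens 1 Pt x
         | Gy \<Rightarrow> tens y Pt 1 + tens 1 Pt y
         | _ \<Rightarrow> 0)
      else if n mod 4 = 2 then
        (case s of
           Rx \<Rightarrow> tens 1 Gx x + tens x Gx 1 + tens 1 Gy (x*y) + tens y Gx y + tens (y*x) Gy 1
         | Ry \<Rightarrow> tens 1 Gy y + tens y Gy 1 + tens 1 Gx (y*x) + tens x Gy x + tens (x*y) Gx 1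
         | _ \<Rightarrow> 0)
      else if n mod 4 = 3 then
        (case s of
           Pt \<Rightarrow> tens x Rx 1 + tens 1 Rx x + tens y Ry 1 + tens 1 Ry y
         | _ \<Rightarrow> 0)
      else
        (case s of
           Pt \<Rightarrow> (\<Sum>(b', b) \<leftarrow> zip (dual_basis x y) (std_basis x y). tens b' Pt b)
         | _ \<Rightarrow> 0))"

definition res_diff :: "'k::field kQ8 \<Rightarrow> 'k kQ8 \<Rightarrow> nat \<Rightarrow> 'k bimod \<Rightarrow> 'k bimod" where
  "res_diff x y n = bimod_map (diff_gen x y n)"

text \<open>
  A chain map of bimodule complexes from the bar resolution to the minimal resolution over the
  identity of \<open>A\<close>; \<open>\<Phi> [a\<^sub>1, \<dots>, a\<^sub>n]\<close> is the image of \<open>1 \<otimes> a\<^sub>1 \<otimes> \<dots> \<otimes> a\<^sub>n \<otimes> 1\<close>.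
  Composition with such a map identifies the cohomology of \<open>Hom (P\<^sub>*, A)\<close> with \<open>HH\<^sup>*(A)\<close>,
  independently of the choice of \<open>\<Phi>\<close>.
\<close>

definition comparison_map ::
    "'k::field kQ8 \<Rightarrow> 'k kQ8 \<Rightarrow> ('k kQ8 list \<Rightarrow> 'k bimod) \<Rightarrow> bool" where
  "comparison_map x y \<Phi> \<longleftrightarrow>
     multilinear vscale vscale \<Phi> \<and>
     (\<forall>xs. \<Phi> xs \<in> res (length xs)) \<and>
     augmentation (\<Phi> []) = 1 \<and>
     (\<forall>xs. xs \<noteq> [] \<longrightarrow>
        res_diff x y (length xs) (\<Phi> xs) =
          bar_diff (\<lambda>a p. act a p 1) (\<lambda>p a. act 1 p a) \<Phi> xs)"

text \<open>The class of the bimodule map \<open>P\<^sub>n \<rightarrow> A\<close> with \<open>1 \<otimes> s \<otimes> 1 \<mapsto> w s\<close>.\<close>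

definition res_class ::
    "('k::field kQ8 list \<Rightarrow> 'k bimod) \<Rightarrow> nat \<Rightarrow> (cell \<Rightarrow> 'k kQ8) \<Rightarrow> ('k kQ8 list \<Rightarrow> 'k kQ8) set" where
  "res_class \<Phi> n w =
     hh_class vscale (\<lambda>xs. if length xs = n then alg_map w (\<Phi> xs) else 0)"


section \<open>The generators and their brackets\<close>

datatype gen = P1 | P2 | P2' | P3 | U1 | U1' | V1 | V2 | V2' | Z

fun gen_deg :: "gen \<Rightarrow> nat" where
  "gen_deg P1 = 0" | "gen_deg P2 = 0" | "gen_deg P2' = 0" | "gen_deg P3 = 0"
| "gen_deg U1 = 1" | "gen_deg U1' = 1"
| "gen_deg V1 = 2" | "gen_deg V2 = 2" | "gen_deg V2' = 2"
| "gen_deg Z = 4"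

definition on_pt :: "'a::zero \<Rightarrow> cell \<Rightarrow> 'a" where
  "on_pt a s = (case s of Pt \<Rightarrow> a | _ \<Rightarrow> 0)"

definition on_pair :: "'a::zero \<Rightarrow> 'a \<Rightarrow> cell \<Rightarrow> 'a" where
  "on_pair a b s = (case s of Gx \<Rightarrow> a | Gy \<Rightarrow> b | Rx \<Rightarrow> a | Ry \<Rightarrow> b | Pt \<Rightarrow> 0)"

fun gen_map :: "'a::ring_1 \<Rightarrow> 'a \<Rightarrow> gen \<Rightarrow> cell \<Rightarrow> 'a" where
  "gen_map x y P1 = on_pt (x*y + y*x)"
| "gen_map x y P2 = on_pt (x*y*x)"
| "gen_map x y P2' = on_pt (y*x*y)"
| "gen_map x y P3 = on_pt (x*y*x*y)"
| "gen_map x y U1 = on_pair (1 + x*y) x"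
| "gen_map x y U1' = on_pair y (1 + y*x)"
| "gen_map x y V1 = on_pair y x"
| "gen_map x y V2 = on_pair x 0"
| "gen_map x y V2' = on_pair 0 y"
| "gen_map x y Z = on_pt 1"

definition gen_class ::
    "'k::field kQ8 \<Rightarrow> 'k kQ8 \<Rightarrow> ('k kQ8 list \<Rightarrow> 'k bimod) \<Rightarrow> gen \<Rightarrow> ('k kQ8 list \<Rightarrow> 'k kQ8) set" where
  "gen_class x y \<Phi> g = res_class \<Phi> (gen_deg g) (gen_map x y g)"

text \<open>
  The table of brackets: the listed values hold for both orders of the arguments, and the bracket
  of a pair that is not listed in either order vanishes.  Here \<open>c g\<close> is the element of \<open>R\<close>
  denoted by the generator \<open>g\<close>.
\<close>

definition nonzero_brackets :: "('c, 'd) ring_scheme \<Rightarrow> (gen \<Rightarrow> 'c) \<Rightarrow> (gen \<times> gen \<times> 'c) set" where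
  "nonzero_brackets R c =
     {(P1, U1, c P2'), (P3, U1, c P2'), (P2, U1', c P2'),
      (P2, U1, c P1), (P2', U1', c P1),
      (P2', U1, c P2), (P1, U1', c P2), (P3, U1', c P2),
      (U1, V1, c U1' [^]\<^bsub>R\<^esub> (2::nat) \<oplus>\<^bsub>R\<^esub> c V2), (U1', V2', c U1' [^]\<^bsub>R\<^esub> (2::nat) \<oplus>\<^bsub>R\<^esub> c V2),
      (U1', V1, c U1 [^]\<^bsub>R\<^esub> (2::nat) \<oplus>\<^bsub>R\<^esub> c V2'), (U1, V2, c U1 [^]\<^bsub>R\<^esub> (2::nat) \<oplus>\<^bsub>R\<^esub> c V2'),
      (U1', V2, c V1), (U1, V2', c V1)}"

definition bracket_table ::
    "('c, 'd) ring_scheme \<Rightarrow> (gen \<Rightarrow> 'c) \<Rightarrow> ('c \<Rightarrow> 'c \<Rightarrow> 'c) \<Rightarrow> bool" where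
  "bracket_table R c br \<longleftrightarrow>
     (\<forall>(g, h, v) \<in> nonzero_brackets R c. br (c g) (c h) = v \<and> br (c h) (c g) = v) \<and>
     (\<forall>g h. (\<forall>v. (g, h, v) \<notin> nonzero_brackets R c \<and> (h, g, v) \<notin> nonzero_brackets R c) \<longrightarrow>
        br (c g) (c h) = \<zero>\<^bsub>R\<^esub>)"

end

theory Submission
  imports Defs
begin

text \<open>In characteristic two all signs vanish, and sums over the splittings of a list give
  the brace calculus of Hochschild cochains, hence the Leibniz, bracket and Poisson identities up to
  coboundaries.  The double complex of multilinear maps into the cochains of the minimal resolution
  identifies the class of a cocycle with that of its pullback along any comparison map.  A contracting
  homotopy of the minimal resolution produces explicit cocycles for the generators, so that all the
  brackets and a spanning set of the cohomology become finite computations over the two-element field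
  on monomials; multiplication by \<open>z\<close> is the periodicity.  Two brackets with the same
  table are biderivations that agree on generators, hence everywhere.\<close>

text \<open>The circle product needs cochains on tensor powers of A, while the generators are maps
  on the minimal resolution transported by an arbitrary \<open>\<Phi>\<close>. The bridge is
  \<open>pull\<close>: it turns a homogeneous Hochschild cocycle into a cocycle on the minimal
  resolution, is defined without \<open>\<Phi>\<close>, and every admissible \<open>\<Phi>\<close>
  transports the result back to the original class. So one computable cocycle per generator serves
  for all \<open>\<Phi>\<close>, and two cocycles of the same degree have the same class as soon as
  their pullbacks differ by a coboundary. Such a pullback consists of at most two elements of an
  eight-dimensional algebra.

  That the generators span the cohomology is not read off from the presentation. It follows from a
  finite certificate indexed by the degree modulo 4, because multiplication by powers of
  \<open>z\<close> leaves pullbacks unchanged.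

  All structure constants in the monomial basis are 0 or 1, so the computations never mention the
  field: an element is a list of monomials, and equal entries cancel.\<close>

section \<open>Sums over splittings of a list and brace operations\<close>

fun spl :: "('a list \<Rightarrow> 'a list \<Rightarrow> 'm::comm_monoid_add) \<Rightarrow> 'a list \<Rightarrow> 'm" where
  "spl F [] = F [] []"
| "spl F (a # xs) = F [] (a # xs) + spl (\<lambda>u v. F (a # u) v) xs"

lemma spl_eq_sum: "spl F xs = (\<Sum>i\<le>length xs. F (take i xs) (drop i xs))"
proof (induction xs arbitrary: F)
  case (Cons a xs)
  then show ?case
    by (simp add: sum.atMost_Suc_shift del: sum.atMost_Suc)
qed simp

lemma spl_add: "spl (\<lambda>u v. F u v + G u v) xs = spl F xs + spl G xs"
  by (simp add: spl_eq_sum sum.distrib)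

lemma spl_0 [simp]: "spl (\<lambda>u v. 0) = (\<lambda>xs. 0)"
  by (simp add: spl_eq_sum fun_eq_iff)

lemma spl_cong:
  assumes "\<And>u v. u @ v = xs \<Longrightarrow> F u v = G u v"
  shows "spl F xs = spl G xs"
  using assms by (simp add: spl_eq_sum)

lemma spl_hom:
  assumes "h 0 = 0" "\<And>a b. h (a + b) = h a + h b"
  shows "h (spl F xs) = spl (\<lambda>u v. h (F u v)) xs"
proof (induction xs arbitrary: F)
qed (auto simp: assms)

lemma spl_swap: "spl (\<lambda>a b. spl (\<lambda>c d. G a b c d) y) x = spl (\<lambda>c d. spl (\<lambda>a b. G a b c d) x) y"
  by (simp add: spl_eq_sum) (rule sum.swap)

text \<open>Cutting the left piece once more or cutting the right piece once more enumerates the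
  same decompositions into three consecutive pieces.\<close>

lemma spl_assoc:
  "spl (\<lambda>m r. spl (\<lambda>a b. F m r a b) m) xs = spl (\<lambda>a q. spl (\<lambda>b r. F (a @ b) r a b) q) xs"
proof (induction xs arbitrary: F)
  case (Cons x xs)
  show ?case
    by (simp add: spl_add Cons [of "\<lambda>m r a b. F (x # m) r (x # a) b"] add.assoc)
qed simp

text \<open>A cut of the first piece is moved outwards past the cuts of the remainder. With the two
  variants below, every iterated sum reaches the normal form in which pieces are cut off from left
  to right.\<close>

lemma spl_hoist1:
  "spl (\<lambda>m r. spl (\<lambda>c d. spl (\<lambda>a b. F m r c d a b) m) r) xs =
   spl (\<lambda>a q. spl (\<lambda>b r. spl (\<lambda>c d. F (a @ b) r c d a b) r) q) xs"
  by (subst spl_swap) (rule spl_assoc)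

lemma spl_hoist2:
  "spl (\<lambda>m r. spl (\<lambda>c d. spl (\<lambda>e g. spl (\<lambda>a b. F m r c d e g a b) m) d) r) xs =
   spl (\<lambda>a q. spl (\<lambda>b r. spl (\<lambda>c d. spl (\<lambda>e g. F (a @ b) r c d e g a b) d) r) q) xs"
  by (subst spl_swap, subst spl_swap) (rule spl_assoc)

lemma spl_hoist3:
  "spl (\<lambda>m r. spl (\<lambda>c d. spl (\<lambda>e g. spl (\<lambda>i j. spl (\<lambda>a b. F m r c d e g i j a b) m) g) d) r) xs =
   spl (\<lambda>a q. spl (\<lambda>b r. spl (\<lambda>c d. spl (\<lambda>e g. spl (\<lambda>i j. F (a @ b) r c d e g i j a b) g) d) r) q) xs"
  by (subst spl_swap, subst spl_swap, subst spl_swap) (rule spl_assoc)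

text \<open>A cut falls before the entry \<open>e\<close> or after it. When \<open>e\<close> is a
  value that has already been inserted, this separates the possible positions of a further
  insertion.\<close>

lemma spl_mid:
  "spl F (xs @ e # ys) = spl (\<lambda>a b. F a (b @ e # ys)) xs + spl (\<lambda>a b. F (xs @ e # a) b) ys"
  by (induction xs arbitrary: F) (auto simp: add.assoc)

definition additive :: "('a::comm_monoid_add list \<Rightarrow> 'm::comm_monoid_add) \<Rightarrow> bool" where
  "additive f \<longleftrightarrow> (\<forall>as a b cs. f (as @ (a + b) # cs) = f (as @ a # cs) + f (as @ b # cs)) \<and>
     (\<forall>as cs. f (as @ 0 # cs) = 0)"

lemma additive_spl:
  assumes "additive f"
  shows "f (as @ spl F m # cs) = spl (\<lambda>u v. f (as @ F u v # cs)) m"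
  by (rule spl_hom [of "\<lambda>z. f (as @ z # cs)"]) (use assms in \<open>auto simp: additive_def\<close>)

lemma additive_spl2:
  assumes "additive f"
  shows "f (as @ c # bs @ spl F m # cs) = spl (\<lambda>u v. f (as @ c # bs @ F u v # cs)) m"
  using additive_spl [OF assms, of "as @ c # bs"] by simp

lemmas spl_in_slot = additive_spl additive_spl2

text \<open>The brace \<open>f{g}\<close>, in all degrees at once and without the signs, which
  disappear in characteristic two. The inserted block may be empty, which covers components of
  \<open>g\<close> in degree 0. \<open>ins2\<close> and \<open>ins3\<close> are the braces with two
  and three ordered entries.\<close>

definition ins :: "('a list \<Rightarrow> 'm::comm_monoid_add) \<Rightarrow> ('a list \<Rightarrow> 'a) \<Rightarrow> 'a list \<Rightarrow> 'm" where
  "ins f g xs = spl (\<lambda>as r. spl (\<lambda>bs cs. f (as @ g bs # cs)) r) xs"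

definition ins2 where
  "ins2 f g h xs = spl (\<lambda>as r. spl (\<lambda>bs q. spl (\<lambda>cs w. spl (\<lambda>ds es.
     f (as @ g bs # cs @ h ds # es)) w) q) r) xs"

definition ins3 where
  "ins3 f g h k xs = spl (\<lambda>as r. spl (\<lambda>bs q. spl (\<lambda>cs w. spl (\<lambda>ds v. spl (\<lambda>es u. spl (\<lambda>is js.
     f (as @ g bs # cs @ h ds # es @ k is # js)) u) v) w) q) r) xs"

text \<open>
  As rewrite rules these are stated without the last argument of \<^const>\<open>spl\<close>, since the simplifier
  works on eta-contracted terms.
\<close>

lemmas ins_normalize = spl_mid append_assoc append_Cons
  spl_add [THEN ext] spl_assoc [THEN ext] spl_hoist1 [THEN ext] spl_hoist2 [THEN ext] spl_hoist3 [THEN ext]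

text \<open>The value of \<open>h\<close> is either an argument of \<open>g\<close> or stands to the
  right or to the left of the block fed to \<open>g\<close>. In particular the associator is
  symmetric in \<open>g\<close> and \<open>h\<close>, which is the pre-Lie relation.\<close>

lemma ins_ins:
  assumes f: "additive f"
  shows "ins (ins f g) h xs = ins f (ins g h) xs + ins2 f g h xs + ins2 f h g xs"
  unfolding ins_def [abs_def] ins2_def
  by (simp only: spl_in_slot [OF f] ins_normalize add_ac)

lemma ins_ins2:
  assumes f: "additive f"
  shows "ins2 (ins f g) h k xs = ins f (ins2 g h k) xs + ins2 f (ins g h) k xs + ins2 f h (ins g k) xs
     + ins3 f g h k xs + ins3 f h g k xs + ins3 f h k g xs"
  unfolding ins_def [abs_def] ins2_def [abs_def] ins3_def
  by (simp only: spl_in_slot [OF f] ins_normalize add_ac)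

lemma ins2_ins:
  assumes f: "additive f"
  shows "ins (ins2 f g h) k xs = ins2 f (ins g k) h xs + ins2 f g (ins h k) xs
     + ins3 f k g h xs + ins3 f g k h xs + ins3 f g h k xs"
  unfolding ins_def [abs_def] ins2_def [abs_def] ins3_def
  by (simp only: spl_in_slot [OF f] ins_normalize add_ac)

section \<open>Multilinear functions on lists\<close>

lemma linear_iff':
  "Vector_Spaces.linear s t f \<longleftrightarrow> vector_space s \<and> vector_space t \<and>
     (\<forall>a b. f (a + b) = f a + f b) \<and> (\<forall>c a. f (s c a) = t c (f a))"
  by (auto simp: Vector_Spaces.linear_iff)

lemma multilinear_iff:
  "multilinear s t f \<longleftrightarrow> (\<forall>as cs. Vector_Spaces.linear s t (\<lambda>a. f (as @ a # cs)))"
proof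
  assume f: "multilinear s t f"
  show "\<forall>as cs. Vector_Spaces.linear s t (\<lambda>a. f (as @ a # cs))"
  proof (intro allI)
    fix as cs
    have "Vector_Spaces.linear s t (\<lambda>a. f ((as @ 0 # cs)[length as := a]))"
      using f unfolding multilinear_def by (rule allE) (erule allE, erule mp, simp)
    then show "Vector_Spaces.linear s t (\<lambda>a. f (as @ a # cs))"
      by simp
  qed
next
  assume "\<forall>as cs. Vector_Spaces.linear s t (\<lambda>a. f (as @ a # cs))"
  then show "multilinear s t f"
    by (simp add: multilinear_def upd_conv_take_nth_drop)
qed

lemma multilinearD:
  assumes "multilinear s t f"
  shows "f (as @ (a + b) # cs) = f (as @ a # cs) + f (as @ b # cs)"
    "f (as @ s c a # cs) = t c (f (as @ a # cs))"
    "f (as @ 0 # cs) = 0"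
proof -
  have l: "Vector_Spaces.linear s t (\<lambda>a. f (as @ a # cs))"
    using assms by (simp add: multilinear_iff)
  then show "f (as @ (a + b) # cs) = f (as @ a # cs) + f (as @ b # cs)"
    "f (as @ s c a # cs) = t c (f (as @ a # cs))"
    by (simp_all add: linear_iff')
  interpret Vector_Spaces.linear s t "\<lambda>a. f (as @ a # cs)" by (rule l)
  show "f (as @ 0 # cs) = 0" by (rule zero)
qed

lemma multilinear_imp_additive: "multilinear s t f \<Longrightarrow> additive f"
  by (simp add: additive_def multilinearD)

lemma linear_spl:
  assumes "vector_space s" "vector_space t" "\<And>u v. Vector_Spaces.linear s t (\<lambda>e. F e u v)"
  shows "Vector_Spaces.linear s t (\<lambda>e. spl (F e) xs)"
proof -
  interpret vector_space_pair s t
    using assms by (simp add: vector_space_pair_def)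
  show ?thesis
    unfolding spl_eq_sum by (rule linear_compose_sum) (use assms in auto)
qed

lemma linear_add:
  assumes "Vector_Spaces.linear s t f" "Vector_Spaces.linear s t g"
  shows "Vector_Spaces.linear s t (\<lambda>e. f e + g e)"
proof -
  interpret vector_space_pair s t
    using assms(1) by (simp add: linear_iff' vector_space_pair_def)
  show ?thesis
    using assms by (rule linear_compose_add)
qed

lemma linear_zero:
  assumes "vector_space s" "vector_space t"
  shows "Vector_Spaces.linear s t (\<lambda>e. 0)"
proof -
  interpret vector_space_pair s t
    using assms by (simp add: vector_space_pair_def)
  show ?thesis
    by (simp add: linear_iff' assms)
qed

section \<open>The bar differential and the multiplication cochain\<close>

text \<open>The inner faces of the bar differential without signs; the recursive form makes it
  possible to break the sum at a chosen entry.\<close>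

fun mrg :: "('a::times list \<Rightarrow> 'm::comm_monoid_add) \<Rightarrow> 'a list \<Rightarrow> 'm" where
  "mrg f [] = 0"
| "mrg f [a] = 0"
| "mrg f (a # b # xs) = f (a * b # xs) + mrg (\<lambda>l. f (a # l)) (b # xs)"

lemma mrg_eq_sum:
  "(\<Sum>i<length xs - 1. f (take i xs @ (xs ! i * xs ! (i + 1)) # drop (i + 2) xs)) = mrg f xs"
proof (induction f xs rule: mrg.induct)
  case (3 f a b xs)
  then show ?case
    by (simp add: sum.lessThan_Suc_shift del: sum.lessThan_Suc)
qed auto

text \<open>No product of neighbours reaches across \<open>c\<close>: it involves entries up to
  \<open>c\<close> or entries from \<open>c\<close> on, and the other end of the list is
  untouched.\<close>

lemma mrg_append: "mrg f (as @ c # bs) = mrg (\<lambda>l. f (l @ bs)) (as @ [c]) + mrg (\<lambda>l. f (as @ l)) (c # bs)"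
proof (induction as arbitrary: f)
  case (Cons a as)
  show ?case
    by (cases as) (use Cons [of "\<lambda>l. f (a # l)"] in \<open>auto simp: add.assoc\<close>)
qed simp

lemma mrg_snoc: "mrg f (as @ [c, d]) = mrg (\<lambda>l. f (l @ [d])) (as @ [c]) + f (as @ [c * d])"
  using mrg_append [of f as c "[d]"] by simp

lemma mrg_add: "mrg (\<lambda>l. f l + g l) xs = mrg f xs + mrg g xs"
proof (induction f xs arbitrary: g rule: mrg.induct)
  case (3 f a b xs)
  show ?case
    using 3 [of "\<lambda>l. g (a # l)"] by (simp add: add_ac)
qed auto

lemma mrg_hom:
  assumes "h 0 = 0" "\<And>a b. h (a + b) = h a + h b"
  shows "h (mrg f xs) = mrg (\<lambda>l. h (f l)) xs"
  by (induction f xs rule: mrg.induct) (auto simp: assms)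

lemma mrg_cong:
  assumes "\<And>l. length l + 1 = length xs \<Longrightarrow> f l = g l"
  shows "mrg f xs = mrg g xs"
  using assms by (induction f xs arbitrary: g rule: mrg.induct) auto

text \<open>The multiplication of the algebra as a cochain concentrated in degree 2; the Hochschild
  differential is the bracket with it.\<close>

definition mlt :: "'a::ring_1 list \<Rightarrow> 'a" where
  "mlt xs = (case xs of [a, b] \<Rightarrow> a * b | _ \<Rightarrow> 0)"

lemma mlt_simps [simp]: "mlt [] = 0" "mlt [a] = 0" "mlt [a, b] = a * b" "mlt (a # b # c # xs) = 0"
  by (simp_all add: mlt_def)

lemma mlt_length: "length xs \<noteq> 2 \<Longrightarrow> mlt xs = 0"
  by (auto simp: mlt_def split: list.splits)

lemma spl_last:
  "spl (\<lambda>bs cs. case cs of [c] \<Rightarrow> G bs c | _ \<Rightarrow> 0) r = (if r = [] then 0 else G (butlast r) (last r))"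
proof (induction r arbitrary: G)
  case (Cons a r)
  then show ?case
    by (cases r) auto
qed simp

lemma spl_whole: "spl (\<lambda>bs cs. case cs of [] \<Rightarrow> G bs | _ \<Rightarrow> 0) r = G r"
proof (induction r arbitrary: G)
  case (Cons a r)
  then show ?case by auto
qed simp

lemma spl_first: "spl (\<lambda>bs cs. case bs of [] \<Rightarrow> G cs | _ \<Rightarrow> 0) r = G r"
  by (cases r) auto

lemma spl_mlt:
  assumes "additive f"
  shows "spl (\<lambda>bs cs. f (as @ mlt bs # cs)) r = (case r of a # b # cs \<Rightarrow> f (as @ (a * b) # cs) | _ \<Rightarrow> 0)"
proof -
  have z: "f (as @ 0 # cs) = 0" for cs
    using assms by (simp add: additive_def)
  show ?thesis
    by (cases r; cases "tl r"; cases "tl (tl r)") (auto simp: z)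
qed

lemma ins_mlt:
  assumes "additive f"
  shows "ins f mlt xs = mrg f xs"
proof -
  have "spl (\<lambda>as r. (case r of a # b # cs \<Rightarrow> f (as @ (a * b) # cs) | _ \<Rightarrow> 0)) xs = mrg f xs" for f :: "'a list \<Rightarrow> 'b"
    by (induction f xs rule: mrg.induct) auto
  then show ?thesis
    by (simp add: ins_def spl_mlt [OF assms])
qed

lemma mlt_ins:
  "ins mlt f xs = (if xs = [] then 0 else hd xs * f (tl xs) + f (butlast xs) * last xs)"
proof -
  have 0: "spl (\<lambda>bs cs. mlt (f bs # cs)) r = (if r = [] then 0 else f (butlast r) * last r)" for r
  proof -
    have "mlt (f bs # cs) = (case cs of [c] \<Rightarrow> f bs * c | _ \<Rightarrow> 0)" for bs cs
      by (auto split: list.splits)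
    then show ?thesis by (simp add: spl_last)
  qed
  have 1: "spl (\<lambda>bs cs. mlt (a # f bs # cs)) r = a * f r" for r a
  proof -
    have "mlt (a # f bs # cs) = (case cs of [] \<Rightarrow> a * f bs | _ \<Rightarrow> 0)" for bs cs
      by (auto split: list.splits)
    then show ?thesis by (simp add: spl_whole)
  qed
  have 2: "mlt (a # b # as @ f bs # cs) = 0" for a b as bs cs
    by (rule mlt_length) simp
  show ?thesis
  proof (cases xs)
    case (Cons a ys)
    have "spl (\<lambda>u v. spl (\<lambda>bs cs. mlt (a # u @ f bs # cs)) v) ys = a * f ys"
      by (cases ys) (simp_all add: 1 2)
    then show ?thesis
      by (simp add: ins_def Cons 0 add.commute)
  qed (simp add: ins_def)
qed

lemma cup_eq_spl: "cup f g xs = spl (\<lambda>u v. f u * g v) xs"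
  by (simp add: cup_def spl_eq_sum)

text \<open>Since \<open>mlt\<close> vanishes off lists of length 2, only the splittings with no
  argument left over survive. Identities for cup products thereby become instances of brace
  identities.\<close>

lemma cup_eq_ins2: "cup f g xs = ins2 mlt f g xs"
proof -
  have "mlt (as @ f bs # cs @ g ds # es) =
      (case as of [] \<Rightarrow> (case cs of [] \<Rightarrow> (case es of [] \<Rightarrow> f bs * g ds | _ \<Rightarrow> 0) | _ \<Rightarrow> 0) | _ \<Rightarrow> 0)"
    for as bs cs ds es
    by (cases as; cases cs; cases es) (auto simp: mlt_length)
  moreover have "(case as of [] \<Rightarrow> (z::'a) | _ \<Rightarrow> 0) = (if as = [] then z else 0)" for as :: "'a list" and z
    by (cases as) auto
  ultimately have "ins2 mlt f g xs = spl (\<lambda>as r. case as of [] \<Rightarrow> spl (\<lambda>bs q.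
      spl (\<lambda>cs w. case cs of [] \<Rightarrow> spl (\<lambda>ds es. case es of [] \<Rightarrow> f bs * g ds | _ \<Rightarrow> 0) w | _ \<Rightarrow> 0) q) r | _ \<Rightarrow> 0) xs"
    unfolding ins2_def by (intro spl_cong) (auto split: list.splits intro!: spl_cong)
  also have "\<dots> = spl (\<lambda>bs q. f bs * g q) xs"
    unfolding spl_first by (intro spl_cong) (simp add: spl_whole [of "\<lambda>ds. f _ * g ds"])
  finally show ?thesis
    by (simp add: cup_eq_spl)
qed

lemma ins3_mlt: "ins3 mlt f g h xs = 0"
proof -
  have "mlt (as @ f bs # cs @ g ds # es @ h is # js) = 0" for as bs cs ds es "is" js
    by (rule mlt_length) simp
  then show ?thesis by (simp add: ins3_def)
qed

lemma alt_char2: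
  assumes "\<And>b::'m::ab_group_add. b + b = 0"
  shows "alt n (a::'m) = a"
  by (simp add: alt_def) (metis assms add_eq_0_iff)

lemma bar_diff_char2:
  fixes f :: "'a::ring_1 list \<Rightarrow> 'm::ab_group_add"
  assumes "\<And>b::'m. b + b = 0" "xs \<noteq> []"
  shows "bar_diff L R f xs = L (hd xs) (f (tl xs)) + mrg f xs + R (f (butlast xs)) (last xs)"
  by (simp add: bar_diff_def alt_char2 [OF assms(1)] flip: mrg_eq_sum)

section \<open>Cochain identities in characteristic two\<close>

locale char2_algebra = vector_space s for s :: "'k::field \<Rightarrow> 'a::ring_1 \<Rightarrow> 'a" +
  assumes scale_mult_left: "s c a * b = s c (a * b)"
    and scale_mult_right: "a * s c b = s c (a * b)"
    and double: "(a :: 'a) + a = 0"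
begin

lemma double_left: "(a :: 'a) + (a + b) = b"
  by (simp add: double flip: add.assoc)

lemma minus_eq: "(a :: 'a) - b = a + b"
  by (simp add: diff_eq_eq add.assoc double)

lemmas char2_simps = double double_left add.commute add.left_commute

lemma eqI: "a + b = 0 \<Longrightarrow> (a :: 'a) = b"
  by (metis add.right_neutral double_left)

abbreviation mlin :: "('a list \<Rightarrow> 'a) \<Rightarrow> bool" where
  "mlin \<equiv> multilinear s s"

abbreviation lin :: "('a \<Rightarrow> 'a) \<Rightarrow> bool" where
  "lin \<equiv> Vector_Spaces.linear s s"

lemma vs: "vector_space s" ..

lemma lin_id: "lin (\<lambda>e. e)"
  by (simp add: linear_iff' vs)

lemma lin_slot:
  assumes "mlin f" "lin h"
  shows "lin (\<lambda>e. f (as @ h e # cs))"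
proof -
  have "lin ((\<lambda>e. f (as @ e # cs)) \<circ> h)"
    by (rule Vector_Spaces.linear_compose) (use assms in \<open>auto simp: multilinear_iff\<close>)
  then show ?thesis by (simp add: o_def)
qed

lemma lin_slot2: "mlin f \<Longrightarrow> lin h \<Longrightarrow> lin (\<lambda>e. f (as @ b # bs @ h e # cs))"
  using lin_slot [of f h "as @ b # bs" cs] by simp

lemma lin_slot3: "mlin f \<Longrightarrow> lin h \<Longrightarrow> lin (\<lambda>e. f (as @ b # bs @ c # ds @ h e # cs))"
  using lin_slot [of f h "as @ b # bs @ c # ds" cs] by simp

lemma mlin_add: "mlin f \<Longrightarrow> mlin g \<Longrightarrow> mlin (\<lambda>xs. f xs + g xs)"
  by (simp add: multilinear_iff linear_add)

lemma mlin_0: "mlin (\<lambda>xs. 0)"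
  by (simp add: multilinear_iff linear_zero vs)

lemma mlin_ins:
  assumes f: "mlin f" and g: "mlin g"
  shows "mlin (ins f g)"
  unfolding multilinear_iff ins_def
  by (simp only: ins_normalize)
    (intro allI linear_add linear_spl vs;
      ((rule lin_slot lin_slot2, rule f, rule lin_id) | (rule lin_slot, rule f, rule lin_slot, rule g, rule lin_id)))

lemma mlin_ins2:
  assumes f: "mlin f" and g: "mlin g" and h: "mlin h"
  shows "mlin (ins2 f g h)"
  unfolding multilinear_iff ins2_def
  by (simp only: ins_normalize)
    (intro allI linear_add linear_spl vs; ((rule lin_slot lin_slot2 lin_slot3, rule f, rule lin_id)
       | (rule lin_slot lin_slot2, rule f, rule lin_slot, rule g, rule lin_id)
       | (rule lin_slot lin_slot2, rule f, rule lin_slot, rule h, rule lin_id)))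

lemma mlin_mlt: "mlin mlt"
proof -
  have *: "mlt (as @ a # cs) = (case as of [] \<Rightarrow> (case cs of [c] \<Rightarrow> a * c | _ \<Rightarrow> 0)
      | [b] \<Rightarrow> (case cs of [] \<Rightarrow> b * a | _ \<Rightarrow> 0) | _ \<Rightarrow> 0)" for as cs and a :: 'a
    by (auto split: list.splits simp: mlt_def neq_Nil_conv)
  show ?thesis
    by (auto simp: multilinear_iff linear_iff' vs * algebra_simps scale_mult_left scale_mult_right
        split: list.splits)
qed

lemma mlin_cup: "mlin f \<Longrightarrow> mlin g \<Longrightarrow> mlin (cup f g)"
  using mlin_ins2 [OF mlin_mlt, of f g] by (simp add: cup_eq_ins2 [abs_def])

lemma mlin_scale: "mlin f \<Longrightarrow> mlin (\<lambda>xs. s c (f xs))"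
  by (auto simp: multilinear_iff linear_iff' vs scale_right_distrib scale_left_commute)

lemma mlin_additive [simp]: "mlin f \<Longrightarrow> additive f"
  by (rule multilinear_imp_additive)

text \<open>The outer faces make up \<open>mlt{f}\<close> and the inner faces \<open>f{mlt}\<close>,
  which opens the differential to the brace identities.\<close>

lemma hoch_diff_eq: "additive f \<Longrightarrow> hoch_diff f (xs :: 'a list) = ins mlt f xs + ins f mlt xs"
  using bar_diff_char2 [of xs "(*)" "(*)" f, OF double] by (cases "xs = []") (simp_all only: hoch_diff_def mlt_ins ins_mlt add_ac if_True if_False simp_thms mrg.simps add_0)

lemma ins_add_left: "ins (\<lambda>xs. f xs + f' xs) g xs = ins f g xs + ins f' g xs"
  by (simp add: ins_def spl_add [THEN ext])

lemma ins2_add_left: "ins2 (\<lambda>xs. f xs + f' xs) g h xs = ins2 f g h xs + ins2 f' g h xs"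
  by (simp add: ins2_def spl_add [THEN ext])

lemma additiveD: "additive f \<Longrightarrow> f (as @ (a + b) # cs) = f (as @ a # cs) + f (as @ b # cs)"
  "additive f \<Longrightarrow> f (as @ c # ds @ (a + b) # cs) = f (as @ c # ds @ a # cs) + f (as @ c # ds @ b # cs)"
  "additive f \<Longrightarrow> f (as @ 0 # cs) = 0"
  "additive f \<Longrightarrow> f (as @ c # ds @ 0 # cs) = 0"
  unfolding additive_def by (metis append_Cons append_assoc)+

lemma ins_add_right: "additive f \<Longrightarrow> ins f (\<lambda>xs. g xs + g' xs) xs = ins f g xs + ins f g' xs"
  by (simp add: ins_def additiveD spl_add [THEN ext])

lemma ins_0_right: "additive f \<Longrightarrow> ins f (\<lambda>xs. 0) xs = 0"
  by (simp add: ins_def additiveD)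

lemma ins2_add_mid: "additive f \<Longrightarrow> ins2 f (\<lambda>xs. g xs + g' xs) h xs = ins2 f g h xs + ins2 f g' h xs"
  by (simp add: ins2_def additiveD spl_add [THEN ext])

lemma ins2_add_right: "additive f \<Longrightarrow> ins2 f g (\<lambda>xs. h xs + h' xs) xs = ins2 f g h xs + ins2 f g h' xs"
  by (simp add: ins2_def additiveD spl_add [THEN ext])

lemma ins_0_left: "ins (\<lambda>xs. 0) g xs = 0" "ins2 (\<lambda>xs. 0) g h xs = 0"
  by (simp_all add: ins_def ins2_def)

text \<open>This is associativity: on a list of length 3 the two bracketings of the product
  cancel.\<close>

lemma mlt_mlt: "ins mlt mlt xs = (0 :: 'a)"
proof -
  consider "xs = []" | a where "xs = [a]" | a b where "xs = [a, b]" | a b c where "xs = [a, b, c]"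
    | a b c d ys where "xs = a # b # c # d # ys"
    by (metis neq_Nil_conv)
  then show ?thesis
    by cases (simp_all add: mlt_ins mult.assoc double mlt_length)
qed

lemmas diff_rules = hoch_diff_eq mlin_ins mlin_ins2 mlin_mlt mlin_cup mlin_add ins_add_left ins2_add_left
  ins_add_right ins2_add_mid ins2_add_right ins_ins ins_ins2 ins2_ins

text \<open>After expansion by the pre-Lie relation, every term occurs twice or belongs to an
  expression containing \<open>mlt{mlt}\<close>, which is zero.\<close>

lemma hoch_diff_hoch_diff:
  assumes "mlin f"
  shows "hoch_diff (hoch_diff f) xs = 0"
proof -
  have d: "hoch_diff f = (\<lambda>xs. ins mlt f xs + ins f mlt xs)"
    using assms by (simp add: hoch_diff_eq fun_eq_iff)
  have "ins (ins mlt mlt) f xs = 0"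
    by (simp add: mlt_mlt [abs_def] ins_0_left)
  then have "ins mlt (ins mlt f) xs = ins2 mlt mlt f xs + ins2 mlt f mlt xs"
    using assms by - (rule eqI, simp add: ins_ins mlin_mlt add.assoc)
  moreover have "ins f (ins mlt mlt) xs = 0"
    using assms by (simp add: mlt_mlt [abs_def] ins_0_right)
  ultimately show ?thesis
    using assms unfolding d by (simp add: diff_rules) (simp add: char2_simps)
qed

lemma hoch_diff_add:
  "mlin f \<Longrightarrow> mlin g \<Longrightarrow> hoch_diff (\<lambda>xs. f xs + g xs) xs = hoch_diff f xs + hoch_diff g xs"
  by (simp add: diff_rules add_ac)

text \<open>The Leibniz rule is the expansion of \<open>mlt{mlt}{f, g} = 0\<close>; the triple
  braces of \<open>mlt\<close> vanish because it takes only two arguments.\<close>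

lemma cup_hoch_diff:
  assumes "mlin f" "mlin g"
  shows "hoch_diff (cup f g) xs = cup (hoch_diff f) g xs + cup f (hoch_diff g) xs"
proof -
  have d: "hoch_diff f = (\<lambda>xs. ins mlt f xs + ins f mlt xs)" "hoch_diff g = (\<lambda>xs. ins mlt g xs + ins g mlt xs)"
    using assms by (simp_all add: hoch_diff_eq fun_eq_iff)
  have "ins2 (ins mlt mlt) f g xs = 0"
    by (simp add: mlt_mlt [abs_def] ins_0_left)
  then have "ins mlt (ins2 mlt f g) xs = ins2 mlt (ins mlt f) g xs + ins2 mlt f (ins mlt g) xs"
    using assms by - (rule eqI, simp add: ins_ins2 mlin_mlt ins3_mlt add.assoc)
  then show ?thesis
    using assms unfolding d cup_eq_ins2 [abs_def]
    by (simp add: diff_rules ins3_mlt)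
qed

text \<open>The circle product is a homotopy for the commutativity of the cup product. In the
  symmetric sum of both circle products the cup terms cancel, so that the bracket commutes with the
  differential.\<close>

lemma ins_hoch_diff:
  assumes "mlin f" "mlin g"
  shows "hoch_diff (ins f g) xs = ins f (hoch_diff g) xs + ins (hoch_diff f) g xs + cup f g xs + cup g f xs"
proof -
  have d: "hoch_diff f = (\<lambda>xs. ins mlt f xs + ins f mlt xs)" "hoch_diff g = (\<lambda>xs. ins mlt g xs + ins g mlt xs)"
    using assms by (simp_all add: hoch_diff_eq fun_eq_iff)
  show ?thesis
    using assms unfolding d cup_eq_ins2 [abs_def]
    by (simp add: diff_rules) (simp add: char2_simps)
qed

text \<open>Inserting a cup product into \<open>h\<close> obeys the product rule only up to
  homotopy, the homotopy being the double brace \<open>h{f, g}\<close>. Inserting \<open>h\<close>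
  into a cup product obeys it exactly, see \<open>ins_cup_left\<close>.\<close>

lemma ins_cup_right:
  assumes "mlin f" "mlin g" "mlin h"
  shows "ins h (cup f g) xs = cup (ins h f) g xs + cup f (ins h g) xs + hoch_diff (ins2 h f g) xs
     + ins2 (hoch_diff h) f g xs + ins2 h (hoch_diff f) g xs + ins2 h f (hoch_diff g) xs"
proof -
  have d: "hoch_diff h = (\<lambda>xs. ins mlt h xs + ins h mlt xs)"
    "hoch_diff f = (\<lambda>xs. ins mlt f xs + ins f mlt xs)" "hoch_diff g = (\<lambda>xs. ins mlt g xs + ins g mlt xs)"
    using assms by (simp_all add: hoch_diff_eq fun_eq_iff)
  show ?thesis
    using assms unfolding d cup_eq_ins2 [abs_def]
    by (simp add: diff_rules ins3_mlt) (simp add: char2_simps)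
qed

lemma ins_cup_left:
  assumes "mlin f" "mlin g"
  shows "ins (cup f g) h xs = cup (ins f h) g xs + cup f (ins g h) xs"
  using assms unfolding cup_eq_ins2 [abs_def] by (simp add: diff_rules ins3_mlt)

text \<open>The defining sum runs over a degree \<open>n\<close> and an insertion position.
  Replacing \<open>n\<close> by the block length \<open>length xs + 1 - n\<close> gives the sum over
  positions and block lengths that defines \<open>ins\<close>.\<close>

lemma bracket_eq: "bracket f g (xs :: 'a list) = ins f g xs + ins g f xs"
proof -
  have circ: "(\<Sum>n\<le>length xs + 1. circ n (length xs + 1 - n) f g xs) = ins f g xs" for f g :: "'a list \<Rightarrow> 'a"
  proof -
    let ?T = "\<lambda>i m. f (take i xs @ g (take m (drop i xs)) # drop m (drop i xs))"
    have "(\<Sum>n\<le>length xs + 1. circ n (length xs + 1 - n) f g xs) =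
        (\<Sum>n\<le>length xs + 1. \<Sum>i<n. ?T i (length xs + 1 - n))"
      by (intro sum.cong) (auto simp: circ_def alt_char2 [OF double] add.commute)
    also have "\<dots> = (\<Sum>(n, i)\<in>Sigma {..length xs + 1} (\<lambda>n. {..<n}). ?T i (length xs + 1 - n))"
      by (rule sum.Sigma) auto
    also have "\<dots> = (\<Sum>(i, m)\<in>Sigma {..length xs} (\<lambda>i. {..length xs - i}). ?T i m)"
      by (rule sum.reindex_bij_witness [where i = "\<lambda>(i, m). (length xs + 1 - m, i)"
            and j = "\<lambda>(n, i). (i, length xs + 1 - n)"]) auto
    also have "\<dots> = (\<Sum>i\<le>length xs. \<Sum>m\<le>length xs - i. ?T i m)"
      by (rule sum.Sigma [symmetric]) auto
    also have "\<dots> = ins f g xs"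
      by (simp add: ins_def spl_eq_sum)
    finally show ?thesis .
  qed
  have "bracket f g xs = (\<Sum>n\<le>length xs + 1. circ n (length xs + 1 - n) f g xs) +
      (\<Sum>n\<le>length xs + 1. circ (length xs + 1 - n) n g f xs)"
    unfolding bracket_def Let_def alt_char2 [OF double]
    by (simp add: minus_eq sum.distrib del: sum.atMost_Suc)
  also have "(\<Sum>n\<le>length xs + 1. circ (length xs + 1 - n) n g f xs) =
      (\<Sum>n\<le>length xs + 1. circ n (length xs + 1 - n) g f xs)"
    by (rule sum.reindex_bij_witness [where i = "\<lambda>n. length xs + 1 - n" and j = "\<lambda>n. length xs + 1 - n"]) auto
  finally show ?thesis
    unfolding circ .
qed

end

section \<open>The cohomology ring\<close>

definition bounded_deg :: "('a list \<Rightarrow> 'm::zero) \<Rightarrow> bool" where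
  "bounded_deg f \<longleftrightarrow> (\<exists>N. \<forall>xs. length xs > N \<longrightarrow> f xs = 0)"

lemma bounded_deg_add:
  fixes f g :: "'a list \<Rightarrow> 'm::monoid_add"
  assumes "bounded_deg f" "bounded_deg g"
  shows "bounded_deg (\<lambda>xs. f xs + g xs)"
proof -
  obtain N M where "\<forall>xs. length xs > N \<longrightarrow> f xs = 0" "\<forall>xs. length xs > M \<longrightarrow> g xs = 0"
    using assms by (auto simp: bounded_deg_def)
  then have "\<forall>xs. length xs > N + M \<longrightarrow> f xs + g xs = 0" by auto
  then show ?thesis unfolding bounded_deg_def by blast
qed

lemma spl_eq_0: "(\<And>u v. u @ v = xs \<Longrightarrow> F u v = 0) \<Longrightarrow> spl F xs = 0"
  by (simp add: spl_eq_sum)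

lemma bounded_deg_ins:
  assumes "bounded_deg f" "bounded_deg g" "additive f"
  shows "bounded_deg (ins f g)"
proof -
  obtain N M where *: "\<forall>xs. length xs > N \<longrightarrow> f xs = 0" "\<forall>xs. length xs > M \<longrightarrow> g xs = 0"
    using assms by (auto simp: bounded_deg_def)
  have "\<forall>xs. length xs > N + M \<longrightarrow> ins f g xs = 0"
  proof (intro allI impI)
    fix xs :: "'a list" assume l: "length xs > N + M"
    have "f (as @ g bs # cs) = 0" if "as @ r = xs" "bs @ cs = r" for as r bs cs
    proof (cases "length bs > M")
      case True
      then show ?thesis using * assms(3) by (simp add: additive_def)
    next
      case False
      then have "length (as @ g bs # cs) > N" using that l by auto
      then show ?thesis using * by blast
    qed
    then show "ins f g xs = 0"
      unfolding ins_def by (intro spl_eq_0)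
  qed
  then show ?thesis unfolding bounded_deg_def by blast
qed

lemma bounded_deg_ins2:
  assumes "bounded_deg f" "bounded_deg g" "bounded_deg h" "additive f"
  shows "bounded_deg (ins2 f g h)"
proof -
  obtain N M K where *: "\<forall>xs. length xs > N \<longrightarrow> f xs = 0" "\<forall>xs. length xs > M \<longrightarrow> g xs = 0"
    "\<forall>xs. length xs > K \<longrightarrow> h xs = 0"
    using assms by (auto simp: bounded_deg_def)
  have z: "f (as @ 0 # cs) = 0" "f (as @ b # bs @ 0 # cs) = 0" for as b bs cs
    using assms(4) unfolding additive_def by (simp, metis append_Cons append_assoc)
  have "\<forall>xs. length xs > N + M + K \<longrightarrow> ins2 f g h xs = 0"
  proof (intro allI impI)
    fix xs :: "'a list" assume l: "length xs > N + M + K"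
    have "f (as @ g bs # cs @ h ds # es) = 0" if "as @ r = xs" "bs @ q = r" "cs @ w = q" "ds @ es = w"
      for as r bs q cs w ds es
    proof -
      have "length as + length bs + length cs + length ds + length es > N + M + K"
        using l unfolding that [symmetric] by simp
      then consider "length bs > M" | "length ds > K" | "length (as @ g bs # cs @ h ds # es) > N"
        by fastforce
      then show ?thesis using * by cases (simp_all add: z)
    qed
    then show "ins2 f g h xs = 0"
      unfolding ins2_def by (intro spl_eq_0)
  qed
  then show ?thesis unfolding bounded_deg_def by blast
qed

lemma bounded_deg_mlt: "bounded_deg mlt"
  unfolding bounded_deg_def by (rule exI [of _ 2]) (auto intro: mlt_length)

context char2_algebra
begin

lemma cochains_iff: "f \<in> cochains s \<longleftrightarrow> mlin f \<and> bounded_deg f"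
  by (simp add: cochains_def bounded_deg_def)

abbreviation "cyc \<equiv> carrier (cocycle_ring s)"

lemma cyc_iff: "f \<in> cyc \<longleftrightarrow> f \<in> cochains s \<and> hoch_diff f = (\<lambda>_. 0)"
  by (simp add: cocycle_ring_def)

lemma cochains_mlin: "f \<in> cochains s \<Longrightarrow> mlin f"
  by (simp add: cochains_iff)

lemma cochains_closed [intro, simp]:
  "f \<in> cochains s \<Longrightarrow> g \<in> cochains s \<Longrightarrow> (\<lambda>xs. f xs + g xs) \<in> cochains s"
  "f \<in> cochains s \<Longrightarrow> g \<in> cochains s \<Longrightarrow> ins f g \<in> cochains s"
  "f \<in> cochains s \<Longrightarrow> g \<in> cochains s \<Longrightarrow> h \<in> cochains s \<Longrightarrow> ins2 f g h \<in> cochains s"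
  "f \<in> cochains s \<Longrightarrow> g \<in> cochains s \<Longrightarrow> cup f g \<in> cochains s"
  "f \<in> cochains s \<Longrightarrow> hoch_diff f \<in> cochains s"
  "f \<in> cochains s \<Longrightarrow> (\<lambda>xs. s c (f xs)) \<in> cochains s"
  "(\<lambda>xs. 0) \<in> cochains s"
proof -
  assume f: "f \<in> cochains s"
  have m: "mlt \<in> cochains s"
    by (simp add: cochains_iff mlin_mlt bounded_deg_mlt)
  show sc: "(\<lambda>xs. s c (f xs)) \<in> cochains s"
    using f by (auto simp: cochains_iff mlin_scale bounded_deg_def)
  have "hoch_diff f = (\<lambda>xs. ins mlt f xs + ins f mlt xs)"
    using f by (simp add: hoch_diff_eq fun_eq_iff cochains_iff)
  then show "hoch_diff f \<in> cochains s"
    using f m by (simp add: cochains_iff mlin_add bounded_deg_add mlin_ins bounded_deg_ins)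
  assume g: "g \<in> cochains s"
  show "(\<lambda>xs. f xs + g xs) \<in> cochains s" "ins f g \<in> cochains s"
    using f g by (auto simp: cochains_iff mlin_add bounded_deg_add mlin_ins bounded_deg_ins)
  show "cup f g \<in> cochains s"
    unfolding cup_eq_ins2 [abs_def]
    using f g m by (simp add: cochains_iff mlin_ins2 bounded_deg_ins2)
  assume "h \<in> cochains s"
  then show "ins2 f g h \<in> cochains s"
    using f g by (simp add: cochains_iff mlin_ins2 bounded_deg_ins2)
next
  show "(\<lambda>xs. 0) \<in> cochains s"
    by (simp add: cochains_iff mlin_0 bounded_deg_def)
qed

lemma cup_simps:
  "cup (\<lambda>xs. f xs + f' xs) g (xs :: 'a list) = cup f g xs + cup f' g xs"
  "cup f (\<lambda>xs. g xs + g' xs) xs = cup f g xs + cup f g' xs"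
  "cup (\<lambda>xs. 0) g xs = 0"
  "cup f (\<lambda>xs. 0) xs = 0"
  "cup (\<lambda>xs. s c (f xs)) g xs = s c (cup f g xs)"
  "cup f (\<lambda>xs. s c (g xs)) xs = s c (cup f g xs)"
  by (simp_all add: cup_def algebra_simps sum.distrib scale_mult_left scale_mult_right scale_sum_right)

lemma cup_assoc: "cup (cup f g) h (xs :: 'a list) = cup f (cup g h) xs"
proof -
  have "cup (cup f g) h xs = spl (\<lambda>m r. spl (\<lambda>a b. f a * g b * h r) m) xs"
    unfolding cup_eq_spl by (intro spl_cong spl_hom [of "\<lambda>z. z * _"]) (simp_all add: algebra_simps)
  also have "\<dots> = spl (\<lambda>a q. spl (\<lambda>b r. f a * g b * h r) q) xs"
    by (rule spl_assoc)
  also have "\<dots> = cup f (cup g h) xs"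
    unfolding cup_eq_spl by (intro spl_cong, subst spl_hom [of "\<lambda>z. _ * z"]) (simp_all add: algebra_simps)
  finally show ?thesis .
qed

abbreviation unit_cochain :: "'a list \<Rightarrow> 'a" where
  "unit_cochain \<equiv> (\<lambda>xs. if xs = [] then 1 else 0)"

lemma cup_unit: "cup unit_cochain f (xs :: 'a list) = f xs" "cup f unit_cochain xs = f xs"
proof -
  have "cup unit_cochain f xs = spl (\<lambda>u v. case u of [] \<Rightarrow> f v | _ \<Rightarrow> 0) xs"
    unfolding cup_eq_spl by (intro spl_cong) (auto split: list.splits)
  then show "cup unit_cochain f xs = f xs" by (simp add: spl_first)
  have "cup f unit_cochain xs = spl (\<lambda>u v. case v of [] \<Rightarrow> f u | _ \<Rightarrow> 0) xs"
    unfolding cup_eq_spl by (intro spl_cong) (auto split: list.splits)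
  then show "cup f unit_cochain xs = f xs" by (simp add: spl_whole)
qed

lemma hoch_diff_0: "hoch_diff (\<lambda>_. 0) = (\<lambda>_. 0 :: 'a)"
  by (simp add: fun_eq_iff hoch_diff_eq additive_def mlt_ins ins_0_left)

lemma hoch_diff_scale: "mlin f \<Longrightarrow> hoch_diff (\<lambda>xs. s c (f xs)) xs = s c (hoch_diff f xs)"
  by (simp add: hoch_diff_eq mlin_scale mlt_ins ins_mlt scale_right_distrib scale_mult_left
      scale_mult_right mrg_hom [of "s c"])

lemma cyc_closed [simp]:
  "f \<in> cyc \<Longrightarrow> g \<in> cyc \<Longrightarrow> (\<lambda>xs. f xs + g xs) \<in> cyc"
  "f \<in> cyc \<Longrightarrow> g \<in> cyc \<Longrightarrow> cup f g \<in> cyc"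
  "f \<in> cyc \<Longrightarrow> (\<lambda>xs. s c (f xs)) \<in> cyc"
  "f \<in> cochains s \<Longrightarrow> hoch_diff f \<in> cyc"
  "unit_cochain \<in> cyc"
  "(\<lambda>xs. 0) \<in> cyc"
proof -
  have "mlin unit_cochain"
    by (simp add: multilinear_iff linear_zero vs)
  moreover have "hoch_diff unit_cochain xs = 0" for xs
  proof -
    consider "xs = []" | a where "xs = [a]" | a b ys where "xs = a # b # ys"
      by (metis neq_Nil_conv)
    then show ?thesis
      by cases (simp_all add: hoch_diff_def bar_diff_def alt_char2 [OF double] double del: sum.lessThan_Suc)
  qed
  ultimately show "unit_cochain \<in> cyc"
    by (auto simp: cyc_iff cochains_iff fun_eq_iff bounded_deg_def)
  assume "f \<in> cyc" "g \<in> cyc"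
  then have fg: "f \<in> cochains s" "g \<in> cochains s" "hoch_diff f = (\<lambda>_. 0)" "hoch_diff g = (\<lambda>_. 0)"
    by (auto simp: cyc_iff)
  then have "hoch_diff (cup f g) = (\<lambda>_. 0)"
    by (intro ext) (simp add: cup_hoch_diff cochains_mlin cup_simps)
  then show "cup f g \<in> cyc"
    using fg by (simp add: cyc_iff)
qed (auto simp: cyc_iff fun_eq_iff cochains_mlin hoch_diff_add cup_hoch_diff cup_simps hoch_diff_scale
      hoch_diff_hoch_diff hoch_diff_0)

lemma ring_cocycle_ring: "ring (cocycle_ring s)"
proof (rule ringI)
  show "abelian_group (cocycle_ring s)"
  proof (rule abelian_groupI)
    fix f assume f: "f \<in> cyc"
    then show "\<exists>g\<in>cyc. g \<oplus>\<^bsub>cocycle_ring s\<^esub> f = \<zero>\<^bsub>cocycle_ring s\<^esub>"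
      by (intro bexI [of _ f]) (simp_all add: cocycle_ring_def double fun_eq_iff)
  qed (use cyc_closed in \<open>auto simp: cocycle_ring_def fun_eq_iff add_ac\<close>)
  show "monoid (cocycle_ring s)"
    by (rule monoidI) (use cyc_closed in \<open>auto simp: cocycle_ring_def fun_eq_iff cup_assoc cup_unit\<close>)
qed (auto simp: cocycle_ring_def fun_eq_iff cup_simps)

sublocale Z: ring "cocycle_ring s"
  by (rule ring_cocycle_ring)

lemma coboundaries_subset: "coboundaries s \<subseteq> cyc"
  by (auto simp: coboundaries_def)

lemma coboundaries_add:
  assumes "f \<in> coboundaries s" "g \<in> coboundaries s"
  shows "(\<lambda>xs. f xs + g xs) \<in> coboundaries s"
proof -
  obtain h k where "h \<in> cochains s" "k \<in> cochains s" "f = hoch_diff h" "g = hoch_diff k"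
    using assms by (auto simp: coboundaries_def)
  then have "(\<lambda>xs. f xs + g xs) = hoch_diff (\<lambda>xs. h xs + k xs)" "(\<lambda>xs. h xs + k xs) \<in> cochains s"
    by (auto simp: hoch_diff_add cochains_mlin)
  then show ?thesis
    unfolding coboundaries_def by (rule image_eqI)
qed

lemma ideal_coboundaries: "ideal (coboundaries s) (cocycle_ring s)"
proof (rule idealI [OF ring_cocycle_ring])
  show "subgroup (coboundaries s) (add_monoid (cocycle_ring s))"
  proof
    show "coboundaries s \<subseteq> carrier (add_monoid (cocycle_ring s))"
      using coboundaries_subset by simp
    show "f \<otimes>\<^bsub>add_monoid (cocycle_ring s)\<^esub> g \<in> coboundaries s"
      if "f \<in> coboundaries s" "g \<in> coboundaries s" for f g
      using coboundaries_add [OF that] by (simp add: cocycle_ring_def)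
    show "\<one>\<^bsub>add_monoid (cocycle_ring s)\<^esub> \<in> coboundaries s"
      using hoch_diff_0 by (auto simp: cocycle_ring_def coboundaries_def intro!: image_eqI [of _ _ "\<lambda>_. 0"])
    show "inv\<^bsub>add_monoid (cocycle_ring s)\<^esub> f \<in> coboundaries s" if "f \<in> coboundaries s" for f
    proof -
      have "\<ominus>\<^bsub>cocycle_ring s\<^esub> f = f"
        by (rule Z.minus_equality) (use that coboundaries_subset in \<open>auto simp: cocycle_ring_def double fun_eq_iff\<close>)
      then show ?thesis using that by (simp add: a_inv_def)
    qed
  qed
  fix b z assume "b \<in> coboundaries s" and z: "z \<in> cyc"
  then obtain h where h: "h \<in> cochains s" "b = hoch_diff h"
    by (auto simp: coboundaries_def)
  have zc: "z \<in> cochains s" "hoch_diff z = (\<lambda>_. 0)"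
    using z by (auto simp: cyc_iff)
  have "cup z b = hoch_diff (cup z h)" "cup b z = hoch_diff (cup h z)"
    unfolding h(2) by (rule ext, simp add: zc h(1) cup_hoch_diff cochains_mlin cup_simps)+
  then show "z \<otimes>\<^bsub>cocycle_ring s\<^esub> b \<in> coboundaries s" "b \<otimes>\<^bsub>cocycle_ring s\<^esub> z \<in> coboundaries s"
    using h zc by (auto simp: cocycle_ring_def coboundaries_def)
qed

lemma ring_HH: "ring (HH s)"
  unfolding HH_def by (rule ideal.quotient_is_ring [OF ideal_coboundaries])

sublocale H: ring "HH s"
  by (rule ring_HH)

lemma hh_class_eq: "hh_class s f = (\<lambda>b xs. b xs + f xs) ` coboundaries s"
  by (auto simp: hh_class_def a_r_coset_def r_coset_def cocycle_ring_def)

lemma carrier_HH: "carrier (HH s) = hh_class s ` cyc"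
  by (auto simp: HH_def FactRing_def A_RCOSETS_def RCOSETS_def hh_class_def a_r_coset_def)

lemma hh_class_closed [simp]: "f \<in> cyc \<Longrightarrow> hh_class s f \<in> carrier (HH s)"
  by (simp add: carrier_HH)

lemma zero_coboundary: "(\<lambda>_. 0) \<in> coboundaries s"
  using hoch_diff_0 by (auto simp: coboundaries_def intro!: image_eqI [of _ _ "\<lambda>_. 0"])

lemma hh_class_self: "f \<in> hh_class s f"
  using zero_coboundary by (auto simp: hh_class_eq intro!: image_eqI [of _ _ "\<lambda>_. 0"])

lemma hh_class_cong:
  assumes "(\<lambda>xs. f xs + g xs) \<in> coboundaries s"
  shows "hh_class s f = hh_class s g"
proof -
  have "hh_class s f \<subseteq> hh_class s g" if "(\<lambda>xs. f xs + g xs) \<in> coboundaries s" for f g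
  proof
    fix z assume "z \<in> hh_class s f"
    then obtain b where b: "b \<in> coboundaries s" "z = (\<lambda>xs. b xs + f xs)"
      by (auto simp: hh_class_eq)
    have "(\<lambda>xs. b xs + (f xs + g xs)) \<in> coboundaries s"
      by (rule coboundaries_add [OF b(1) that])
    moreover have "z = (\<lambda>xs. (b xs + (f xs + g xs)) + g xs)"
      by (simp add: b(2) add.assoc double)
    ultimately show "z \<in> hh_class s g"
      unfolding hh_class_eq by (intro rev_image_eqI)
  qed
  from this [of f g] this [of g f] show ?thesis
    using assms by (simp add: add.commute)
qed

lemma hh_class_add:
  assumes "f \<in> cyc" "g \<in> cyc"
  shows "hh_class s f \<oplus>\<^bsub>HH s\<^esub> hh_class s g = hh_class s (\<lambda>xs. f xs + g xs)"
proof -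
  interpret ideal "coboundaries s" "cocycle_ring s" by (rule ideal_coboundaries)
  show ?thesis
    using a_rcos_sum [OF assms] by (simp add: HH_def FactRing_def hh_class_def) (simp add: cocycle_ring_def)
qed

lemma hh_class_mult:
  assumes "f \<in> cyc" "g \<in> cyc"
  shows "hh_class s f \<otimes>\<^bsub>HH s\<^esub> hh_class s g = hh_class s (cup f g)"
  using ideal.rcoset_mult_add [OF ideal_coboundaries assms]
  by (simp add: HH_def FactRing_def hh_class_def) (simp add: cocycle_ring_def)

lemma hh_class_one: "\<one>\<^bsub>HH s\<^esub> = hh_class s unit_cochain"
  by (simp add: HH_def FactRing_def hh_class_def) (simp add: cocycle_ring_def)

lemma hh_class_zero: "\<zero>\<^bsub>HH s\<^esub> = hh_class s (\<lambda>_. 0)"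
  by (simp add: HH_def FactRing_def hh_class_eq)

lemma HH_double: "a \<in> carrier (HH s) \<Longrightarrow> a \<oplus>\<^bsub>HH s\<^esub> a = \<zero>\<^bsub>HH s\<^esub>"
  by (auto simp: carrier_HH hh_class_add hh_class_zero double)

lemma UN_hh_class:
  assumes "\<And>g. g \<in> hh_class s f \<Longrightarrow> F g = (F f :: 'b set)"
  shows "(\<Union>g\<in>hh_class s f. F g) = F f"
  using assms hh_class_self by blast

lemma hh_scale_class:
  assumes "f \<in> cyc"
  shows "hh_scale s c (hh_class s f) = hh_class s (\<lambda>xs. s c (f xs))"
  unfolding hh_scale_def
proof (rule UN_hh_class)
  fix g assume "g \<in> hh_class s f"
  then obtain h where h: "h \<in> cochains s" "g = (\<lambda>xs. hoch_diff h xs + f xs)"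
    by (auto simp: hh_class_eq coboundaries_def)
  show "hh_class s (\<lambda>xs. s c (g xs)) = hh_class s (\<lambda>xs. s c (f xs))"
    by (rule hh_class_cong) (auto simp: h(2) coboundaries_def scale_right_distrib add.assoc double fun_eq_iff
        hoch_diff_scale cochains_mlin h(1) intro!: image_eqI [of _ _ "\<lambda>xs. s c (h xs)"])
qed

section \<open>The bracket on cohomology\<close>

lemma bracket_closed [simp]: "f \<in> cyc \<Longrightarrow> g \<in> cyc \<Longrightarrow> bracket f g \<in> cyc"
proof -
  assume fg: "f \<in> cyc" "g \<in> cyc"
  then have c: "f \<in> cochains s" "g \<in> cochains s" and d: "hoch_diff f = (\<lambda>_. 0)" "hoch_diff g = (\<lambda>_. 0)"
    by (auto simp: cyc_iff)
  have "bracket f g = (\<lambda>xs. ins f g xs + ins g f xs)"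
    by (simp add: bracket_eq fun_eq_iff)
  moreover have "hoch_diff (\<lambda>xs. ins f g xs + ins g f xs) xs = 0" for xs
    using c by (simp add: hoch_diff_add cochains_mlin ins_hoch_diff d ins_0_right ins_0_left char2_simps)
  ultimately show ?thesis
    using c by (auto simp: cyc_iff)
qed

text \<open>The bracket of \<open>h\<close> with the cocycle \<open>g\<close> is a primitive: in its
  differential both cup products of \<open>h\<close> and \<open>g\<close> occur twice.\<close>

lemma bracket_coboundary:
  assumes "h \<in> cochains s" "g \<in> cyc"
  shows "bracket (hoch_diff h) g \<in> coboundaries s"
proof -
  have g: "g \<in> cochains s" "hoch_diff g = (\<lambda>_. 0)"
    using assms(2) by (auto simp: cyc_iff)
  have "hoch_diff (\<lambda>xs. ins h g xs + ins g h xs) xs = ins (hoch_diff h) g xs + ins g (hoch_diff h) xs" for xs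
    using assms(1) g by (simp add: hoch_diff_add cochains_mlin ins_hoch_diff ins_0_right ins_0_left)
      (simp add: char2_simps)
  then have "bracket (hoch_diff h) g = hoch_diff (\<lambda>xs. ins h g xs + ins g h xs)"
    by (simp add: bracket_eq fun_eq_iff)
  then show ?thesis
    using assms(1) g(1) by (auto simp: coboundaries_def)
qed

lemma bracket_commute: "bracket f g (xs :: 'a list) = bracket g f xs"
  by (simp add: bracket_eq add.commute)

lemma bracket_add_left:
  assumes "f \<in> cochains s" "f' \<in> cochains s" "g \<in> cochains s"
  shows "bracket (\<lambda>xs. f xs + f' xs) g xs = bracket f g xs + bracket f' g xs"
  using assms by (simp add: bracket_eq ins_add_left ins_add_right cochains_mlin add_ac)

lemma bracket_class_cong:
  assumes "f \<in> cyc" "f' \<in> hh_class s f" "g \<in> cyc"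
  shows "hh_class s (bracket f' g) = hh_class s (bracket f g)"
proof -
  obtain h where h: "h \<in> cochains s" "f' = (\<lambda>xs. hoch_diff h xs + f xs)"
    using assms by (auto simp: hh_class_eq coboundaries_def)
  have "(\<lambda>xs. bracket f' g xs + bracket f g xs) = bracket (hoch_diff h) g"
    using assms(1,3) h(1) by (simp add: h(2) bracket_add_left cyc_iff add.assoc double fun_eq_iff)
  then show ?thesis
    using bracket_coboundary [OF h(1) assms(3)] by (intro hh_class_cong) simp
qed

lemma hh_class_cyc: "f \<in> cyc \<Longrightarrow> g \<in> hh_class s f \<Longrightarrow> g \<in> cyc"
  using coboundaries_subset by (auto simp: hh_class_eq)

text \<open>The union over all representatives collapses to one class, since changing either
  representative changes the bracket by a coboundary.\<close>

lemma hh_bracket_class: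
  assumes "f \<in> cyc" "g \<in> cyc"
  shows "hh_bracket s (hh_class s f) (hh_class s g) = hh_class s (bracket f g)"
proof -
  have "hh_class s (bracket f' g') = hh_class s (bracket f g)"
    if "f' \<in> hh_class s f" "g' \<in> hh_class s g" for f' g'
  proof -
    have "hh_class s (bracket f' g') = hh_class s (bracket f g')"
      by (rule bracket_class_cong) (use that assms hh_class_cyc in auto)
    also have "bracket f g' = bracket g' f" "bracket f g = bracket g f"
      by (rule ext, rule bracket_commute)+
    ultimately show ?thesis
      using bracket_class_cong [of g g' f] that assms by metis
  qed
  then show ?thesis
    unfolding hh_bracket_def using hh_class_self [of f] hh_class_self [of g] by blast
qed

lemma hh_bracket_closed [simp]:
  "a \<in> carrier (HH s) \<Longrightarrow> b \<in> carrier (HH s) \<Longrightarrow> hh_bracket s a b \<in> carrier (HH s)"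
  by (auto simp: carrier_HH hh_bracket_class simp del: hh_class_closed)

lemma hh_bracket_commute:
  "a \<in> carrier (HH s) \<Longrightarrow> b \<in> carrier (HH s) \<Longrightarrow> hh_bracket s a b = hh_bracket s b a"
proof (clarsimp simp: carrier_HH)
  fix f g assume fg: "f \<in> cyc" "g \<in> cyc"
  have "bracket f g = bracket g f"
    by (rule ext) (rule bracket_commute)
  then show "hh_bracket s (hh_class s f) (hh_class s g) = hh_bracket s (hh_class s g) (hh_class s f)"
    using fg by (simp add: hh_bracket_class)
qed

lemma hh_bracket_add:
  "a \<in> carrier (HH s) \<Longrightarrow> b \<in> carrier (HH s) \<Longrightarrow> c \<in> carrier (HH s) \<Longrightarrow>
   hh_bracket s (a \<oplus>\<^bsub>HH s\<^esub> b) c = hh_bracket s a c \<oplus>\<^bsub>HH s\<^esub> hh_bracket s b c"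
proof (clarsimp simp: carrier_HH)
  fix f g h assume fgh: "f \<in> cyc" "g \<in> cyc" "h \<in> cyc"
  then have "bracket (\<lambda>xs. f xs + g xs) h = (\<lambda>xs. bracket f h xs + bracket g h xs)"
    by (intro ext bracket_add_left) (auto simp: cyc_iff)
  then show "hh_bracket s (hh_class s f \<oplus>\<^bsub>HH s\<^esub> hh_class s g) (hh_class s h) =
      hh_bracket s (hh_class s f) (hh_class s h) \<oplus>\<^bsub>HH s\<^esub> hh_bracket s (hh_class s g) (hh_class s h)"
    using fgh by (simp add: hh_bracket_class hh_class_add)
qed

lemma hh_bracket_scale:
  "a \<in> carrier (HH s) \<Longrightarrow> b \<in> carrier (HH s) \<Longrightarrow>
   hh_bracket s (hh_scale s c a) b = hh_scale s c (hh_bracket s a b)"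
proof (clarsimp simp: carrier_HH)
  fix f g assume fg: "f \<in> cyc" "g \<in> cyc"
  have "bracket (\<lambda>xs. s c (f xs)) g xs = s c (bracket f g xs)" for xs
  proof -
    have "g (as @ s c a # cs) = s c (g (as @ a # cs))" for as a cs
      using fg multilinearD(2) by (metis cyc_iff cochains_mlin)
    then show ?thesis
      by (simp add: bracket_eq ins_def scale_right_distrib spl_eq_sum scale_sum_right)
  qed
  then have "bracket (\<lambda>xs. s c (f xs)) g = (\<lambda>xs. s c (bracket f g xs))" by (rule ext)
  then show "hh_bracket s (hh_scale s c (hh_class s f)) (hh_class s g) =
      hh_scale s c (hh_bracket s (hh_class s f) (hh_class s g))"
    using fg by (simp add: hh_scale_class hh_bracket_class)
qed

text \<open>The defect of the Poisson rule on cocycles is the differential of the double brace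
  \<open>h{f, g}\<close>.\<close>

lemma hh_bracket_mult:
  "a \<in> carrier (HH s) \<Longrightarrow> b \<in> carrier (HH s) \<Longrightarrow> c \<in> carrier (HH s) \<Longrightarrow>
   hh_bracket s (a \<otimes>\<^bsub>HH s\<^esub> b) c =
     (hh_bracket s a c \<otimes>\<^bsub>HH s\<^esub> b) \<oplus>\<^bsub>HH s\<^esub> (a \<otimes>\<^bsub>HH s\<^esub> hh_bracket s b c)"
proof (clarsimp simp: carrier_HH)
  fix f g h assume fgh: "f \<in> cyc" "g \<in> cyc" "h \<in> cyc"
  then have c: "f \<in> cochains s" "g \<in> cochains s" "h \<in> cochains s"
    and d: "hoch_diff f = (\<lambda>_. 0)" "hoch_diff g = (\<lambda>_. 0)" "hoch_diff h = (\<lambda>_. 0)"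
    by (auto simp: cyc_iff)
  have z: "ins2 h (\<lambda>_. 0) g xs = 0" "ins2 h f (\<lambda>_. 0) xs = 0" for xs
    using c additiveD(3,4) [of h] by (simp_all add: ins2_def cochains_mlin)
  have "bracket (cup f g) h xs + (cup (bracket f h) g xs + cup f (bracket g h) xs) = hoch_diff (ins2 h f g) xs"
    for xs
    using c by (simp add: bracket_eq [abs_def] cup_simps ins_cup_left ins_cup_right [of f g h] cochains_mlin d
        ins_0_left z) (simp add: char2_simps)
  then have "(\<lambda>xs. bracket (cup f g) h xs + (cup (bracket f h) g xs + cup f (bracket g h) xs)) \<in> coboundaries s"
    using c by (auto simp: coboundaries_def fun_eq_iff intro!: image_eqI [of _ _ "ins2 h f g"])
  then show "hh_bracket s (hh_class s f \<otimes>\<^bsub>HH s\<^esub> hh_class s g) (hh_class s h) =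
      (hh_bracket s (hh_class s f) (hh_class s h) \<otimes>\<^bsub>HH s\<^esub> hh_class s g) \<oplus>\<^bsub>HH s\<^esub>
      (hh_class s f \<otimes>\<^bsub>HH s\<^esub> hh_bracket s (hh_class s g) (hh_class s h))"
    using fgh by (simp add: hh_class_mult hh_bracket_class hh_class_add) (rule hh_class_cong)
qed

end

section \<open>The group algebra and its free bimodules\<close>

abbreviation "lu \<equiv> Poly_Mapping.lookup"
abbreviation "sg \<equiv> Poly_Mapping.single"

lemma vs_vscale [simp]: "vector_space vscale"
  by (rule vector_space_vscale)

lemma vscale_add [simp]: "vscale c (a + b) = vscale c a + vscale c b"
  by (rule poly_mapping_eqI) (simp add: lookup_vscale lookup_add algebra_simps)

lemma vscale_0 [simp]: "vscale c 0 = 0" "vscale 0 a = 0"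
  by (rule poly_mapping_eqI, simp add: lookup_vscale)+

lemma vscale_1 [simp]: "vscale 1 a = a"
  by (rule poly_mapping_eqI, simp add: lookup_vscale)

lemma vscale_sum: "vscale c (sum f S) = (\<Sum>i\<in>S. vscale c (f i))"
  by (induction S rule: infinite_finite_induct) auto

lemma vscale_vscale: "vscale c (vscale d a) = vscale (c * d) a"
  by (rule poly_mapping_eqI) (simp add: lookup_vscale mult.assoc)

lemma single_vscale: "sg g c = vscale c (sg g 1)"
  by (rule poly_mapping_eqI) (simp add: lookup_vscale lookup_single when_def)

lemma poly_mapping_expand: "(\<Sum>g\<in>UNIV. vscale (lu a g) (sg g 1)) = (a :: 'b::finite \<Rightarrow>\<^sub>0 'k::field)"
  by (rule poly_mapping_eqI)
    (simp add: lookup_sum lookup_vscale lookup_single when_def if_distrib [of "(*) c" for c] cong: if_cong)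

text \<open>Scaling is multiplication by \<open>sg 0 c\<close>, which is central because it commutes
  with every term of the expansion in group elements.\<close>

lemma vscale_mult:
  "vscale c a * b = vscale c (a * (b :: 'k::field kQ8))" "a * vscale c b = vscale c (a * b)"
proof -
  have v: "vscale c a = sg 0 c * a" for a :: "'k kQ8"
    by (simp add: vscale_def mult_map_scale_conv_mult)
  have "(\<Sum>g\<in>UNIV. sg g (lu a g)) * sg 0 c = sg 0 c * (\<Sum>g\<in>UNIV. sg g (lu a g))"
    by (simp add: sum_distrib_left sum_distrib_right mult_single mult.commute)
  moreover have "(\<Sum>g\<in>UNIV. sg g (lu a g)) = a"
    by (subst (2) poly_mapping_expand [of a, symmetric]) (simp add: single_vscale [of _ "lu a _"])
  ultimately have "a * sg 0 c = sg 0 c * a" by simp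
  then show "vscale c a * b = vscale c (a * b)" "a * vscale c b = vscale c (a * b)"
    unfolding v by (simp_all add: mult.assoc [symmetric])
qed

lemma lookup_tens: "lu (tens a s b) (u, t, v) = (if s = t then lu a u * lu b v else 0)"
proof -
  have "lu (tens a s b) (u, t, v) =
      (\<Sum>g\<in>UNIV. \<Sum>h\<in>UNIV. if h = v then (if g = u \<and> s = t then lu a g * lu b h else 0) else 0)"
    by (auto simp: tens_def lookup_sum lookup_single when_def intro!: sum.cong)
  also have "\<dots> = (\<Sum>g\<in>UNIV. if g = u then (if s = t then lu a g * lu b v else 0) else 0)"
    by (auto intro!: sum.cong)
  finally show ?thesis
    by simp
qed

lemma tens_linear:
  "tens (a + a') s b = tens a s b + tens a' s b" "tens a s (b + b') = tens a s b + tens a s b'"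
  "tens (vscale c a) s b = vscale c (tens a s b)" "tens a s (vscale c b) = vscale c (tens a s b)"
  "tens 0 s b = 0" "tens a s 0 = 0"
  by (rule poly_mapping_eqI, auto simp: lookup_tens lookup_add lookup_vscale algebra_simps)+

lemma tens_single: "tens (sg g 1) s (sg h 1) = sg (g, s, h) 1"
proof (rule poly_mapping_eqI)
  fix k :: "q8 \<times> cell \<times> q8"
  show "lu (tens (sg g 1) s (sg h 1)) k = lu (sg (g, s, h) 1) k"
    by (cases k) (auto simp: lookup_tens lookup_single when_def)
qed

abbreviation klin :: "(('b \<Rightarrow>\<^sub>0 'k::field) \<Rightarrow> ('c \<Rightarrow>\<^sub>0 'k)) \<Rightarrow> bool" where
  "klin \<equiv> Vector_Spaces.linear vscale vscale"

lemma klin_iff: "klin F \<longleftrightarrow> (\<forall>a b. F (a + b) = F a + F b) \<and> (\<forall>c a. F (vscale c a) = vscale c (F a))"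
  by (simp add: linear_iff')

lemma klin_0: "klin F \<Longrightarrow> F 0 = 0"
  by (metis klin_iff vscale_0(2))

lemma klin_sum: "klin F \<Longrightarrow> F (sum f S) = (\<Sum>i\<in>S. F (f i))"
  by (induction S rule: infinite_finite_induct) (auto simp: klin_iff klin_0)

lemma klin_eqI:
  fixes F G :: "('b::finite \<Rightarrow>\<^sub>0 'k::field) \<Rightarrow> ('c \<Rightarrow>\<^sub>0 'k)"
  assumes "klin F" "klin G" "\<And>g. F (sg g 1) = G (sg g 1)"
  shows "F p = G p"
proof -
  have "F (\<Sum>g\<in>UNIV. vscale (lu p g) (sg g 1)) = G (\<Sum>g\<in>UNIV. vscale (lu p g) (sg g 1))"
    using assms by (simp add: klin_sum) (simp add: klin_iff)
  then show ?thesis by (simp only: poly_mapping_expand)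
qed

lemma klin_tens_eqI:
  fixes F G :: "'k::field bimod \<Rightarrow> ('c \<Rightarrow>\<^sub>0 'k)"
  assumes "klin F" "klin G" "\<And>a s b. F (tens a s b) = G (tens a s b)"
  shows "F p = G p"
  by (rule klin_eqI [OF assms(1,2)]) (metis assms(3) prod_cases3 tens_single)

text \<open>Linear extension from the basis of group elements. \<open>act\<close>,
  \<open>bimod_map\<close> and \<open>alg_map\<close> all have this form, so \<open>ext_tens\<close>
  alone evaluates them on tensors with arbitrary entries.\<close>

definition ext :: "(q8 \<Rightarrow> cell \<Rightarrow> q8 \<Rightarrow> ('c \<Rightarrow>\<^sub>0 'k::field)) \<Rightarrow> 'k bimod \<Rightarrow> ('c \<Rightarrow>\<^sub>0 'k)" where
  "ext B p = (\<Sum>(g, s, h)\<in>UNIV. vscale (lu p (g, s, h)) (B g s h))"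

lemma vscale_add_left: "vscale (a + b) c = vscale a c + vscale b c"
  by (rule poly_mapping_eqI) (simp add: lookup_vscale lookup_add algebra_simps)

lemma klin_ext: "klin (ext B)"
  by (auto simp: klin_iff ext_def lookup_add lookup_vscale case_prod_unfold sum.distrib vscale_sum
      vscale_vscale vscale_add_left)

lemma ext_single: "ext B (sg (g, s, h) 1) = B g s h"
proof -
  have "ext B (sg (g, s, h) 1) = (\<Sum>i\<in>UNIV. if i = (g, s, h) then B g s h else 0)"
    unfolding ext_def by (rule sum.cong) (auto simp: lookup_single when_def split: if_splits)
  then show ?thesis by simp
qed

lemma ext_linear [simp]:
  "ext B (p + q) = ext B p + ext B q" "ext B (vscale c p) = vscale c (ext B p)" "ext B 0 = 0"
  using klin_ext [of B] klin_0 [OF klin_ext [of B]] by (auto simp: klin_iff)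

lemma ext_tens:
  assumes B: "\<And>s h. klin (\<lambda>a. B a s h)" "\<And>a s. klin (B a s)"
  shows "ext (\<lambda>g s h. B (sg g 1) s (sg h 1)) (tens a s b) = B a s b"
proof -
  let ?E = "ext (\<lambda>g s h. B (sg g 1) s (sg h 1))"
  have lin: "klin (\<lambda>a. ?E (tens a s c))" "klin (\<lambda>b. ?E (tens a s b))" for a c
    by (simp_all add: klin_iff tens_linear)
  have 1: "?E (tens a s (sg h 1)) = B a s (sg h 1)" for a h
    by (rule klin_eqI [OF lin(1) B(1)]) (simp add: tens_single ext_single)
  show ?thesis
    by (rule klin_eqI [OF lin(2) B(2)]) (rule 1)
qed

lemma act_eq_ext: "act a p b = ext (\<lambda>g s h. tens (a * sg g 1) s (sg h 1 * b)) p"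
  by (simp add: act_def ext_def)

lemma act_tens: "act a (tens b s c) d = tens (a * b) s (c * d)"
  unfolding act_eq_ext
  by (rule ext_tens [where B = "\<lambda>g s h. tens (a * g) s (h * d)"])
    (auto simp: klin_iff algebra_simps tens_linear vscale_mult)

lemma klin_act: "klin (\<lambda>p. act a p b)"
  unfolding act_eq_ext by (rule klin_ext)

lemma act_linear [simp]:
  "act a (p + q) b = act a p b + act a q b" "act a (vscale c p) b = vscale c (act a p b)" "act a 0 b = 0"
  using klin_act [of a b] klin_0 [OF klin_act [of a b]] by (auto simp: klin_iff)

lemma act_linear_left:
  "act (a + a') p b = act a p b + act a' p b" "act (vscale c a) p b = vscale c (act a p b)"
  "act a p (b + b') = act a p b + act a p b'" "act a p (vscale c b) = vscale c (act a p b)"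
  by (rule klin_tens_eqI [where p = p];
    simp add: klin_iff act_tens algebra_simps tens_linear vscale_mult vscale_vscale mult.commute)+

lemma act_act: "act a (act b p c) d = act (a * b) p (c * d)"
  by (rule klin_tens_eqI [where p = p]) (simp_all add: klin_iff act_tens mult.assoc)

lemma act_1: "act 1 p 1 = p"
  by (rule klin_tens_eqI [where p = p]) (simp_all add: klin_iff act_tens)

lemma bimod_map_eq_ext: "bimod_map v = ext (\<lambda>g s h. act (sg g 1) (v s) (sg h 1))"
  by (rule HOL.ext) (simp add: bimod_map_def ext_def)

lemma alg_map_eq_ext: "alg_map w = ext (\<lambda>g s h. sg g 1 * w s * sg h 1)"
  by (rule HOL.ext) (simp add: alg_map_def ext_def)

lemma bimod_map_tens: "bimod_map v (tens a s b) = act a (v s) b"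
  unfolding bimod_map_eq_ext
  by (rule ext_tens [where B = "\<lambda>g s h. act g (v s) h"]) (auto simp: klin_iff act_linear_left)

lemma alg_map_tens: "alg_map w (tens a s b) = a * w s * b"
  unfolding alg_map_eq_ext
  by (rule ext_tens [where B = "\<lambda>g s h. g * w s * h"]) (auto simp: klin_iff algebra_simps vscale_mult)

lemma klin_maps: "klin (bimod_map v)" "klin (alg_map w)"
  unfolding bimod_map_eq_ext alg_map_eq_ext by (rule klin_ext)+

lemma maps_linear [simp]:
  "bimod_map v (p + q) = bimod_map v p + bimod_map v q" "bimod_map v (vscale c p) = vscale c (bimod_map v p)"
  "alg_map w (p + q) = alg_map w p + alg_map w q" "alg_map w (vscale c p) = vscale c (alg_map w p)"
  "bimod_map v 0 = 0" "alg_map w 0 = 0"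
  using klin_maps(1) [of v] klin_maps(2) [of w] klin_0 [OF klin_maps(1) [of v]] klin_0 [OF klin_maps(2) [of w]]
  by (auto simp: klin_iff)

lemma bimod_map_act: "bimod_map v (act a p b) = act a (bimod_map v p) b"
  by (rule klin_tens_eqI [where p = p]) (simp_all add: klin_iff act_tens bimod_map_tens act_act)

lemma alg_map_act: "alg_map w (act a p b) = a * alg_map w p * b"
  by (rule klin_tens_eqI [where p = p])
    (simp_all add: klin_iff act_tens alg_map_tens mult.assoc algebra_simps vscale_mult)

lemma bimod_map_bimod_map: "bimod_map v (bimod_map u p) = bimod_map (\<lambda>s. bimod_map v (u s)) p"
  by (rule klin_tens_eqI [where p = p]) (simp_all add: klin_iff bimod_map_tens bimod_map_act)

lemma alg_map_bimod_map: "alg_map w (bimod_map u p) = alg_map (\<lambda>s. alg_map w (u s)) p"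
  by (rule klin_tens_eqI [where p = p]) (simp_all add: klin_iff bimod_map_tens alg_map_act alg_map_tens)

lemma bimod_map_0: "bimod_map (\<lambda>_. 0) p = 0" "alg_map (\<lambda>_. 0) p = 0"
  by (simp_all add: bimod_map_def alg_map_def case_prod_unfold)

lemma char2_poly_mapping:
  assumes "CHAR('k::field) = 2"
  shows "(p :: 'b \<Rightarrow>\<^sub>0 'k) + p = 0"
proof -
  have "(2::'k) = 0"
    using of_nat_CHAR [where 'a='k] assms by simp
  then have "(a::'k) + a = 0" for a
    by (metis mult_2 mult_zero_left)
  then show ?thesis
    by (intro poly_mapping_eqI) (simp add: lookup_add)
qed

section \<open>Pulling Hochschild cocycles back to a complex of free bimodules\<close>

locale res_complex =
  fixes D :: "nat \<Rightarrow> cell \<Rightarrow> 'k::field bimod"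
  assumes char_k: "CHAR('k) = 2"
    and aug_D: "alg_map (\<lambda>_. 1) (D (Suc 0) s) = 0"
    and D_D: "bimod_map (D (Suc n)) (D (Suc (Suc n)) s) = 0"
begin

sublocale char2_algebra "vscale :: 'k \<Rightarrow> 'k kQ8 \<Rightarrow> 'k kQ8"
proof -
  interpret vector_space "vscale :: 'k \<Rightarrow> 'k kQ8 \<Rightarrow> 'k kQ8"
    by (rule vector_space_vscale)
  show "char2_algebra (vscale :: 'k \<Rightarrow> 'k kQ8 \<Rightarrow> 'k kQ8)"
    by unfold_locales (simp_all add: vscale_mult char2_poly_mapping [OF char_k])
qed

lemma doubleP: "(p :: 'k bimod) + p = 0"
  by (rule char2_poly_mapping [OF char_k])

lemma aug_d: "alg_map (\<lambda>_. 1) (bimod_map (D (Suc 0)) p) = 0"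
  by (simp add: alg_map_bimod_map aug_D bimod_map_0)

lemma d_d: "bimod_map (D (Suc n)) (bimod_map (D (Suc (Suc n))) p) = 0"
  by (simp add: bimod_map_bimod_map D_D bimod_map_0)

text \<open>The left factor of \<open>a \<otimes> t \<otimes> b\<close> becomes an additional last
  argument. This is a contracting homotopy in the bar direction, available because the bimodules are
  free as left modules.\<close>

definition hh :: "('k kQ8 list \<Rightarrow> 'k bimod \<Rightarrow> 'k kQ8) \<Rightarrow> 'k kQ8 list \<Rightarrow> 'k bimod \<Rightarrow> 'k kQ8" where
  "hh F as = ext (\<lambda>g t h. F (as @ [sg g 1]) (tens 1 t (sg h 1)))"

text \<open>Elements of the double complex: multilinear in the list and right linear in the bimodule
  argument. The left action on the bimodule enters through the last face of
  \<open>dF\<close>.\<close>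

definition fam :: "('k kQ8 list \<Rightarrow> 'k bimod \<Rightarrow> 'k kQ8) \<Rightarrow> bool" where
  "fam F \<longleftrightarrow> (\<forall>as cs p. klin (\<lambda>a. F (as @ a # cs) p)) \<and> (\<forall>as. klin (F as)) \<and>
     (\<forall>as p c. F as (act 1 p c) = F as p * c)"

definition dF :: "('k kQ8 list \<Rightarrow> 'k bimod \<Rightarrow> 'k kQ8) \<Rightarrow> 'k kQ8 list \<Rightarrow> 'k bimod \<Rightarrow> 'k kQ8" where
  "dF F xs p = hd xs * F (tl xs) p + mrg (\<lambda>l. F l p) xs + F (butlast xs) (act (last xs) p 1)"

lemma hh_tens:
  assumes "fam F"
  shows "hh F as (tens a t b) = F (as @ [a]) (tens 1 t b)"
  unfolding hh_def
proof (rule ext_tens [where B = "\<lambda>a t b. F (as @ [a]) (tens 1 t b)"])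
  show "klin (\<lambda>a. F (as @ [a]) (tens 1 t h))" for t h
    using assms by (simp add: fam_def)
  have "klin (F (as @ [a]))" for a
    using assms by (simp add: fam_def)
  then show "klin (\<lambda>b. F (as @ [a]) (tens 1 t b))" for a t
    by (simp add: klin_iff tens_linear)
qed

lemma klin_slot_hh:
  assumes "fam F"
  shows "klin (\<lambda>a. hh F (as @ a # cs) p)"
proof -
  have *: "klin (\<lambda>a. F (as @ a # cs) p)" for as cs p
    using assms by (simp add: fam_def)
  show ?thesis
    using * [of as "cs @ [_]"]
    by (auto simp: klin_iff hh_def ext_def case_prod_unfold sum.distrib vscale_sum vscale_vscale mult.commute)
qed

lemma klin_hh: "klin (hh F as)"
  unfolding hh_def by (rule klin_ext)

lemma fam_hh:
  assumes "fam F"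
  shows "fam (hh F)"
  unfolding fam_def
proof (intro conjI allI klin_slot_hh [OF assms] klin_hh)
  fix as p c
  have F: "F as' (act 1 q c) = F as' q * c" for as' q
    using assms by (simp add: fam_def)
  show "hh F as (act 1 p c) = hh F as p * c"
  proof (rule klin_tens_eqI [where p = p])
    show "klin (\<lambda>p. hh F as (act 1 p c))" "klin (\<lambda>p. hh F as p * c)"
      using klin_hh [of F as] by (auto simp: klin_iff algebra_simps vscale_mult)
    show "hh F as (act 1 (tens a s b) c) = hh F as (tens a s b) * c" for a s b
      using F [of "as @ [a]" "tens 1 s b"] by (simp add: act_tens hh_tens [OF assms])
  qed
qed

lemma famD:
  assumes "fam F"
  shows "F as (p + q) = F as p + F as q" "F as (vscale c p) = vscale c (F as p)" "F as 0 = 0"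
    "F as (act 1 p b) = F as p * b"
  using assms klin_0 [of "F as"] by (auto simp: fam_def klin_iff)

lemma klin_mrg:
  assumes "\<And>l. klin (F l)"
  shows "klin (\<lambda>p. mrg (\<lambda>l. F l p) xs)"
proof -
  have "mrg (\<lambda>l. F l (p + q)) xs = mrg (\<lambda>l. F l p) xs + mrg (\<lambda>l. F l q) xs"
    "mrg (\<lambda>l. F l (vscale c p)) xs = vscale c (mrg (\<lambda>l. F l p) xs)" for p q c
    using assms by (simp_all add: klin_iff mrg_add mrg_hom [of "vscale c"])
  then show ?thesis by (simp add: klin_iff)
qed

lemma klin_dF:
  assumes "fam F"
  shows "klin (dF F xs)"
  using klin_mrg [of F xs] assms
  by (auto simp: dF_def klin_iff famD [OF assms] algebra_simps vscale_mult fam_def)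

text \<open>In the cocycle condition on \<open>xs @ [a]\<close> the last face is \<open>F xs\<close>
  at \<open>a \<otimes> t \<otimes> b\<close>, and the other faces are exactly those of
  \<open>dF (hh F)\<close> on \<open>xs\<close>.\<close>

lemma dF_hh:
  assumes F: "fam F" and xs: "xs \<noteq> []" and z: "\<And>a t b. dF F (xs @ [a]) (tens 1 t b) = 0"
  shows "dF (hh F) xs p = F xs p"
proof (rule klin_tens_eqI [OF klin_dF [OF fam_hh [OF F]]])
  show "klin (F xs)"
    using F by (simp add: fam_def)
  fix a t b
  obtain zs e where zs: "xs = zs @ [e]"
    using xs by (metis rev_exhaust)
  have "dF (hh F) xs (tens a t b) + F xs (tens a t b) = dF F (xs @ [a]) (tens 1 t b)"
  proof -
    have "mrg (\<lambda>l. F l (tens 1 t b)) (zs @ [e, a]) =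
        mrg (\<lambda>l. F (l @ [a]) (tens 1 t b)) (zs @ [e]) + F (zs @ [e * a]) (tens 1 t b)"
      by (rule mrg_snoc)
    moreover have "hd (zs @ [e, a]) = hd (zs @ [e])" "tl (zs @ [e, a]) = tl (zs @ [e]) @ [a]"
      "butlast (zs @ [e, a]) = zs @ [e]"
      by (cases zs; simp add: butlast_append)+
    ultimately show ?thesis
      by (simp add: dF_def hh_tens [OF F] act_tens zs add_ac del: mrg.simps)
  qed
  then show "dF (hh F) xs (tens a t b) = F xs (tens a t b)"
    unfolding z by (rule eqI)
qed

text \<open>A zigzag through the double complex: each step trades one bar argument for one degree of
  the resolution, starting from \<open>f\<close> times the augmentation.\<close>

primrec FF :: "('k kQ8 list \<Rightarrow> 'k kQ8) \<Rightarrow> nat \<Rightarrow> 'k kQ8 list \<Rightarrow> 'k bimod \<Rightarrow> 'k kQ8" where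
  "FF f 0 = (\<lambda>as p. f as * alg_map (\<lambda>_. 1) p)"
| "FF f (Suc j) = (\<lambda>as p. hh (FF f j) as (bimod_map (D (Suc j)) p))"

lemma fam_FF:
  assumes "mlin f"
  shows "fam (FF f j)"
proof (induction j)
  case 0
  have "klin (\<lambda>a. f (as @ a # cs))" for as cs
    using assms by (simp add: multilinear_iff)
  then show ?case
    by (auto simp: fam_def klin_iff algebra_simps vscale_mult alg_map_act)
next
  case (Suc j)
  note h = fam_hh [OF Suc]
  have "klin (\<lambda>a. hh (FF f j) (as @ a # cs) p)" for as cs p
    using h by (simp add: fam_def)
  then show ?case
    using famD [OF h] by (auto simp: fam_def klin_iff bimod_map_act)
qed

text \<open>The homotopy reduces \<open>dF\<close> of stage \<open>Suc j\<close> to stage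
  \<open>j\<close> composed with the differential. There two consecutive differentials meet, or for
  \<open>j = 0\<close> the augmentation and the first differential.\<close>

lemma dF_FF:
  assumes f: "mlin f" "hoch_diff f = (\<lambda>_. 0)" and xs: "xs \<noteq> []"
  shows "dF (FF f j) xs p = 0"
  using xs
proof (induction j arbitrary: xs p)
  case 0
  have "hoch_diff f xs = hd xs * f (tl xs) + mrg f xs + f (butlast xs) * last xs"
    using 0 by (simp add: hoch_diff_def bar_diff_char2 [OF double])
  then have z: "hd xs * f (tl xs) + mrg f xs + f (butlast xs) * last xs = 0"
    by (simp add: f(2))
  have "mrg (\<lambda>l. f l * alg_map (\<lambda>_. 1) p) xs = mrg f xs * alg_map (\<lambda>_. 1) p"
    by (rule mrg_hom [where h = "\<lambda>z. z * _", symmetric]) (simp_all add: algebra_simps)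
  then have "dF (FF f 0) xs p = (hd xs * f (tl xs) + mrg f xs + f (butlast xs) * last xs) * alg_map (\<lambda>_. 1) p"
    by (simp only: dF_def FF.simps alg_map_act mult_1_right distrib_right mult.assoc)
  then show ?case
    by (simp add: z)
next
  case (Suc j)
  have F: "fam (FF f j)" by (rule fam_FF [OF f(1)])
  have "dF (FF f (Suc j)) xs p = dF (hh (FF f j)) xs (bimod_map (D (Suc j)) p)"
    by (simp add: dF_def bimod_map_act)
  also have "\<dots> = FF f j xs (bimod_map (D (Suc j)) p)"
    by (rule dF_hh [OF F]) (use Suc in auto)
  also have "\<dots> = 0"
  proof (cases j)
    case 0
    then show ?thesis by (simp add: aug_d)
  next
    case (Suc i)
    then show ?thesis using famD(3) [OF fam_hh [OF fam_FF [OF f(1)]]] by (simp add: d_d)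
  qed
  finally show ?case .
qed

lemma FF_boundary:
  assumes "mlin f"
  shows "FF f j as (bimod_map (D (Suc j)) p) = 0"
proof (cases j)
  case 0
  then show ?thesis by (simp add: aug_d)
next
  case (Suc i)
  then show ?thesis using famD(3) [OF fam_hh [OF fam_FF [OF assms]]] by (simp add: d_d)
qed

definition pull :: "nat \<Rightarrow> ('k kQ8 list \<Rightarrow> 'k kQ8) \<Rightarrow> cell \<Rightarrow> 'k kQ8" where
  "pull n f t = FF f n [] (tens 1 t 1)"

text \<open>For a single argument the cocycle condition of \<open>dF\<close> is left linearity. The
  last stage is therefore a bimodule map, determined by its values on the free generators.\<close>

lemma FF_pull:
  assumes f: "mlin f" "hoch_diff f = (\<lambda>_. 0)"
  shows "FF f n [] p = alg_map (pull n f) p"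
proof (rule klin_tens_eqI [where p = p])
  show "klin (FF f n [])"
    using fam_FF [OF f(1)] by (simp add: fam_def)
  show "klin (alg_map (pull n f))"
    by (rule klin_maps)
  fix a t b
  have "dF (FF f n) [a] (tens 1 t b) = 0"
    by (rule dF_FF [OF f]) simp
  then have "FF f n [] (tens a t b) = a * FF f n [] (tens 1 t b)"
    by - (rule eqI, simp add: dF_def act_tens add.commute)
  also have "FF f n [] (tens 1 t b) = FF f n [] (tens 1 t 1) * b"
    using famD(4) [OF fam_FF [OF f(1)], of n "[]" "tens 1 t 1" b] by (simp add: act_tens)
  finally show "FF f n [] (tens a t b) = alg_map (pull n f) (tens a t b)"
    by (simp add: pull_def alg_map_tens mult.assoc)
qed

lemma pull_cocycle:
  assumes f: "mlin f" "hoch_diff f = (\<lambda>_. 0)"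
  shows "alg_map (pull n f) (D (Suc n) t) = 0"
proof -
  have "alg_map (pull n f) (bimod_map (D (Suc n)) (tens 1 t 1)) = 0"
    using FF_boundary [OF f(1)] by (simp flip: FF_pull [OF f])
  then show ?thesis by (simp add: bimod_map_tens act_1)
qed

section \<open>From the double complex to cohomology classes\<close>

text \<open>An element of the double complex is spliced with the chain map \<open>\<Phi>\<close>
  into a cochain of degree \<open>n - 1\<close>, whose differential will compare two stages of the
  zigzag.\<close>

definition EE :: "nat \<Rightarrow> nat \<Rightarrow> ('k kQ8 list \<Rightarrow> 'k bimod \<Rightarrow> 'k kQ8) \<Rightarrow> ('k kQ8 list \<Rightarrow> 'k bimod) \<Rightarrow>
    'k kQ8 list \<Rightarrow> 'k kQ8" where
  "EE n q G \<Phi> xs = (if Suc (length xs) = n then G (take q xs) (\<Phi> (drop q xs)) else 0)"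

lemma mlin_EE:
  assumes G: "fam G" and \<Phi>: "multilinear vscale vscale \<Phi>"
  shows "mlin (EE n q G \<Phi>)"
  unfolding multilinear_iff
proof (intro allI)
  fix as cs :: "'k kQ8 list"
  have 1: "klin (\<lambda>a. G (as @ a # cs) p)" "klin (G as)" for as cs p
    using G by (auto simp: fam_def)
  have 2: "klin (\<lambda>a. \<Phi> (as @ a # cs))" for as cs
    using \<Phi> by (simp add: multilinear_iff)
  have "klin (\<lambda>a. G (take q (as @ a # cs)) (\<Phi> (drop q (as @ a # cs))))"
  proof (cases "q \<le> length as")
    case True
    then show ?thesis using 2 1(2) [of "take q as"] by (auto simp: klin_iff)
  next
    case False
    then obtain r where "q = length as + Suc r"
      by (metis add_Suc_right less_imp_Suc_add not_le)
    then show ?thesis using 1(1) by simp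
  qed
  then show "klin (\<lambda>a. EE n q G \<Phi> (as @ a # cs))"
    by (cases "Suc (length (as @ cs)) + 1 = n") (auto simp: EE_def klin_iff)
qed

text \<open>The faces are sorted by the entry \<open>c\<close>: those to its left belong to
  \<open>dF G\<close>, those to its right form the bar differential of \<open>\<Phi>\<close>, which
  the chain map property converts into \<open>D\<close>. The term where \<open>c\<close> acts on
  \<open>\<Phi> bs\<close> occurs in both summands and cancels.\<close>

lemma hoch_diff_EE:
  assumes G: "fam G" and \<Phi>: "multilinear vscale vscale \<Phi>"
    and chain: "\<And>xs. xs \<noteq> [] \<Longrightarrow> bimod_map (D (length xs)) (\<Phi> xs) = bar_diff (\<lambda>a p. act a p 1) (\<lambda>p a. act 1 p a) \<Phi> xs"
    and len: "length as = q" "length bs = j" "n = Suc (q + j)"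
  shows "hoch_diff (EE n q G \<Phi>) (as @ c # bs) =
    dF G (as @ [c]) (\<Phi> bs) + G as (bimod_map (D (Suc j)) (\<Phi> (c # bs)))"
proof -
  let ?E = "EE n q G \<Phi>" and ?xs = "as @ c # bs"
  have "bar_diff (\<lambda>a p. act a p 1) (\<lambda>p a. act 1 p a) \<Phi> (c # bs) =
      act c (\<Phi> bs) 1 + mrg \<Phi> (c # bs) + act 1 (\<Phi> (butlast (c # bs))) (last (c # bs))"
    by (subst bar_diff_char2 [OF doubleP]) simp_all
  then have d: "bimod_map (D (Suc j)) (\<Phi> (c # bs)) =
      act c (\<Phi> bs) 1 + mrg \<Phi> (c # bs) + act 1 (\<Phi> (butlast (c # bs))) (last (c # bs))"
    using chain [of "c # bs"] len by simp
  have 1: "hoch_diff ?E ?xs = hd ?xs * ?E (tl ?xs) + mrg ?E ?xs + ?E (butlast ?xs) * last ?xs"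
    by (simp only: hoch_diff_def bar_diff_char2 [OF double] append_is_Nil_conv list.distinct if_False simp_thms)
  have 2: "hd ?xs * ?E (tl ?xs) = hd (as @ [c]) * G (tl (as @ [c])) (\<Phi> bs)"
  proof -
    have "n = Suc (length as + length bs)"
      using len by simp
    then show ?thesis
      unfolding len(1) [symmetric] by (cases as) (simp_all add: EE_def)
  qed
  have 3: "mrg ?E ?xs = mrg (\<lambda>l. G l (\<Phi> bs)) (as @ [c]) + G as (mrg \<Phi> (c # bs))"
  proof -
    have "mrg (\<lambda>l. ?E (l @ bs)) (as @ [c]) = mrg (\<lambda>l. G l (\<Phi> bs)) (as @ [c])"
      by (rule mrg_cong) (use len in \<open>simp add: EE_def\<close>)
    moreover have "mrg (\<lambda>l. ?E (as @ l)) (c # bs) = mrg (\<lambda>l. G as (\<Phi> l)) (c # bs)"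
      by (rule mrg_cong) (use len in \<open>simp add: EE_def\<close>)
    moreover have "G as (mrg \<Phi> (c # bs)) = mrg (\<lambda>l. G as (\<Phi> l)) (c # bs)"
      by (rule mrg_hom) (simp_all add: famD [OF G])
    ultimately show ?thesis
      unfolding mrg_append [of ?E as c bs] by (simp only:)
  qed
  have 4: "?E (butlast ?xs) * last ?xs = G as (act 1 (\<Phi> (butlast (c # bs))) (last (c # bs)))"
    using len by (cases bs rule: rev_exhaust) (simp_all add: EE_def famD [OF G] butlast_append)
  have 5: "dF G (as @ [c]) (\<Phi> bs) = hd (as @ [c]) * G (tl (as @ [c])) (\<Phi> bs) +
      mrg (\<lambda>l. G l (\<Phi> bs)) (as @ [c]) + G as (act c (\<Phi> bs) 1)"
    by (simp only: dF_def butlast_snoc last_snoc)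
  have 6: "a + (b + e) + h = a + b + g + (g + e + h)" for a b e g h :: "'k kQ8"
    by (simp add: add.assoc double_left)
  show ?thesis
    unfolding 1 2 3 4 5 d famD(1) [OF G] by (rule 6)
qed

lemma hoch_diff_EE_other: "length xs \<noteq> n \<Longrightarrow> hoch_diff (EE n q G \<Phi>) xs = 0"
proof (cases "xs = []")
  case False
  assume "length xs \<noteq> n"
  moreover have "mrg (EE n q G \<Phi>) xs = mrg (\<lambda>_. 0) xs"
    by (rule mrg_cong) (use \<open>length xs \<noteq> n\<close> in \<open>simp add: EE_def\<close>)
  moreover have "mrg (\<lambda>_. 0) xs = (0 :: 'k kQ8)" for xs :: "'k kQ8 list"
    using mrg_hom [of "\<lambda>_. 0 :: 'k kQ8" "\<lambda>_. 0 :: 'k kQ8" xs] by simp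
  ultimately show ?thesis
    using False by (simp add: hoch_diff_def bar_diff_char2 [OF double] EE_def)
qed (simp add: hoch_diff_def)

text \<open>
  The step of the zigzag in the double complex \<open>Hom(A\<^sup>\<otimes>\<^sup>q \<otimes> P\<^sub>j, A)\<close>: evaluating on \<open>\<Phi>\<close> turns
  \<^term>\<open>FF f j\<close> into a cochain whose class does not depend on \<open>j\<close>.
\<close>

lemma class_eq_pull:
  assumes f: "f \<in> cyc" "homogeneous n f"
    and \<Phi>: "multilinear vscale vscale \<Phi>" "alg_map (\<lambda>_. 1) (\<Phi> []) = 1"
    and chain: "\<And>xs. xs \<noteq> [] \<Longrightarrow> bimod_map (D (length xs)) (\<Phi> xs) = bar_diff (\<lambda>a p. act a p 1) (\<lambda>p a. act 1 p a) \<Phi> xs"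
  shows "hh_class vscale f = hh_class vscale (\<lambda>xs. if length xs = n then alg_map (pull n f) (\<Phi> xs) else 0)"
proof -
  have fm: "mlin f" "hoch_diff f = (\<lambda>_. 0)"
    using f(1) by (auto simp: cyc_iff cochains_mlin)
  define e where "e = (\<lambda>j xs. if length xs = n then FF f j (take (n - j) xs) (\<Phi> (drop (n - j) xs)) else 0)"
  have step: "hh_class vscale (e j) = hh_class vscale (e (Suc j))" if "j < n" for j
  proof (rule hh_class_cong)
    define q where "q = n - Suc j"
    have n: "n = Suc (q + j)" using that by (simp add: q_def)
    let ?G = "hh (FF f j)"
    have G: "fam ?G" by (intro fam_hh fam_FF fm)
    \<comment> \<open>The two summands of \<open>hoch_diff_EE\<close> are the two stages:
      \<open>dF_hh\<close> gives back \<open>FF f j\<close>, and \<open>hh\<close> after the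
      differential is \<open>FF f (Suc j)\<close> by definition.\<close>
    have "(\<lambda>xs. e j xs + e (Suc j) xs) = hoch_diff (EE n q ?G \<Phi>)"
    proof
      fix xs :: "'k kQ8 list"
      show "e j xs + e (Suc j) xs = hoch_diff (EE n q ?G \<Phi>) xs"
      proof (cases "length xs = n")
        case True
        define as c bs where "as = take q xs" "c = xs ! q" "bs = drop (Suc q) xs"
        have xs: "xs = as @ c # bs" and l: "length as = q" "length bs = j"
          using True n by (auto simp: as_c_bs_def id_take_nth_drop)
        have "dF ?G (as @ [c]) (\<Phi> bs) = FF f j (as @ [c]) (\<Phi> bs)"
          by (rule dF_hh [OF fam_FF [OF fm(1)]]) (auto intro: dF_FF [OF fm])
        then have "hoch_diff (EE n q ?G \<Phi>) xs =
            FF f j (as @ [c]) (\<Phi> bs) + ?G as (bimod_map (D (Suc j)) (\<Phi> (c # bs)))"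
          unfolding xs using hoch_diff_EE [OF G \<Phi>(1) chain l n, of c] by simp
        then show ?thesis
          unfolding xs using l n by (simp add: e_def)
      qed (simp add: e_def hoch_diff_EE_other)
    qed
    moreover have "EE n q ?G \<Phi> \<in> cochains vscale"
    proof -
      have "bounded_deg (EE n q ?G \<Phi>)"
        unfolding bounded_deg_def by (rule exI [of _ n]) (simp add: EE_def)
      then show ?thesis by (simp add: cochains_iff mlin_EE [OF G \<Phi>(1)])
    qed
    ultimately show "(\<lambda>xs. e j xs + e (Suc j) xs) \<in> coboundaries vscale"
      by (simp add: coboundaries_def)
  qed
  have "hh_class vscale (e 0) = hh_class vscale (e j)" if "j \<le> n" for j
    using that
  proof (induction j)
    case (Suc j)
    then show ?case using step [of j] by (metis Suc_le_lessD less_imp_le)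
  qed simp
  moreover have "e 0 = f"
    using f(2) \<Phi>(2) by (auto simp: e_def homogeneous_def fun_eq_iff)
  moreover have "e n = (\<lambda>xs. if length xs = n then alg_map (pull n f) (\<Phi> xs) else 0)"
    by (auto simp: e_def FF_pull [OF fm] fun_eq_iff)
  ultimately show ?thesis by (metis order_refl)
qed

end

section \<open>Symbolic computation with monomials over the two-element field\<close>

datatype mon = mI | mX | mY | mXY | mYX | mXYX | mYXY | mW

abbreviation "mons \<equiv> [mI, mX, mY, mXY, mYX, mXYX, mYXY, mW]"

lemma UNIV_mon: "UNIV = set mons"
  using mon.exhaust by auto

instance mon :: finite
  by standard (simp add: UNIV_mon)

text \<open>
  A product of basis monomials is a basis monomial or zero; the product is returned as a list with
  at most one element.  The element \<open>mW\<close> is \<open>xyxy = yxyx\<close>.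
\<close>

fun mulx :: "mon \<Rightarrow> mon list" where
  "mulx mI = [mX]" | "mulx mX = [mYXY]" | "mulx mY = [mXY]" | "mulx mXY = []"
| "mulx mYX = [mXYX]" | "mulx mXYX = []" | "mulx mYXY = [mW]" | "mulx mW = []"

fun muly :: "mon \<Rightarrow> mon list" where
  "muly mI = [mY]" | "muly mX = [mYX]" | "muly mY = [mXYX]" | "muly mXY = [mYXY]"
| "muly mYX = []" | "muly mXYX = [mW]" | "muly mYXY = []" | "muly mW = []"

definition bnd :: "('a \<Rightarrow> 'b list) \<Rightarrow> 'a list \<Rightarrow> 'b list" where
  "bnd f l = concat (map f l)"

fun mulm :: "mon \<Rightarrow> mon \<Rightarrow> mon list" where
  "mulm mI m = [m]" | "mulm mX m = mulx m" | "mulm mY m = muly m"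
| "mulm mXY m = bnd mulx (muly m)" | "mulm mYX m = bnd muly (mulx m)"
| "mulm mXYX m = bnd mulx (bnd muly (mulx m))" | "mulm mYXY m = bnd muly (bnd mulx (muly m))"
| "mulm mW m = bnd mulx (bnd muly (bnd mulx (muly m)))"

definition mulL :: "mon list \<Rightarrow> mon list \<Rightarrow> mon list" where
  "mulL l k = bnd (\<lambda>a. bnd (mulm a) k) l"

fun tog :: "'a \<Rightarrow> 'a list \<Rightarrow> 'a list" where
  "tog e [] = [e]"
| "tog e (a # l) = (if e = a then l else a # tog e l)"

text \<open>Equal entries cancel in pairs, so a formal sum vanishes in characteristic two if its
  normal form is \<open>[]\<close>; all tables below are checked in this shape.\<close>

definition nrm :: "'a list \<Rightarrow> 'a list" where
  "nrm l = foldr tog l []"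

type_synonym tri = "mon \<times> cell \<times> mon"

definition actL :: "mon \<Rightarrow> tri list \<Rightarrow> mon \<Rightarrow> tri list" where
  "actL a l c = bnd (\<lambda>(b, t, e). bnd (\<lambda>b'. map (\<lambda>e'. (b', t, e')) (mulm e c)) (mulm a b)) l"

text \<open>A contracting homotopy that is linear on the right, given on
  \<open>m \<otimes> t \<otimes> 1\<close>. In degree 0 it is the noncommutative derivative of
  \<open>m\<close>, where \<open>xyx\<close>, \<open>yxy\<close> and \<open>xyxy\<close> are read as
  \<open>yy\<close>, \<open>xx\<close> and \<open>xxx\<close>. In degree 3 it extracts the
  coefficient of \<open>xyxy\<close> in the left factor, the form to which the dual basis in
  \<open>\<rho>\<close> belongs. The remaining entries are justified by
  \<open>table_homotopy\<close>.\<close>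

definition TL :: "nat \<Rightarrow> mon \<Rightarrow> cell \<Rightarrow> (mon \<times> cell \<times> mon) list" where
  "TL i m t =
    (if i = 0 then (case t of Pt \<Rightarrow> (case m of mX \<Rightarrow> [(mI, Gx, mI)]
          | mY \<Rightarrow> [(mI, Gy, mI)]
          | mXY \<Rightarrow> [(mI, Gx, mY), (mX, Gy, mI)]
          | mYX \<Rightarrow> [(mI, Gy, mX), (mY, Gx, mI)]
          | mXYX \<Rightarrow> [(mI, Gy, mY), (mY, Gy, mI)]
          | mYXY \<Rightarrow> [(mI, Gx, mX), (mX, Gx, mI)]
          | mW \<Rightarrow> [(mI, Gx, mYXY), (mX, Gx, mX), (mYXY, Gx, mI)] | _ \<Rightarrow> []) | _ \<Rightarrow> [])
     else if i = 1 then (case t of Gx \<Rightarrow> (case m of mXY \<Rightarrow> [(mI, Ry, mI)]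
          | mYX \<Rightarrow> [(mI, Ry, mXY), (mY, Rx, mI), (mXY, Rx, mY)]
          | mXYX \<Rightarrow> [(mI, Ry, mX), (mX, Ry, mXY), (mXY, Rx, mI)]
          | mW \<Rightarrow> [(mI, Rx, mYXY), (mYX, Ry, mXY), (mYXY, Rx, mI)] | _ \<Rightarrow> []) |
        Gy \<Rightarrow> (case m of mXY \<Rightarrow> [(mI, Rx, mYX), (mX, Ry, mI), (mYX, Ry, mX)]
          | mYX \<Rightarrow> [(mI, Rx, mI)]
          | mXYX \<Rightarrow> [(mI, Rx, mX), (mY, Ry, mI)]
          | mYXY \<Rightarrow> [(mI, Rx, mY), (mY, Rx, mYX), (mYX, Ry, mI)]
          | mW \<Rightarrow> [(mX, Rx, mY), (mXY, Rx, mYX), (mXYX, Ry, mI)] | _ \<Rightarrow> []) | _ \<Rightarrow> [])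
     else if i = 2 then (case t of Rx \<Rightarrow> (case m of mX \<Rightarrow> [(mI, Pt, mI)]
          | mYX \<Rightarrow> [(mI, Pt, mY), (mY, Pt, mI)]
          | mXYX \<Rightarrow> [(mI, Pt, mXY), (mX, Pt, mY), (mXY, Pt, mI)]
          | mW \<Rightarrow> [(mI, Pt, mYXY), (mY, Pt, mXY), (mYX, Pt, mY), (mYXY, Pt, mI)] | _ \<Rightarrow> []) |
        Ry \<Rightarrow> (case m of mXY \<Rightarrow> [(mI, Pt, mX), (mX, Pt, mI)]
          | mXYX \<Rightarrow> [(mI, Pt, mY)]
          | mYXY \<Rightarrow> [(mI, Pt, mYX), (mY, Pt, mX), (mYX, Pt, mI)]
          | mW \<Rightarrow> [(mX, Pt, mYX), (mXY, Pt, mX), (mXYX, Pt, mI)] | _ \<Rightarrow> []) | _ \<Rightarrow> [])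
     else (case t of Pt \<Rightarrow> (case m of mW \<Rightarrow> [(mI, Pt, mI)] | _ \<Rightarrow> []) | _ \<Rightarrow> []))"

text \<open>The index is the degree modulo 4, so 0 stands for the differentials of degrees 4, 8 and
  so on.\<close>

definition DL :: "nat \<Rightarrow> cell \<Rightarrow> (mon \<times> cell \<times> mon) list" where
  "DL i t =
    (if i = 1 then (case t of Gx \<Rightarrow> [(mX, Pt, mI), (mI, Pt, mX)] |
        Gy \<Rightarrow> [(mY, Pt, mI), (mI, Pt, mY)] | _ \<Rightarrow> [])
     else if i = 2 then (case t of Rx \<Rightarrow> [(mI, Gx, mX), (mX, Gx, mI), (mI, Gy, mXY), (mY, Gx, mY), (mYX, Gy, mI)] |
        Ry \<Rightarrow> [(mI, Gy, mY), (mY, Gy, mI), (mI, Gx, mYX), (mX, Gy, mX), (mXY, Gx, mI)] | _ \<Rightarrow> [])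
     else if i = 3 then (case t of Pt \<Rightarrow> [(mX, Rx, mI), (mI, Rx, mX), (mY, Ry, mI), (mI, Ry, mY)] | _ \<Rightarrow> [])
     else (case t of Pt \<Rightarrow> [(mW, Pt, mI), (mYXY, Pt, mX), (mXYX, Pt, mY), (mXY, Pt, mXY), (mYX, Pt, mYX), (mY, Pt, mXYX), (mX, Pt, mYXY), (mI, Pt, mW)] | _ \<Rightarrow> []))"

definition bimodL :: "(mon \<Rightarrow> cell \<Rightarrow> tri list) \<Rightarrow> tri list \<Rightarrow> tri list" where
  "bimodL v l = bnd (\<lambda>(a, t, c). actL mI (v a t) c) l"

definition dL :: "nat \<Rightarrow> tri list \<Rightarrow> tri list" where
  "dL i = bimodL (\<lambda>a t. actL a (DL i t) mI)"

definition tL :: "nat \<Rightarrow> tri list \<Rightarrow> tri list" where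
  "tL i = bimodL (TL i)"

definition algL :: "(cell \<Rightarrow> mon list) \<Rightarrow> tri list \<Rightarrow> mon list" where
  "algL w l = bnd (\<lambda>(a, t, c). mulL [a] (mulL (w t) [c])) l"

fun cellL :: "nat \<Rightarrow> cell list" where
  "cellL i = (if i = 1 then [Gx, Gy] else if i = 2 then [Rx, Ry] else [Pt])"

abbreviation "all_cells \<equiv> [Pt, Gx, Gy, Rx, Ry]"

lemma table_D_D:
  "list_all (\<lambda>t. nrm (algL (\<lambda>_. [mI]) (DL 1 t)) = []) all_cells"
  "list_all (\<lambda>t. nrm (dL 1 (DL 2 t)) = [] \<and> nrm (dL 2 (DL 3 t)) = [] \<and> nrm (dL 3 (DL 0 t)) = [] \<and>
     nrm (dL 0 (DL 1 t)) = []) all_cells"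
  by code_simp+

text \<open>In degree 0 the augmentation followed by \<open>a \<mapsto> 1 \<otimes> a\<close> takes
  the place of the term with homotopy after differential.\<close>

lemma table_homotopy0:
  "list_all (\<lambda>m. nrm ((m, Pt, mI) # dL 1 (TL 0 m Pt) @ [(mI, Pt, m)]) = []) mons"
  by code_simp

text \<open>The identity \<open>1 + d t + t d = 0\<close>, one line for each residue of the degree
  modulo 4. The last line concerns positive multiples of 4, where \<open>TL 3\<close> after the
  differential yields \<open>1 \<otimes> m\<close>, as the augmentation does in degree 0.\<close>

lemma table_homotopy:
  "list_all (\<lambda>m. list_all (\<lambda>t. nrm ((m, t, mI) # dL 2 (TL 1 m t) @ tL 0 (dL 1 [(m, t, mI)])) = []) (cellL 1)) mons"
  "list_all (\<lambda>m. list_all (\<lambda>t. nrm ((m, t, mI) # dL 3 (TL 2 m t) @ tL 1 (dL 2 [(m, t, mI)])) = []) (cellL 2)) mons"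
  "list_all (\<lambda>m. list_all (\<lambda>t. nrm ((m, t, mI) # dL 0 (TL 3 m t) @ tL 2 (dL 3 [(m, t, mI)])) = []) (cellL 3)) mons"
  "list_all (\<lambda>m. list_all (\<lambda>t. nrm ((m, t, mI) # dL 1 (TL 0 m t) @ tL 3 (dL 0 [(m, t, mI)])) = []) (cellL 0)) mons"
  by code_simp+

lemma table_TL_cells:
  "list_all (\<lambda>m. list_all (\<lambda>t. list_all (\<lambda>(a, u, b). u \<in> {Gx, Gy}) (TL 0 m t) \<and>
     list_all (\<lambda>(a, u, b). u \<in> {Rx, Ry}) (TL 1 m t) \<and> list_all (\<lambda>(a, u, b). u = Pt) (TL 2 m t) \<and>
     list_all (\<lambda>(a, u, b). u = Pt) (TL 3 m t)) all_cells) mons"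
  by code_simp

text \<open>The usual recursion for a chain map out of the bar resolution: multiply the image of the
  tail by the first argument and apply the homotopy.\<close>

fun phiL :: "mon list \<Rightarrow> tri list" where
  "phiL [] = [(mI, Pt, mI)]"
| "phiL (m # ms) = nrm (tL (length ms mod 4) (actL m (phiL ms) mI))"

fun wL :: "gen \<Rightarrow> cell \<Rightarrow> mon list" where
  "wL P1 t = (case t of Pt \<Rightarrow> [mXY, mYX] | _ \<Rightarrow> [])"
| "wL P2 t = (case t of Pt \<Rightarrow> [mXYX] | _ \<Rightarrow> [])"
| "wL P2' t = (case t of Pt \<Rightarrow> [mYXY] | _ \<Rightarrow> [])"
| "wL P3 t = (case t of Pt \<Rightarrow> [mW] | _ \<Rightarrow> [])"
| "wL U1 t = (case t of Pt \<Rightarrow> [] | Gx \<Rightarrow> [mI, mXY] | Rx \<Rightarrow> [mI, mXY] | _ \<Rightarrow> [mX])"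
| "wL U1' t = (case t of Pt \<Rightarrow> [] | Gx \<Rightarrow> [mY] | Rx \<Rightarrow> [mY] | _ \<Rightarrow> [mI, mYX])"
| "wL V1 t = (case t of Pt \<Rightarrow> [] | Gx \<Rightarrow> [mY] | Rx \<Rightarrow> [mY] | _ \<Rightarrow> [mX])"
| "wL V2 t = (case t of Gx \<Rightarrow> [mX] | Rx \<Rightarrow> [mX] | _ \<Rightarrow> [])"
| "wL V2' t = (case t of Gy \<Rightarrow> [mY] | Ry \<Rightarrow> [mY] | _ \<Rightarrow> [])"
| "wL Z t = (case t of Pt \<Rightarrow> [mI] | _ \<Rightarrow> [])"

definition cL :: "gen \<Rightarrow> mon list \<Rightarrow> mon list" where
  "cL g ms = nrm (algL (wL g) (phiL ms))"

text \<open>A comparison in the opposite direction. The image of the generator \<open>t\<close> in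
  the bar resolution is found by applying the differential repeatedly and turning each left
  coefficient into a bar argument; the right coefficients are multiplied up in the second
  component.\<close>

fun psi :: "nat \<Rightarrow> cell \<Rightarrow> (mon list \<times> mon) list" where
  "psi 0 t = [([], mI)]"
| "psi (Suc j) t = bnd (\<lambda>(b, u, c). bnd (\<lambda>(ms, d). map (Pair (b # ms)) (mulm d c)) (psi j u)) (DL (Suc j mod 4) t)"

definition pullL :: "nat \<Rightarrow> (mon list \<Rightarrow> mon list) \<Rightarrow> cell \<Rightarrow> mon list" where
  "pullL n F t = nrm (bnd (\<lambda>(ms, e). mulL (F ms) [e]) (psi n t))"

definition brk1 :: "nat \<Rightarrow> nat \<Rightarrow> (mon list \<Rightarrow> mon list) \<Rightarrow> (mon list \<Rightarrow> mon list) \<Rightarrow> mon list \<Rightarrow> mon list" where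
  "brk1 n m F G ms = bnd (\<lambda>i. bnd (\<lambda>e. F (take i ms @ e # drop (i + m) ms)) (G (take m (drop i ms)))) [0..<n]"

definition brkL :: "gen \<Rightarrow> gen \<Rightarrow> mon list \<Rightarrow> mon list" where
  "brkL g h ms = brk1 (gen_deg g) (gen_deg h) (cL g) (cL h) ms @ brk1 (gen_deg h) (gen_deg g) (cL h) (cL g) ms"

fun cML :: "gen list \<Rightarrow> mon list \<Rightarrow> mon list" where
  "cML [] ms = [mI]"
| "cML (g # gs) ms = mulL (cL g (take (gen_deg g) ms)) (cML gs (drop (gen_deg g) ms))"

section \<open>Certificates for cocycles, spanning and brackets\<close>

lemma table_cocycles:
  "list_all (\<lambda>g. list_all (\<lambda>t. nrm (algL (wL g) (DL (Suc (gen_deg g) mod 4) t)) = []) all_cells)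
     [P1, P2, P2', P3, U1, U1', V1, V2, V2', Z]"
  by code_simp

text \<open>The explicit cocycle of a generator pulls back to the defining map of the generator
  itself, not merely to a cohomologous one.\<close>

lemma table_pull:
  "list_all (\<lambda>g. list_all (\<lambda>t. nrm (pullL (gen_deg g) (cL g) t @ wL g t) = []) (cellL (gen_deg g mod 4)))
     [P1, P2, P2', P3, U1, U1', V1, V2, V2', Z]"
  by code_simp

text \<open>
  An element of \<open>Hom(P\<^sub>n, A)\<close> is a list of pairs \<open>(t, m)\<close>, each standing for the map that sends the
  generator \<open>t\<close> to \<open>m\<close> and the others to zero.
\<close>

definition onL :: "(cell \<times> mon) list \<Rightarrow> cell \<Rightarrow> mon list" where
  "onL l t = bnd (\<lambda>(u, m). if u = t then [m] else []) l"

definition tagL :: "nat \<Rightarrow> (cell \<Rightarrow> mon list) \<Rightarrow> (cell \<times> mon) list" where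
  "tagL i w = bnd (\<lambda>t. map (Pair t) (w t)) (cellL i)"

definition cobL :: "nat \<Rightarrow> (cell \<times> mon) list \<Rightarrow> cell \<Rightarrow> mon list" where
  "cobL i l t = algL (onL l) (DL i t)"

text \<open>
  The classes \<^term>\<open>LAM\<close> of products of generators span the cohomology: for a basis element \<open>e\<close> of
  \<open>Hom(P\<^sub>n, A)\<close>, the certificate is \<open>e = LAM e + d (SIG e) + TAU (d e)\<close>.
\<close>

definition LAM :: "nat \<Rightarrow> cell \<Rightarrow> mon \<Rightarrow> gen list list" where
  "LAM i t m =
    (if i = 0 then (case t of Pt \<Rightarrow> (case m of mI \<Rightarrow> [[]] | mYX \<Rightarrow> [[P1]] | mXYX \<Rightarrow> [[P2]] | mYXY \<Rightarrow> [[P2']] | mW \<Rightarrow> [[P3]] | _ \<Rightarrow> []) | _ \<Rightarrow> [])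
     else if i = 1 then (case t of Gx \<Rightarrow> (case m of mXYX \<Rightarrow> [[P2, U1]] | mYXY \<Rightarrow> [[P1, U1'], [P3, U1']] | mW \<Rightarrow> [[P3, U1]] | _ \<Rightarrow> []) |
        Gy \<Rightarrow> (case m of mX \<Rightarrow> [[U1]] | mXY \<Rightarrow> [[U1']] | mYX \<Rightarrow> [[U1']] | mXYX \<Rightarrow> [[P1, U1], [P3, U1]] | mYXY \<Rightarrow> [[P2, U1]] | mW \<Rightarrow> [[P3, U1']] | _ \<Rightarrow> []) | _ \<Rightarrow> [])
     else if i = 2 then (case t of Rx \<Rightarrow> (case m of mI \<Rightarrow> [[U1, U1], [V2']] | mX \<Rightarrow> [[V2]] | mYX \<Rightarrow> [[P1, V2']] | mXYX \<Rightarrow> [[P1, V2]] | mW \<Rightarrow> [[P1, V2']] | _ \<Rightarrow> []) |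
        Ry \<Rightarrow> (case m of mI \<Rightarrow> [[U1', U1'], [V2]] | mX \<Rightarrow> [[V1]] | mY \<Rightarrow> [[V2']] | mYX \<Rightarrow> [[P1, V2]] | mYXY \<Rightarrow> [[P1, V2']] | mW \<Rightarrow> [[P1, V2]] | _ \<Rightarrow> []) | _ \<Rightarrow> [])
     else (case t of Pt \<Rightarrow> (case m of mI \<Rightarrow> [[U1, U1, U1]] | mX \<Rightarrow> [[U1, V2]] | mY \<Rightarrow> [[U1, V1]] | mXY \<Rightarrow> [[U1, V2']] | mYX \<Rightarrow> [[U1, V2']] | mW \<Rightarrow> [[P1, U1, V2']] | _ \<Rightarrow> []) | _ \<Rightarrow> []))"

definition SIG :: "nat \<Rightarrow> cell \<Rightarrow> mon \<Rightarrow> (cell \<times> mon) list" where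
  "SIG i t m =
    (if i = 0 then []
     else if i = 1 then (case t of Gx \<Rightarrow> (case m of mYX \<Rightarrow> [(Pt, mY)] | mYXY \<Rightarrow> [(Pt, mX)] | _ \<Rightarrow> []) |
        Gy \<Rightarrow> (case m of mXY \<Rightarrow> [(Pt, mX)] | mXYX \<Rightarrow> [(Pt, mY)] | mYXY \<Rightarrow> [(Pt, mXY)] | _ \<Rightarrow> []) | _ \<Rightarrow> [])
     else if i = 2 then (case t of Rx \<Rightarrow> (case m of mI \<Rightarrow> [(Gx, mY)] | mYX \<Rightarrow> [(Gy, mI)] | mYXY \<Rightarrow> [(Gx, mX)] | mW \<Rightarrow> [(Gx, mY), (Gy, mI)] | _ \<Rightarrow> []) |
        Ry \<Rightarrow> (case m of mI \<Rightarrow> [(Gx, mI), (Gx, mXY)] | mYX \<Rightarrow> [(Gx, mI)] | mXYX \<Rightarrow> [(Gy, mY)] | mW \<Rightarrow> [(Gx, mXY)] | _ \<Rightarrow> []) | _ \<Rightarrow> [])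
     else (case t of Pt \<Rightarrow> (case m of mI \<Rightarrow> [(Rx, mY)] | mX \<Rightarrow> [(Rx, mXY)] | mY \<Rightarrow> [(Ry, mXY)] | mYX \<Rightarrow> [(Rx, mY)] | mXYX \<Rightarrow> [(Rx, mXY)] | mYXY \<Rightarrow> [(Ry, mXY)] | _ \<Rightarrow> []) | _ \<Rightarrow> []))"

definition TAU :: "nat \<Rightarrow> cell \<Rightarrow> mon \<Rightarrow> (cell \<times> mon) list" where
  "TAU i t m =
    (if i = 0 then (case t of Gx \<Rightarrow> (case m of mYX \<Rightarrow> [(Pt, mY)] | _ \<Rightarrow> []) |
        Gy \<Rightarrow> (case m of mYX \<Rightarrow> [(Pt, mX)] | mYXY \<Rightarrow> [(Pt, mXY)] | _ \<Rightarrow> []) | _ \<Rightarrow> [])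
     else if i = 1 then (case t of Rx \<Rightarrow> (case m of mYXY \<Rightarrow> [(Gx, mX)] | mW \<Rightarrow> [(Gx, mY)] | _ \<Rightarrow> []) |
        Ry \<Rightarrow> (case m of mYX \<Rightarrow> [(Gx, mI)] | mXYX \<Rightarrow> [(Gy, mY)] | mYXY \<Rightarrow> [(Gy, mI)] | mW \<Rightarrow> [(Gx, mXY)] | _ \<Rightarrow> []) | _ \<Rightarrow> [])
     else if i = 2 then (case t of Pt \<Rightarrow> (case m of mYX \<Rightarrow> [(Rx, mY)] | mXYX \<Rightarrow> [(Rx, mXY)] | mYXY \<Rightarrow> [(Ry, mXY)] | _ \<Rightarrow> []) | _ \<Rightarrow> [])
     else [])"

fun gsdeg :: "gen list \<Rightarrow> nat" where
  "gsdeg [] = 0" | "gsdeg (g # gs) = gen_deg g + gsdeg gs"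

text \<open>The second clause makes the chosen products homogeneous of degree \<open>i\<close>, so
  that a power of \<open>z\<close> brings them to any degree congruent to \<open>i\<close>. The
  third shows that no coboundary is used in degrees divisible by 4, which makes the certificate
  valid in degree 0 as well.\<close>

lemma table_span:
  "list_all (\<lambda>i. list_all (\<lambda>t. list_all (\<lambda>m.
     nrm (tagL i (onL [(t, m)]) @ bnd (\<lambda>gs. tagL i (pullL i (cML gs))) (LAM i t m) @ tagL i (cobL i (SIG i t m)) @
       bnd (\<lambda>(u, q). TAU i u q) (tagL (Suc i mod 4) (cobL (Suc i mod 4) [(t, m)]))) = []) mons) (cellL i)) [0, 1, 2, 3]"
  "list_all (\<lambda>i. list_all (\<lambda>t. list_all (\<lambda>m. list_all (\<lambda>gs. gsdeg gs = i) (LAM i t m)) mons) (cellL i)) [0, 1, 2, 3]"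
  "list_all (\<lambda>t. list_all (\<lambda>m. SIG 0 t m = []) mons) (cellL 0)"
  by code_simp+

text \<open>A row \<open>(g, h, v, c)\<close> records \<open>[g, h] = v + d c\<close> on the minimal resolution.\<close>

definition bracket_rows :: "(gen \<times> gen \<times> gen list list \<times> (cell \<times> mon) list) list" where
  "bracket_rows = [
    (P1, U1, [[P2']], []),
    (P1, U1', [[P2]], []),
    (P1, V1, [], []),
    (P1, V2, [], [(Pt, mY)]),
    (P1, V2', [], [(Pt, mX)]),
    (P1, Z, [], []),
    (P2, U1, [[P1]], []),
    (P2, U1', [[P2']], []),
    (P2, V1, [], []),
    (P2, V2, [], []),
    (P2, V2', [], [(Pt, mY)]),
    (P2, Z, [], []),
    (P2', U1, [[P2]], []),
    (P2', U1', [[P1]], []),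
    (P2', V1, [], []),
    (P2', V2, [], [(Pt, mX)]),
    (P2', V2', [], []),
    (P2', Z, [], []),
    (P3, U1, [[P2']], []),
    (P3, U1', [[P2]], []),
    (P3, V1, [], []),
    (P3, V2, [], []),
    (P3, V2', [], []),
    (P3, Z, [], []),
    (U1, U1', [], []),
    (U1, V1, [[U1', U1'], [V2]], [(Gx, mI)]),
    (U1, V2, [[U1, U1], [V2']], [(Gx, mY), (Gy, mI)]),
    (U1, V2', [[V1]], [(Gy, mY)]),
    (U1, Z, [], []),
    (U1', V1, [[U1, U1], [V2']], [(Gy, mI)]),
    (U1', V2, [[V1]], [(Gx, mX)]),
    (U1', V2', [[U1', U1'], [V2]], [(Gx, mXY)]),
    (U1', Z, [], []),
    (V1, V2, [], []),
    (V1, V2', [], []),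
    (V1, Z, [], []),
    (V2, V2', [], []),
    (V2, Z, [], [(Pt, mY)]),
    (V2', Z, [], [(Pt, mX)])]"

text \<open>In degree 0 there are no coboundaries, but index 0 of \<open>DL\<close> formally
  supplies the differential of degree 4; the last conjunct excludes its use there.\<close>

definition row_ok :: "gen \<times> gen \<times> gen list list \<times> (cell \<times> mon) list \<Rightarrow> bool" where
  "row_ok = (\<lambda>(g, h, v, c). let n = gen_deg g + gen_deg h - 1 in
     list_all (\<lambda>t. nrm (pullL n (brkL g h) t @ bnd (\<lambda>gs. pullL n (cML gs) t) v @ cobL (n mod 4) c t) = [])
       (cellL (n mod 4)) \<and> list_all (\<lambda>gs. gsdeg gs = n) v \<and> (n = 0 \<longrightarrow> c = []))"

lemma table_brackets: "list_all row_ok bracket_rows"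
  by code_simp

section \<open>Interpretation of the symbolic lists\<close>

definition val :: "('b \<Rightarrow> 'm::comm_monoid_add) \<Rightarrow> 'b list \<Rightarrow> 'm" where
  "val \<phi> l = sum_list (map \<phi> l)"

lemma val_simps [simp]:
  "val \<phi> [] = 0" "val \<phi> (a # l) = \<phi> a + val \<phi> l" "val \<phi> (l @ k) = val \<phi> l + val \<phi> k"
  by (simp_all add: val_def)

lemma val_map [simp]: "val \<phi> (map f l) = val (\<lambda>a. \<phi> (f a)) l"
  by (simp add: val_def o_def)

lemma val_bnd: "val \<phi> (bnd f l) = val (\<lambda>a. val \<phi> (f a)) l"
  by (induction l) (auto simp: bnd_def)

lemma val_cong: "(\<And>a. a \<in> set l \<Longrightarrow> \<phi> a = \<psi> a) \<Longrightarrow> val \<phi> l = val \<psi> l"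
  by (simp add: val_def cong: map_cong)

lemma val_hom:
  assumes "h 0 = 0" "\<And>a b. h (a + b) = h a + h b"
  shows "h (val \<phi> l) = val (\<lambda>a. h (\<phi> a)) l"
  by (induction l) (auto simp: assms)

lemma val_tog:
  fixes \<phi> :: "'b \<Rightarrow> 'm::comm_monoid_add"
  assumes "\<And>b::'m. b + b = 0"
  shows "val \<phi> (tog e l) = \<phi> e + val \<phi> l"
proof (induction l)
  case (Cons a l)
  have "\<phi> e + (\<phi> e + val \<phi> l) = val \<phi> l"
    using assms by (simp flip: add.assoc)
  then show ?case using Cons by (auto simp: add_ac)
qed simp

lemma val_nrm:
  fixes \<phi> :: "'b \<Rightarrow> 'm::comm_monoid_add"
  assumes "\<And>b::'m. b + b = 0"
  shows "val \<phi> (nrm l) = val \<phi> l"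
  by (induction l) (simp_all add: nrm_def val_tog [OF assms])

section \<open>The monomial basis of the group algebra\<close>

locale quat =
  fixes x y :: "'k::field kQ8"
  assumes char_k2: "CHAR('k) = 2"
    and ident: "identification x y"
begin

lemma dbl: "(p :: 'b \<Rightarrow>\<^sub>0 'k) + p = 0"
  by (rule char2_poly_mapping [OF char_k2])

lemma dbl_eqI: "p + q = 0 \<Longrightarrow> (p :: 'b \<Rightarrow>\<^sub>0 'k) = q"
proof -
  assume "p + q = 0"
  then have "p + q + q = q" by simp
  then show "p = q" by (simp add: add.assoc dbl)
qed

definition bas :: "mon \<Rightarrow> 'k kQ8" where
  "bas m = (case m of mI \<Rightarrow> 1 | mX \<Rightarrow> x | mY \<Rightarrow> y | mXY \<Rightarrow> x*y | mYX \<Rightarrow> y*x | mXYX \<Rightarrow> x*y*x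
     | mYXY \<Rightarrow> y*x*y | mW \<Rightarrow> x*y*x*y)"

lemma bas_simps: "bas mI = 1" "bas mX = x" "bas mY = y" "bas mXY = x*y" "bas mYX = y*x"
  "bas mXYX = x*y*x" "bas mYXY = y*x*y" "bas mW = x*y*x*y"
  by (simp_all add: bas_def)

text \<open>That \<open>xxy\<close> and \<open>yyx\<close> vanish is not among the defining
  relations. It follows from nilpotency, and it closes the multiplication table of the eight
  monomials.\<close>

lemma relations:
  "x * x = y * (x * y)" "y * y = x * (y * x)" "y * (x * (y * x)) = x * (y * (x * y))"
  "x * (x * z) = y * (x * (y * z))" "y * (y * z) = x * (y * (x * z))"
  "x * (y * (y * x)) = 0" "x * (x * y) = 0" "y * (y * x) = 0" "x * (y * (x * (y * x))) = 0"
  "y * (x * (y * (x * y))) = 0"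
proof -
  have xx0: "x * x + y * (x * y) = 0" and yy0: "y * y + x * (y * x) = 0"
    using ident by (auto simp: identification_def power2_eq_square mult.assoc)
  note xx = dbl_eqI [OF xx0] and yy = dbl_eqI [OF yy0]
  have xxl: "x * (x * z) = y * (x * (y * z))" and yyl: "y * (y * z) = x * (y * (x * z))" for z
    using arg_cong [OF xx, of "\<lambda>a. a * z"] arg_cong [OF yy, of "\<lambda>a. a * z"] by (simp_all add: mult.assoc)
  have x4: "x * (x * (x * x)) = 0" and y4: "y * (y * (y * y)) = 0"
    using ident by (auto simp: identification_def numeral_eq_Suc mult.assoc)
  have yxyx: "y * (x * (y * x)) = x * (y * (x * y))"
    using xxl [of x] by (simp only: xx)
  \<comment> \<open>The relations give \<open>u = y u x\<close>. Four applications give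
    \<open>u = y^4 u x^4\<close>, which is zero because \<open>x^4 = 0\<close>.\<close>
  define u where "u = x * (x * y)"
  have "u = y * (x * (y * y))"
    by (simp only: u_def xxl)
  also have "\<dots> = y * (u * x)"
    by (simp only: u_def yy mult.assoc)
  finally have u1: "u = y * (u * x)" .
  have u2: "u = y * ((y * (u * x)) * x)"
    using arg_cong [OF u1, of "\<lambda>a. y * (a * x)"] by (rule trans [OF u1])
  have "u = y * ((y * ((y * ((y * (u * x)) * x)) * x)) * x)"
    using arg_cong [OF u2, of "\<lambda>a. y * ((y * (a * x)) * x)"] by (rule trans [OF u2])
  then have "u = y * (y * (y * (y * (u * (x * (x * (x * x)))))))"
    by (simp only: mult.assoc)
  then have u: "x * (x * y) = 0"
    by (simp add: x4 u_def)
  have v: "y * (y * x) = 0"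
  proof -
    have "y * (y * x) = x * (y * (x * x))" by (simp add: yyl)
    also have "\<dots> = x * (y * (y * (x * y)))" by (simp add: xx)
    also have "\<dots> = x * (x * (y * (x * (x * y))))" by (simp only: yyl)
    finally show ?thesis by (simp add: u)
  qed
  show "x * x = y * (x * y)" "y * y = x * (y * x)" "y * (x * (y * x)) = x * (y * (x * y))"
    "x * (x * z) = y * (x * (y * z))" "y * (y * z) = x * (y * (x * z))"
    by (fact xx yy yxyx xxl yyl)+
  show "x * (x * y) = 0" "y * (y * x) = 0"
    by (fact u v)+
  show "x * (y * (y * x)) = 0"
    by (simp add: v)
  have "x * (y * (x * (y * x))) = (x * (x * y)) * (x * y)"
    by (simp only: yxyx mult.assoc)
  then show "x * (y * (x * (y * x))) = 0"
    by (simp add: u)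
  have "y * (x * (y * (x * y))) = (y * (x * (y * x))) * y"
    by (simp only: mult.assoc)
  also have "\<dots> = x * (y * (x * (y * y)))"
    by (simp only: yxyx mult.assoc)
  also have "\<dots> = x * (y * ((x * (x * y)) * x))"
    by (simp only: yy mult.assoc)
  finally show "y * (x * (y * (x * y))) = 0"
    by (simp add: u)
qed

lemma x_bas: "x * bas m = val bas (mulx m)"
proof -
  have "x * (x * (y * z)) = 0" for z
    using relations(7) by (metis mult.assoc mult_zero_left)
  then show ?thesis
    using relations(1,7,9) relations(6) by (cases m) (simp_all add: bas_simps mult.assoc)
qed

lemma y_bas: "y * bas m = val bas (muly m)"
proof -
  have "y * (y * (x * z)) = 0" for z
    using relations(8) by (metis mult.assoc mult_zero_left)
  then show ?thesis
    using relations(2,3,8,10) by (cases m) (simp_all add: bas_simps mult.assoc)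
qed

lemma x_val: "x * val bas l = val bas (bnd mulx l)" and y_val: "y * val bas l = val bas (bnd muly l)"
  by (simp_all add: val_hom [of "(*) _"] distrib_left x_bas y_bas val_bnd)

lemma bas_mult: "bas a * bas b = val bas (mulm a b)"
  by (cases a) (simp_all add: bas_simps mult.assoc x_bas y_bas x_val y_val)

lemma val_mult: "val bas l * val bas k = val bas (mulL l k)"
proof -
  have "val bas l * val bas k = val (\<lambda>a. bas a * val bas k) l"
    by (rule val_hom [where h = "\<lambda>z. z * val bas k"]) (simp_all add: distrib_right)
  moreover have "bas a * val bas k = val (\<lambda>b. bas a * bas b) k" for a
    by (rule val_hom [where h = "\<lambda>z. bas a * z"]) (simp_all add: distrib_left)
  ultimately show ?thesis
    by (simp add: mulL_def val_bnd bas_mult)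
qed

lemma std_basis_eq: "std_basis x y = map bas mons"
  by (simp add: std_basis_def bas_simps)

lemma inj_bas: "inj bas"
proof -
  have "distinct (map bas mons)"
    using ident by (simp add: identification_def std_basis_eq)
  then show ?thesis
    by (simp add: distinct_map UNIV_mon)
qed

interpretation V: vector_space "vscale :: 'k \<Rightarrow> 'k kQ8 \<Rightarrow> 'k kQ8"
  by (rule vector_space_vscale)

lemma basis: "V.independent (range bas)" "V.span (range bas) = UNIV"
proof -
  have "set (std_basis x y) = range bas"
    by (simp only: std_basis_eq set_map UNIV_mon)
  then show "V.independent (range bas)" "V.span (range bas) = UNIV"
    using ident by (simp_all add: identification_def)
qed

definition cf :: "mon \<Rightarrow> 'k kQ8 \<Rightarrow> 'k" where
  "cf m a = V.representation (range bas) a (bas m)"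

lemma cf_add: "cf m (a + b) = cf m a + cf m b"
  by (simp add: cf_def V.representation_add basis)

lemma cf_scale: "cf m (vscale c a) = c * cf m a"
  by (simp add: cf_def V.representation_scale basis)

lemma cf_bas: "cf m (bas n) = (if m = n then 1 else 0)"
  using inj_bas by (simp add: cf_def V.representation_basis basis inj_eq)

lemma cf_expand: "(\<Sum>m\<in>UNIV. vscale (cf m a) (bas m)) = a"
proof -
  have "(\<Sum>b\<in>range bas. vscale (V.representation (range bas) a b) b) = a"
    by (rule V.sum_representation_eq) (simp_all add: basis)
  then show ?thesis
    by (simp add: cf_def sum.reindex [OF inj_bas])
qed

lemma klin_bas_eqI:
  assumes "klin F" "klin G" "\<And>m. F (bas m) = G (bas m)"
  shows "F a = G (a :: 'k kQ8)"
proof -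
  have "F (\<Sum>m\<in>UNIV. vscale (cf m a) (bas m)) = G (\<Sum>m\<in>UNIV. vscale (cf m a) (bas m))"
    using assms by (simp add: klin_sum) (simp add: klin_iff)
  then show ?thesis by (simp only: cf_expand)
qed

text \<open>Linear extension from the monomial basis, the counterpart of \<open>ext\<close>. Both
  are needed since the bimodules are built on group elements while the tables are written in
  monomials.\<close>

definition bext :: "(mon \<Rightarrow> ('b \<Rightarrow>\<^sub>0 'k)) \<Rightarrow> 'k kQ8 \<Rightarrow> ('b \<Rightarrow>\<^sub>0 'k)" where
  "bext f a = (\<Sum>m\<in>UNIV. vscale (cf m a) (f m))"

lemma klin_bext: "klin (bext f)"
  by (simp add: klin_iff bext_def cf_add cf_scale vscale_add_left sum.distrib vscale_sum vscale_vscale)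

lemma bext_bas: "bext f (bas m) = f m"
proof -
  have "bext f (bas m) = (\<Sum>n\<in>UNIV. if n = m then f n else 0)"
    unfolding bext_def by (rule sum.cong) (auto simp: cf_bas)
  then show ?thesis by simp
qed

definition tv :: "tri \<Rightarrow> 'k bimod" where
  "tv = (\<lambda>(a, t, c). tens (bas a) t (bas c))"

lemma tens_val: "tens (val bas l) t b = val (\<lambda>a. tens (bas a) t b) l"
  "tens b t (val bas l) = val (\<lambda>a. tens b t (bas a)) l"
  by (induction l) (auto simp: tens_linear)

lemma tens_val_val: "tens (val bas l) t (val bas k) = val (\<lambda>a. val (\<lambda>c. tens (bas a) t (bas c)) k) l"
  by (subst tens_val(1)) (simp only: tens_val(2))

lemma tv_eq [simp]: "tv (a, t, c) = tens (bas a) t (bas c)"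
  by (simp add: tv_def)

lemma act_val: "act a (val \<phi> l) b = val (\<lambda>p. act a (\<phi> p) b) l"
  by (rule val_hom) simp_all

lemma val_actL: "val tv (actL a l c) = act (bas a) (val tv l) (bas c)"
  unfolding actL_def val_bnd act_val
  by (rule val_cong) (auto simp: val_bnd act_tens bas_mult tens_val_val)

lemma val_algL: "val bas (algL w l) = alg_map (\<lambda>t. val bas (w t)) (val tv l)"
proof -
  have "alg_map (\<lambda>t. val bas (w t)) (val tv l) = val (\<lambda>p. alg_map (\<lambda>t. val bas (w t)) (tv p)) l"
    by (rule val_hom) simp_all
  also have "\<dots> = val bas (algL w l)"
    unfolding algL_def val_bnd
    by (rule val_cong) (auto simp: alg_map_tens mult.assoc simp flip: val_mult)
  finally show ?thesis ..
qed

abbreviation "D \<equiv> diff_gen x y"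

lemma D_eq: "D n t = val tv (DL (n mod 4) t)"
proof -
  have "n mod 4 = 0 \<or> n mod 4 = 1 \<or> n mod 4 = 2 \<or> n mod 4 = 3" by auto
  then show ?thesis
    by (elim disjE; cases t)
      (simp_all add: diff_gen_def DL_def bas_simps add_ac dual_basis_def std_basis_def)
qed

lemma val_dL: "val tv (dL (n mod 4) l) = bimod_map (D n) (val tv l)"
proof -
  have "bimod_map (D n) (val tv l) = val (\<lambda>p. bimod_map (D n) (tv p)) l"
    by (rule val_hom) simp_all
  also have "\<dots> = val tv (dL (n mod 4) l)"
    unfolding dL_def bimodL_def val_bnd
    by (rule val_cong) (auto simp: bimod_map_tens D_eq val_actL act_act bas_simps)
  finally show ?thesis ..
qed

lemma nrm_zero: "nrm l = [] \<Longrightarrow> val \<phi> l = (0 :: 'b \<Rightarrow>\<^sub>0 'k)"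
  using val_nrm [OF dbl, of \<phi> l] by simp

lemma all_cells: "t \<in> set all_cells"
  by (cases t) auto

lemma all_mons: "m \<in> set mons"
  by (cases m) auto

sublocale res_complex D
proof
  show "CHAR('k) = 2" by (rule char_k2)
  show "alg_map (\<lambda>_. 1) (D (Suc 0) t) = 0" for t
  proof -
    have "nrm (algL (\<lambda>_. [mI]) (DL 1 t)) = []"
      using table_D_D(1) all_cells [of t] unfolding list_all_iff by blast
    then have "val bas (algL (\<lambda>_. [mI]) (DL 1 t)) = 0"
      by (rule nrm_zero)
    then show ?thesis
      by (simp add: val_algL D_eq bas_simps)
  qed
  show "bimod_map (D (Suc n)) (D (Suc (Suc n)) t) = 0" for n t
  proof -
    have "n mod 4 = 0 \<or> n mod 4 = 1 \<or> n mod 4 = 2 \<or> n mod 4 = 3" by auto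
    then have "nrm (dL (Suc n mod 4) (DL (Suc (Suc n) mod 4) t)) = []"
      using table_D_D(2) all_cells [of t] unfolding list_all_iff
      by (auto simp: mod_Suc numeral_2_eq_2 numeral_3_eq_3)
    then have "val tv (dL (Suc n mod 4) (DL (Suc (Suc n) mod 4) t)) = 0"
      by (rule nrm_zero)
    then show ?thesis
      by (simp only: val_dL D_eq)
  qed
qed

section \<open>The contracting homotopy of the minimal resolution\<close>

text \<open>The table \<open>TL\<close> is extended linearly in the left factor and as a map of
  right modules in the right factor.\<close>

definition tt :: "nat \<Rightarrow> 'k bimod \<Rightarrow> 'k bimod" where
  "tt i = ext (\<lambda>g t h. act 1 (bext (\<lambda>m. val tv (TL i m t)) (sg g 1)) (sg h 1))"

lemma tt_tens: "tt i (tens a t b) = act 1 (bext (\<lambda>m. val tv (TL i m t)) a) b"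
  unfolding tt_def
proof (rule ext_tens [where B = "\<lambda>a t b. act 1 (bext (\<lambda>m. val tv (TL i m t)) a) b"])
  show "klin (\<lambda>a. act 1 (bext (\<lambda>m. val tv (TL i m t)) a) b)" for t b
    using klin_bext [of "\<lambda>m. val tv (TL i m t)"] by (auto simp: klin_iff)
qed (simp add: klin_iff act_linear_left)

lemma tt_linear [simp]: "tt i (p + q) = tt i p + tt i q" "tt i (vscale c p) = vscale c (tt i p)" "tt i 0 = 0"
  by (simp_all add: tt_def)

lemma tt_act: "tt i (act 1 p c) = act 1 (tt i p) c"
  by (rule klin_tens_eqI [where p = p]) (simp_all add: klin_iff act_tens tt_tens act_act)

lemma val_tL: "val tv (tL i l) = tt i (val tv l)"
proof -
  have "tt i (val tv l) = val (\<lambda>p. tt i (tv p)) l"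
    by (rule val_hom) simp_all
  also have "\<dots> = val tv (tL i l)"
    unfolding tL_def bimodL_def val_bnd
    by (rule val_cong) (auto simp: tt_tens bext_bas val_actL bas_simps)
  finally show ?thesis ..
qed

lemma cells_eq: "set (cellL (n mod 4)) = cells n"
  by (auto simp: cells_def)

text \<open>This reduces an identity on \<open>P_n\<close> to finitely many monomials and cells. The
  right entry stays arbitrary, because right linearity removes it.\<close>

lemma res_eqI:
  fixes F G :: "'k bimod \<Rightarrow> ('b \<Rightarrow>\<^sub>0 'k)"
  assumes "klin F" "klin G" "\<And>m t b. t \<in> cells n \<Longrightarrow> F (tens (bas m) t b) = G (tens (bas m) t b)" "p \<in> res n"
  shows "F p = G p"
proof -
  have *: "F (tens a t b) = G (tens a t b)" if "t \<in> cells n" for a t b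
    by (rule klin_bas_eqI [where F = "\<lambda>a. F (tens a t b)"])
      (use assms(1,2) assms(3) [OF that] in \<open>auto simp: klin_iff tens_linear\<close>)
  have "vscale (lu p k) (F (sg k 1)) = vscale (lu p k) (G (sg k 1))" for k
  proof (cases "k \<in> Poly_Mapping.keys p")
    case True
    obtain g t h where k: "k = (g, t, h)" by (cases k)
    then have "t \<in> cells n"
      using True assms(4) by (auto simp: res_def)
    then show ?thesis
      using * [of t "sg g 1" "sg h 1"] by (simp add: k tens_single)
  qed (simp add: in_keys_iff)
  then have "F (\<Sum>k\<in>UNIV. vscale (lu p k) (sg k 1)) = G (\<Sum>k\<in>UNIV. vscale (lu p k) (sg k 1))"
    using assms(1,2) by (simp add: klin_sum) (simp add: klin_iff)
  then show ?thesis by (simp only: poly_mapping_expand)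
qed

lemma klin_bimod_tt: "klin (\<lambda>p. bimod_map v (tt i p))" "klin (\<lambda>p. tt i (bimod_map v p))"
  by (simp_all add: klin_iff)

lemma klin_plus: "klin F \<Longrightarrow> klin G \<Longrightarrow> klin (\<lambda>p. F p + G p)"
  by (simp add: klin_iff algebra_simps)

lemma tens_act: "tens a t b = act 1 (tens a t 1) b"
  by (simp add: act_tens)

lemma homotopy0:
  assumes "p \<in> res 0"
  shows "bimod_map (D (Suc 0)) (tt 0 p) + tens 1 Pt (alg_map (\<lambda>_. 1) p) = p"
proof (rule res_eqI [OF _ _ _ assms])
  show "klin (\<lambda>p. bimod_map (D (Suc 0)) (tt 0 p) + tens 1 Pt (alg_map (\<lambda>_. 1) p))"
    by (intro klin_plus klin_bimod_tt) (simp add: klin_iff tens_linear)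
  show "klin (\<lambda>p. p :: 'k bimod)" by (simp add: klin_iff)
  fix m t b assume "t \<in> cells 0"
  then have t: "t = Pt" by (simp add: cells_def)
  have "nrm ((m, Pt, mI) # dL 1 (TL 0 m Pt) @ [(mI, Pt, m)]) = []"
    using table_homotopy0 all_mons [of m] unfolding list_all_iff by blast
  then have "val tv ((m, Pt, mI) # dL (Suc 0 mod 4) (TL 0 m Pt) @ [(mI, Pt, m)]) = 0"
    by (intro nrm_zero) simp
  then have *: "bimod_map (D (Suc 0)) (val tv (TL 0 m Pt)) + tens 1 Pt (bas m) = tens (bas m) Pt 1"
    unfolding val_simps val_dL by - (rule dbl_eqI, simp add: bas_simps add_ac)
  have "bimod_map (D (Suc 0)) (tt 0 (tens (bas m) t b)) + tens 1 Pt (alg_map (\<lambda>_. 1) (tens (bas m) t b)) =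
      act 1 (bimod_map (D (Suc 0)) (val tv (TL 0 m Pt)) + tens 1 Pt (bas m)) b"
    by (simp add: t tt_tens bext_bas bimod_map_act alg_map_tens act_tens)
  then show "bimod_map (D (Suc 0)) (tt 0 (tens (bas m) t b)) + tens 1 Pt (alg_map (\<lambda>_. 1) (tens (bas m) t b)) =
      tens (bas m) t b"
    unfolding * by (simp add: t act_tens)
qed

lemma homotopy:
  assumes "p \<in> res (Suc n)"
  shows "bimod_map (D (Suc (Suc n))) (tt (Suc n mod 4) p) + tt (n mod 4) (bimod_map (D (Suc n)) p) = p"
proof (rule res_eqI [OF _ _ _ assms])
  show "klin (\<lambda>p. bimod_map (D (Suc (Suc n))) (tt (Suc n mod 4) p) + tt (n mod 4) (bimod_map (D (Suc n)) p))"
    by (intro klin_plus klin_bimod_tt)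
  show "klin (\<lambda>p. p :: 'k bimod)" by (simp add: klin_iff)
  fix m t b assume t: "t \<in> cells (Suc n)"
  have "n mod 4 = 0 \<or> n mod 4 = 1 \<or> n mod 4 = 2 \<or> n mod 4 = 3" by auto
  then have "nrm ((m, t, mI) # dL (Suc (Suc n) mod 4) (TL (Suc n mod 4) m t) @
      tL (n mod 4) (dL (Suc n mod 4) [(m, t, mI)])) = []"
    using table_homotopy all_mons [of m] t unfolding list_all_iff cells_eq [symmetric]
    by (elim disjE) (auto simp: mod_Suc numeral_2_eq_2 numeral_3_eq_3 simp del: set_simps)
  then have "val tv ((m, t, mI) # dL (Suc (Suc n) mod 4) (TL (Suc n mod 4) m t) @
      tL (n mod 4) (dL (Suc n mod 4) [(m, t, mI)])) = 0"
    by (rule nrm_zero)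
  then have *: "bimod_map (D (Suc (Suc n))) (val tv (TL (Suc n mod 4) m t)) +
      tt (n mod 4) (bimod_map (D (Suc n)) (tens (bas m) t 1)) = tens (bas m) t 1"
    unfolding val_simps val_dL val_tL by - (rule dbl_eqI, simp add: bas_simps add_ac)
  have "bimod_map (D (Suc (Suc n))) (tt (Suc n mod 4) (tens (bas m) t b)) +
      tt (n mod 4) (bimod_map (D (Suc n)) (tens (bas m) t b)) =
      act 1 (bimod_map (D (Suc (Suc n))) (val tv (TL (Suc n mod 4) m t)) +
        tt (n mod 4) (bimod_map (D (Suc n)) (tens (bas m) t 1))) b"
    by (simp add: tens_act [of "bas m" t b] tt_act bimod_map_act) (simp add: tt_tens bext_bas act_1)
  then show "bimod_map (D (Suc (Suc n))) (tt (Suc n mod 4) (tens (bas m) t b)) +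
      tt (n mod 4) (bimod_map (D (Suc n)) (tens (bas m) t b)) = tens (bas m) t b"
    unfolding * by (simp add: act_tens)
qed

end

section \<open>A computable comparison map\<close>

context quat
begin

lemma res_closed:
  fixes p q :: "'k bimod"
  shows
  "p \<in> res n \<Longrightarrow> q \<in> res n \<Longrightarrow> p + q \<in> res n" "p \<in> res n \<Longrightarrow> vscale c p \<in> res n"
  "(0 :: 'k bimod) \<in> res n"
proof -
  have *: "p \<in> res n \<longleftrightarrow> (\<forall>g t h. t \<notin> cells n \<longrightarrow> lu p (g, t, h) = 0)" for p :: "'k bimod"
  proof
    assume p: "p \<in> res n"
    show "\<forall>g t h. t \<notin> cells n \<longrightarrow> lu p (g, t, h) = 0"
    proof (intro allI impI, rule ccontr)
      fix g t h assume "t \<notin> cells n" "lu p (g, t, h) \<noteq> 0"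
      moreover from this have "(g, t, h) \<in> Poly_Mapping.keys p"
        by (simp add: in_keys_iff)
      ultimately show False
        using p by (auto simp: res_def)
    qed
  next
    assume p: "\<forall>g t h. t \<notin> cells n \<longrightarrow> lu p (g, t, h) = 0"
    have "s \<in> cells n" if "(g, s, h) \<in> Poly_Mapping.keys p" for g s h
      using that p by (metis in_keys_iff)
    then show "p \<in> res n"
      unfolding res_def by blast
  qed
  show "p \<in> res n \<Longrightarrow> q \<in> res n \<Longrightarrow> p + q \<in> res n" "p \<in> res n \<Longrightarrow> vscale c p \<in> res n"
    "(0 :: 'k bimod) \<in> res n"
    by (simp_all add: * lookup_add lookup_vscale)
qed

lemma res_sum: "(\<And>i. i \<in> S \<Longrightarrow> f i \<in> res n) \<Longrightarrow> (sum f S :: 'k bimod) \<in> res n"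
  by (induction S rule: infinite_finite_induct) (auto simp: res_closed)

lemma res_val: "(\<And>a. a \<in> set l \<Longrightarrow> \<phi> a \<in> res n) \<Longrightarrow> (val \<phi> l :: 'k bimod) \<in> res n"
  by (induction l) (auto simp: res_closed)

lemma res_tens: "t \<in> cells n \<Longrightarrow> tens a t b \<in> res n"
  unfolding res_def by (auto simp: in_keys_iff lookup_tens split: if_splits)

lemma res_act:
  fixes p :: "'k bimod"
  assumes "p \<in> res n"
  shows "act a p b \<in> res n"
  unfolding act_def
proof (rule res_sum, clarify)
  fix g t h
  show "vscale (lu p (g, t, h)) (tens (a * sg g 1) t (sg h 1 * b)) \<in> res n"
  proof (cases "lu p (g, t, h) = 0")
    case False
    then have "(g, t, h) \<in> Poly_Mapping.keys p"
      by (simp add: in_keys_iff)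
    then have "t \<in> cells n"
      using assms by (auto simp: res_def)
    then show ?thesis by (simp add: res_closed res_tens)
  qed (simp add: res_closed)
qed

lemma res_tt: "tt (n mod 4) p \<in> res (Suc n)"
proof -
  have cells: "n mod 4 = 0 \<or> n mod 4 = 1 \<or> n mod 4 = 2 \<or> n mod 4 = 3" by auto
  have TL: "u \<in> cells (Suc n)" if "(a, u, b) \<in> set (TL (n mod 4) m t)" for a u b m t
  proof -
    note T = bspec [OF bspec [OF table_TL_cells [unfolded list_all_iff] all_mons [of m]] all_cells [of t]]
    have "\<forall>(a, u, b) \<in> set (TL 0 m t). u \<in> {Gx, Gy}" "\<forall>(a, u, b) \<in> set (TL 1 m t). u \<in> {Rx, Ry}"
      "\<forall>(a, u, b) \<in> set (TL 2 m t). u = Pt" "\<forall>(a, u, b) \<in> set (TL 3 m t). u = Pt"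
      using T by blast+
    note U = this [THEN bspec]
    show ?thesis
      using cells U(1) [of "(a, u, b)"] U(2) [of "(a, u, b)"] U(3) [of "(a, u, b)"] U(4) [of "(a, u, b)"] that
      by (elim disjE) (simp_all only: cells_def mod_Suc split: if_splits, simp_all)
  qed
  have "val tv (TL (n mod 4) m t) \<in> res (Suc n)" for m t
    by (rule res_val, clarify, simp only: tv_eq, rule res_tens, erule TL)
  then have "act 1 (bext (\<lambda>m. val tv (TL (n mod 4) m t)) a) b \<in> res (Suc n)" for a t b
    unfolding bext_def by (intro res_act res_sum res_closed)
  then show ?thesis
    unfolding tt_def ext_def by (intro res_sum) (auto intro: res_closed)
qed

primrec P0 :: "'k kQ8 list \<Rightarrow> 'k bimod" where
  "P0 [] = tens 1 Pt 1"
| "P0 (a # as) = tt (length as mod 4) (act a (P0 as) 1)"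

lemma P0_res: "P0 xs \<in> res (length xs)"
  by (cases xs) (auto simp: res_tt intro!: res_tens simp: cells_def)

lemma P0_multilinear: "multilinear vscale vscale P0"
proof -
  have "klin (\<lambda>a. P0 (as @ a # cs))" for as cs
    by (induction as) (auto simp: klin_iff act_linear_left)
  then show ?thesis by (simp add: multilinear_iff)
qed

text \<open>By induction on the list: \<open>d t = 1 + t d\<close> is applied to \<open>a\<close>
  times the image of the tail, and \<open>d\<close> of that image is expanded by the induction
  hypothesis. Right linearity of the homotopy lets the last entry pass outside.\<close>

lemma P0_chain:
  "xs \<noteq> [] \<Longrightarrow> bimod_map (D (length xs)) (P0 xs) = act (hd xs) (P0 (tl xs)) 1 + mrg P0 xs + act 1 (P0 (butlast xs)) (last xs)"
proof (induction xs)
  case (Cons a xs)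
  show ?case
  proof (cases xs)
    case Nil
    have "bimod_map (D (Suc 0)) (tt 0 (act a (tens 1 Pt 1) 1)) + tens 1 Pt (alg_map (\<lambda>_. 1) (act a (tens 1 Pt 1) 1)) =
        act a (tens 1 Pt 1) 1"
      by (rule homotopy0) (simp add: act_tens res_tens cells_def)
    then have "bimod_map (D (Suc 0)) (tt 0 (tens a Pt 1)) + tens 1 Pt a = tens a Pt 1"
      by (simp add: act_tens alg_map_tens)
    then have "bimod_map (D (Suc 0)) (tt 0 (tens a Pt 1)) + (tens 1 Pt a + tens 1 Pt a) = tens a Pt 1 + tens 1 Pt a"
      by (simp flip: add.assoc)
    then show ?thesis
      by (simp add: Nil act_tens dbl)
  next
    case (Cons b ys)
    define p where "p = act a (P0 xs) 1"
    define i where "i = length ys mod 4"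
    have pr: "p \<in> res (Suc (length ys))"
      using P0_res [of xs] by (simp add: p_def res_act Cons)
    have P0_a: "P0 (a # l) = tt i (act a (P0 l) 1)" if "length l = length ys" for l
      using that by (simp add: i_def)
    have "bimod_map (D (Suc (length ys))) p = act a (bimod_map (D (length xs)) (P0 xs)) 1"
      by (simp add: p_def bimod_map_act Cons)
    also have "bimod_map (D (length xs)) (P0 xs) = act b (P0 ys) 1 + mrg P0 xs + act 1 (P0 (butlast xs)) (last xs)"
      using Cons.IH Cons by simp
    finally have "tt i (bimod_map (D (Suc (length ys))) p) =
        tt i (act a (act b (P0 ys) 1) 1) + tt i (act a (mrg P0 xs) 1) + tt i (act a (act 1 (P0 (butlast xs)) (last xs)) 1)"
      by simp
    also have "tt i (act a (act b (P0 ys) 1) 1) = P0 (a * b # ys)"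
      by (simp add: i_def act_act)
    also have "tt i (act a (mrg P0 xs) 1) = mrg (\<lambda>l. tt i (act a (P0 l) 1)) xs"
      by (rule mrg_hom) simp_all
    also have "\<dots> = mrg (\<lambda>l. P0 (a # l)) xs"
      by (rule mrg_cong) (simp add: i_def Cons)
    also have "tt i (act a (act 1 (P0 (butlast xs)) (last xs)) 1) = act 1 (P0 (a # butlast xs)) (last xs)"
    proof -
      have "P0 (a # butlast xs) = tt i (act a (P0 (butlast xs)) 1)"
        by (rule P0_a) (simp add: Cons)
      then show ?thesis
        by (simp only: act_act mult_1_left mult_1_right flip: tt_act)
    qed
    finally have t: "tt i (bimod_map (D (Suc (length ys))) p) =
        mrg P0 (a # xs) + act 1 (P0 (butlast (a # xs))) (last (a # xs))"
      by (simp add: Cons)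
    have "bimod_map (D (Suc (Suc (length ys)))) (tt (Suc (length ys) mod 4) p) + tt i (bimod_map (D (Suc (length ys))) p) = p"
      unfolding i_def by (rule homotopy [OF pr])
    then have "bimod_map (D (Suc (Suc (length ys)))) (tt (Suc (length ys) mod 4) p) = p + tt i (bimod_map (D (Suc (length ys))) p)"
      by (metis add.assoc add.right_neutral dbl)
    then have "bimod_map (D (length (a # xs))) (P0 (a # xs)) = p + tt i (bimod_map (D (Suc (length ys))) p)"
      by (simp add: p_def Cons)
    then show ?thesis
      unfolding t by (simp add: p_def add.assoc del: P0.simps mrg.simps)
  qed
qed simp

lemma val_phiL: "P0 (map bas ms) = val tv (phiL ms)"
proof (induction ms)
  case (Cons m ms)
  have "val tv (phiL (m # ms)) = val tv (tL (length ms mod 4) (actL m (phiL ms) mI))"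
    by (simp add: val_nrm [OF dbl])
  then show ?case
    using Cons by (simp add: val_tL val_actL bas_simps)
qed (simp add: bas_simps)

section \<open>Explicit cocycles for the generators\<close>

lemma val_wL: "t \<in> cells (gen_deg g) \<Longrightarrow> gen_map x y g t = val bas (wL g t)"
  by (cases g; cases t) (auto simp: on_pt_def on_pair_def bas_simps cells_def)

definition wv :: "gen \<Rightarrow> cell \<Rightarrow> 'k kQ8" where
  "wv g t = val bas (wL g t)"

text \<open>The generator is transported by the computable map \<open>P0\<close> instead of the
  given \<open>\<Phi>\<close>; \<open>gen_class_eq\<close> shows that the class is the same.\<close>

definition cc :: "gen \<Rightarrow> 'k kQ8 list \<Rightarrow> 'k kQ8" where
  "cc g xs = (if length xs = gen_deg g then alg_map (wv g) (P0 xs) else 0)"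

lemma all_gens: "g \<in> set [P1, P2, P2', P3, U1, U1', V1, V2, V2', Z]"
  by (cases g) auto

lemma cochain_P0:
  fixes \<Phi> :: "'k kQ8 list \<Rightarrow> 'k bimod"
  assumes "multilinear vscale vscale \<Phi>"
  shows "(\<lambda>xs. if length xs = n then alg_map w (\<Phi> xs) else 0) \<in> cochains vscale"
proof -
  have \<Phi>: "klin (\<lambda>a. \<Phi> (as @ a # cs))" for as cs
    using assms by (simp add: multilinear_iff)
  have "klin (\<lambda>a. if length (as @ a # cs) = n then alg_map w (\<Phi> (as @ a # cs)) else 0)" for as cs
    using \<Phi> [of as cs] by (auto simp: klin_iff)
  then have "mlin (\<lambda>xs. if length xs = n then alg_map w (\<Phi> xs) else 0)"
    unfolding multilinear_iff by blast
  then show ?thesis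
    by (auto simp: cochains_iff bounded_deg_def)
qed

text \<open>A chain map turns the Hochschild differential into composition with the differential of
  the resolution. It is used for \<open>P0\<close> and for the given \<open>\<Phi>\<close>.\<close>

lemma hoch_diff_alg_map:
  fixes \<Phi> :: "'k kQ8 list \<Rightarrow> 'k bimod"
  assumes "\<And>xs. xs \<noteq> [] \<Longrightarrow> bimod_map (D (length xs)) (\<Phi> xs) =
     act (hd xs) (\<Phi> (tl xs)) 1 + mrg \<Phi> xs + act 1 (\<Phi> (butlast xs)) (last xs)"
  shows "hoch_diff (\<lambda>xs. if length xs = n then alg_map w (\<Phi> xs) else 0) xs =
    (if length xs = Suc n then alg_map w (bimod_map (D (Suc n)) (\<Phi> xs)) else 0)"
proof (cases "xs = []")
  case False
  let ?f = "\<lambda>xs. if length xs = n then alg_map w (\<Phi> xs) else 0"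
  have h: "hoch_diff ?f xs = hd xs * ?f (tl xs) + mrg ?f xs + ?f (butlast xs) * last xs"
    using False by (simp add: hoch_diff_def bar_diff_char2 [OF double])
  have l: "length (tl xs) = n \<longleftrightarrow> length xs = Suc n" "length (butlast xs) = n \<longleftrightarrow> length xs = Suc n"
    using False by (cases xs; auto)+
  have m: "mrg ?f xs = (if length xs = Suc n then alg_map w (mrg \<Phi> xs) else 0)"
  proof (cases "length xs = Suc n")
    case True
    then have "mrg ?f xs = mrg (\<lambda>l. alg_map w (\<Phi> l)) xs"
      by (intro mrg_cong) simp
    also have "\<dots> = alg_map w (mrg \<Phi> xs)"
      by (rule mrg_hom [symmetric]) simp_all
    finally show ?thesis using True by simp
  next
    case F: False
    then have "mrg ?f xs = mrg (\<lambda>_. 0) xs"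
      by (intro mrg_cong) auto
    moreover have "mrg (\<lambda>_. 0) xs = (0 :: 'k kQ8)"
      using mrg_hom [of "\<lambda>_. 0 :: 'k kQ8" "\<lambda>_. 0 :: 'k kQ8" xs] by simp
    ultimately show ?thesis using F by simp
  qed
  show ?thesis
  proof (cases "length xs = Suc n")
    case True
    then have "bimod_map (D (Suc n)) (\<Phi> xs) = act (hd xs) (\<Phi> (tl xs)) 1 + mrg \<Phi> xs + act 1 (\<Phi> (butlast xs)) (last xs)"
      using assms [OF False] by simp
    then show ?thesis
      unfolding h m using True l by (simp add: alg_map_act)
  next
    case F: False
    then show ?thesis unfolding h m using l by simp
  qed
qed (simp add: hoch_diff_def)

lemma cc_cyc: "cc g \<in> cyc"
proof -
  have "alg_map (wv g) (D (Suc (gen_deg g)) t) = 0" for t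
  proof -
    have "nrm (algL (wL g) (DL (Suc (gen_deg g) mod 4) t)) = []"
      using table_cocycles all_gens [of g] all_cells [of t] unfolding list_all_iff by blast
    then have "val bas (algL (wL g) (DL (Suc (gen_deg g) mod 4) t)) = 0"
      by (rule nrm_zero)
    then show ?thesis
      by (simp add: val_algL D_eq wv_def [abs_def])
  qed
  then have "alg_map (wv g) (bimod_map (D (Suc (gen_deg g))) p) = 0" for p
    by (simp add: alg_map_bimod_map bimod_map_0)
  then have "hoch_diff (cc g) = (\<lambda>_. 0)"
    unfolding cc_def [abs_def] by (intro HOL.ext) (simp add: hoch_diff_alg_map [OF P0_chain])
  moreover have "cc g \<in> cochains vscale"
    unfolding cc_def [abs_def] by (rule cochain_P0 [OF P0_multilinear])
  ultimately show ?thesis by (simp add: cyc_iff)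
qed

lemma homogeneous_cc: "homogeneous (gen_deg g) (cc g)"
  by (simp add: homogeneous_def cc_def)

section \<open>Symbolic evaluation of products, brackets and pullbacks\<close>

text \<open>The link between a cochain and its symbolic version. It constrains lists of length
  \<open>n\<close> only, so the symbolic functions need not test lengths.\<close>

definition rel :: "nat \<Rightarrow> ('k kQ8 list \<Rightarrow> 'k kQ8) \<Rightarrow> (mon list \<Rightarrow> mon list) \<Rightarrow> bool" where
  "rel n f F \<longleftrightarrow> (\<forall>ms. length ms = n \<longrightarrow> f (map bas ms) = val bas (F ms))"

lemma rel_cc: "rel (gen_deg g) (cc g) (cL g)"
  by (simp add: rel_def cc_def val_phiL cL_def val_nrm [OF dbl] val_algL wv_def [abs_def])

lemma spl_homogeneous:
  assumes "\<And>u v. length u \<noteq> n \<Longrightarrow> F u v = 0" "n \<le> length xs"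
  shows "spl F xs = F (take n xs) (drop n xs)"
proof -
  have "spl F xs = (\<Sum>i\<le>length xs. if i = n then F (take n xs) (drop n xs) else 0)"
    unfolding spl_eq_sum by (rule sum.cong) (use assms in auto)
  then show ?thesis using assms(2) by simp
qed

lemma homogeneous_cup:
  assumes "homogeneous n f" "homogeneous m h"
  shows "homogeneous (n + m) (cup f h)"
  unfolding homogeneous_def cup_eq_spl
  by (intro allI impI spl_eq_0) (use assms in \<open>auto simp: homogeneous_def\<close>, metis mult_zero_left mult_zero_right)

lemma cup_homogeneous:
  assumes "homogeneous n f" "n \<le> length xs"
  shows "cup f h xs = f (take n xs) * h (drop n xs)"
  unfolding cup_eq_spl by (rule spl_homogeneous) (use assms in \<open>auto simp: homogeneous_def\<close>)

lemma rel_cup: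
  assumes "rel n f F" "rel m h H" "homogeneous n f"
  shows "rel (n + m) (cup f h) (\<lambda>ms. mulL (F (take n ms)) (H (drop n ms)))"
  using assms(1,2) unfolding rel_def
  by (auto simp: cup_homogeneous [OF assms(3)] take_map drop_map simp flip: val_mult)

text \<open>For homogeneous cochains one block length contributes at each position, which leaves a
  finite sum that can be evaluated.\<close>

lemma ins_homogeneous:
  assumes f: "mlin f" "homogeneous n f" and g: "homogeneous m g"
  shows "ins f g xs = (if length xs + 1 = n + m
     then \<Sum>i<n. f (take i xs @ g (take m (drop i xs)) # drop (i + m) xs) else 0)"
proof -
  have z: "f (as @ 0 # cs) = 0" for as cs
    using f(1) by (rule multilinearD)
  have inner: "spl (\<lambda>bs cs. f (as @ g bs # cs)) r =
      (if m \<le> length r then f (as @ g (take m r) # drop m r) else 0)" for as r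
  proof (cases "m \<le> length r")
    case True
    then show ?thesis
      by (subst spl_homogeneous [where n = m]) (use g z in \<open>auto simp: homogeneous_def\<close>)
  next
    case False
    have "spl (\<lambda>bs cs. f (as @ g bs # cs)) r = 0"
      by (rule spl_eq_0) (use False g z in \<open>auto simp: homogeneous_def\<close>)
    then show ?thesis using False by simp
  qed
  have i: "ins f g xs = (\<Sum>i\<le>length xs. if m \<le> length xs - i
      then f (take i xs @ g (take m (drop i xs)) # drop (i + m) xs) else 0)"
    by (simp only: ins_def inner spl_eq_sum drop_drop length_drop add.commute [of m])
  show ?thesis
  proof (cases "length xs + 1 = n + m")
    case True
    show ?thesis
    proof (cases "m \<le> length xs")
      case m: True
      have "ins f g xs = (\<Sum>i\<in>{..<n}. f (take i xs @ g (take m (drop i xs)) # drop (i + m) xs))"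
        unfolding i by (rule sum.mono_neutral_cong_right) (use True m in auto)
      then show ?thesis using True by simp
    next
      case False
      \<comment> \<open>The block is longer than the whole argument list, which is possible only if
        \<open>f\<close> has degree 0; then neither side has a nonzero term.\<close>
      then have "n = 0" using True by linarith
      then show ?thesis unfolding i using False by (auto intro!: sum.neutral)
    qed
  next
    case False
    have "f (take i xs @ g (take m (drop i xs)) # drop (i + m) xs) = 0" if "i \<le> length xs" "m \<le> length xs - i" for i
      using f(2) False that unfolding homogeneous_def by simp
    then show ?thesis unfolding i using False by (auto intro!: sum.neutral)
  qed
qed

lemma val_slot: "mlin f \<Longrightarrow> f (as @ val bas l # cs) = val (\<lambda>e. f (as @ bas e # cs)) l"
  by (rule val_hom [where h = "\<lambda>z. f (as @ z # cs)"]) (simp_all add: multilinearD)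

lemma val_upt: "val \<phi> [0..<n] = (\<Sum>i<n. \<phi> i)"
  by (induction n) (simp_all add: add.commute)

lemma rel_ins:
  assumes "rel n f F" "rel m g G" "mlin f" "homogeneous n f" "homogeneous m g"
    and ms: "length ms + 1 = n + m"
  shows "ins f g (map bas ms) = val bas (brk1 n m F G ms)"
proof -
  have "f (take i (map bas ms) @ g (take m (drop i (map bas ms))) # drop (i + m) (map bas ms)) =
      val bas (bnd (\<lambda>e. F (take i ms @ e # drop (i + m) ms)) (G (take m (drop i ms))))" if "i < n" for i
  proof -
    have "g (take m (drop i (map bas ms))) = val bas (G (take m (drop i ms)))"
      using assms(2) ms that by (simp add: rel_def take_map drop_map)
    moreover have "f (take i (map bas ms) @ bas e # drop (i + m) (map bas ms)) = val bas (F (take i ms @ e # drop (i + m) ms))" for e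
      using assms(1) [unfolded rel_def, rule_format, of "take i ms @ e # drop (i + m) ms"] ms that
      by (simp add: take_map drop_map)
    ultimately show ?thesis
      by (simp only: val_slot [OF assms(3)] val_bnd)
  qed
  then show ?thesis
    using ms by (simp add: ins_homogeneous [OF assms(3-5)] brk1_def val_bnd val_upt)
qed

lemma rel_bracket:
  "rel (gen_deg g + gen_deg h - 1) (bracket (cc g) (cc h)) (brkL g h)" if "gen_deg g + gen_deg h \<noteq> 0"
proof -
  have m: "mlin (cc g)" for g
    using cc_cyc [of g] by (simp add: cyc_iff cochains_mlin)
  show ?thesis
    using that by (auto simp: rel_def bracket_eq brkL_def rel_ins [OF rel_cc rel_cc m homogeneous_cc homogeneous_cc] add.commute)
qed

lemma homogeneous_bracket: "homogeneous (gen_deg g + gen_deg h - 1) (bracket (cc g) (cc h))"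
proof -
  have m: "mlin (cc g)" for g
    using cc_cyc [of g] by (simp add: cyc_iff cochains_mlin)
  show ?thesis
    by (auto simp: homogeneous_def bracket_eq ins_homogeneous [OF m homogeneous_cc homogeneous_cc])
qed

text \<open>On a free generator the recursions of \<open>FF\<close> and \<open>psi\<close> agree:
  \<open>hh\<close> makes the left coefficient the next argument, and right linearity takes the
  right coefficient out.\<close>

lemma FF_psi:
  assumes "mlin f"
  shows "FF f j as (tens 1 t 1) = val (\<lambda>(ms, e). f (as @ map bas ms) * bas e) (psi j t)"
proof (induction j arbitrary: as t)
  case 0
  then show ?case by (simp add: alg_map_tens bas_simps)
next
  case (Suc j)
  have F: "fam (FF f j)" by (rule fam_FF [OF assms])
  have *: "hh (FF f j) as (val tv l) = val (\<lambda>p. hh (FF f j) as (tv p)) l" for l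
    by (rule val_hom) (simp_all add: famD [OF fam_hh [OF F]])
  have "FF f (Suc j) as (tens 1 t 1) = hh (FF f j) as (val tv (DL (Suc j mod 4) t))"
    by (simp add: bimod_map_tens act_1 D_eq)
  also have "\<dots> = val (\<lambda>(ms, e). f (as @ map bas ms) * bas e) (psi (Suc j) t)"
    unfolding * psi.simps val_bnd
  proof (rule val_cong, clarify)
    fix b u c
    have "hh (FF f j) as (tv (b, u, c)) = FF f j (as @ [bas b]) (tens 1 u 1) * bas c"
      using famD(4) [OF F, of "as @ [bas b]" "tens 1 u 1" "bas c"] by (simp add: hh_tens [OF F] act_tens)
    also have "\<dots> = val (\<lambda>(ms, e). f ((as @ [bas b]) @ map bas ms) * bas e * bas c) (psi j u)"
      unfolding Suc by (subst val_hom [where h = "\<lambda>z. z * bas c"]) (simp_all add: distrib_right case_prod_unfold)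
    also have "\<dots> = val (\<lambda>(ms, e). f (as @ map bas ms) * bas e) (bnd (\<lambda>(ms, d). map (Pair (b # ms)) (mulm d c)) (psi j u))"
      unfolding val_bnd
      by (rule val_cong) (auto simp: mult.assoc bas_mult val_hom [of "(*) _"] distrib_left)
    finally show "hh (FF f j) as (tv (b, u, c)) = \<dots>" .
  qed
  finally show ?case .
qed

lemma psi_length: "(ms, e) \<in> set (psi n t) \<Longrightarrow> length ms = n"
  by (induction n arbitrary: ms e t) (auto simp: bnd_def)

lemma pull_rel:
  assumes "mlin f" "rel n f F"
  shows "pull n f t = val bas (pullL n F t)"
proof -
  have "pull n f t = val (\<lambda>(ms, e). f (map bas ms) * bas e) (psi n t)"
    by (simp add: pull_def FF_psi [OF assms(1)])
  also have "\<dots> = val (\<lambda>(ms, e). val bas (mulL (F ms) [e])) (psi n t)"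
    by (rule val_cong) (use assms(2) psi_length in \<open>auto simp: rel_def simp flip: val_mult\<close>)
  finally show ?thesis
    by (simp add: pullL_def val_nrm [OF dbl] val_bnd case_prod_unfold)
qed

fun cm :: "gen list \<Rightarrow> 'k kQ8 list \<Rightarrow> 'k kQ8" where
  "cm [] = unit_cochain"
| "cm (g # gs) = cup (cc g) (cm gs)"

lemma cm_cyc: "cm gs \<in> cyc"
  by (induction gs) (simp_all add: cc_cyc)

lemma homogeneous_cm: "homogeneous (gsdeg gs) (cm gs)"
  by (induction gs) (auto simp: homogeneous_cup homogeneous_cc, simp add: homogeneous_def)

lemma rel_cm: "rel (gsdeg gs) (cm gs) (cML gs)"
proof (induction gs)
  case (Cons g gs)
  then show ?case
    using rel_cup [OF rel_cc Cons.IH homogeneous_cc] by simp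
qed (simp add: rel_def bas_simps)

end

section \<open>Linearity and periodicity of the pullback\<close>

lemma val_add: "val (\<lambda>a. \<phi> a + \<psi> a) l = val \<phi> l + val \<psi> l"
  by (induction l) (simp_all add: add_ac)

lemma val_0: "val (\<lambda>_. 0) l = 0"
  by (induction l) simp_all

context quat
begin

lemma alg_map_res_cong:
  assumes "p \<in> res n" "\<And>t. t \<in> cells n \<Longrightarrow> w t = w' t"
  shows "alg_map w p = alg_map w' (p :: 'k bimod)"
  by (rule res_eqI [OF klin_maps(2) klin_maps(2) _ assms(1)]) (simp add: alg_map_tens assms(2))

lemma alg_map_linear_left:
  "alg_map (\<lambda>t. w t + w' t) (p :: 'k bimod) = alg_map w p + alg_map w' p"
  "alg_map (\<lambda>t. vscale c (w t)) p = vscale c (alg_map w p)"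
  by (rule klin_tens_eqI [where p = p]; simp add: klin_iff alg_map_tens algebra_simps vscale_mult vscale_vscale)+

lemma alg_map_sum_left: "alg_map (\<lambda>t. \<Sum>i\<in>I. w i t) (p :: 'k bimod) = (\<Sum>i\<in>I. alg_map (w i) p)"
  by (induction I rule: infinite_finite_induct) (simp_all add: alg_map_linear_left bimod_map_0)

lemma pull_eq_val: "mlin f \<Longrightarrow> pull n f t = val (\<lambda>(ms, e). f (map bas ms) * bas e) (psi n t)"
  by (simp add: pull_def FF_psi)

lemma pull_add:
  assumes "mlin f" "mlin g"
  shows "pull n (\<lambda>xs. f xs + g xs) t = pull n f t + pull n g t"
  using assms by (simp add: pull_eq_val mlin_add distrib_right case_prod_unfold val_add)

lemma pull_scale:
  assumes "mlin f"
  shows "pull n (\<lambda>xs. vscale c (f xs)) t = vscale c (pull n f t)"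
  using assms by (simp add: pull_eq_val mlin_scale vscale_mult case_prod_unfold val_hom [of "vscale c"])

lemma pull_0: "pull n (\<lambda>xs. 0) t = 0"
  by (simp add: pull_eq_val mlin_0 case_prod_unfold val_0)

lemma cyc_mlin: "f \<in> cyc \<Longrightarrow> mlin f"
  by (simp add: cyc_iff cochains_mlin)

text \<open>A single step of the unrolled recursion. The periodicity proof inducts on the stage
  while the list of collected arguments grows, so the closed form with \<open>psi\<close> does not
  suit it.\<close>

lemma FF_step:
  assumes "mlin f"
  shows "FF f (Suc j) as (tens 1 t 1) = val (\<lambda>(b, u, c). FF f j (as @ [bas b]) (tens 1 u 1) * bas c) (DL (Suc j mod 4) t)"
proof -
  have F: "fam (FF f j)" by (rule fam_FF [OF assms])
  have "FF f (Suc j) as (tens 1 t 1) = hh (FF f j) as (val tv (DL (Suc j mod 4) t))"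
    by (simp add: bimod_map_tens act_1 D_eq)
  also have "\<dots> = val (\<lambda>p. hh (FF f j) as (tv p)) (DL (Suc j mod 4) t)"
    by (rule val_hom) (simp_all add: famD [OF fam_hh [OF F]])
  also have "\<dots> = val (\<lambda>(b, u, c). FF f j (as @ [bas b]) (tens 1 u 1) * bas c) (DL (Suc j mod 4) t)"
  proof (rule val_cong, clarify)
    fix b u c
    show "hh (FF f j) as (tv (b, u, c)) = FF f j (as @ [bas b]) (tens 1 u 1) * bas c"
      using famD(4) [OF F, of "as @ [bas b]" "tens 1 u 1" "bas c"] by (simp add: hh_tens [OF F] act_tens)
  qed
  finally show ?thesis .
qed

lemma DL_cells:
  assumes "(b, u, c) \<in> set (DL (Suc n mod 4) t)"
  shows "u \<in> cells n"
proof -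
  have "n mod 4 = 0 \<or> n mod 4 = 1 \<or> n mod 4 = 2 \<or> n mod 4 = 3" by auto
  then show ?thesis
    using assms by (elim disjE; cases t) (auto simp: DL_def cells_def mod_Suc)
qed

lemma D_res: "D (Suc n) t \<in> res n"
  unfolding D_eq by (rule res_val, clarify, simp only: tv_eq, rule res_tens, erule DL_cells)

lemma pull_cc:
  assumes "t \<in> cells (gen_deg g)"
  shows "pull (gen_deg g) (cc g) t = val bas (wL g t)"
proof -
  have "nrm (pullL (gen_deg g) (cL g) t @ wL g t) = []"
    using table_pull all_gens [of g] assms unfolding list_all_iff cells_eq [symmetric] by blast
  then have "val bas (pullL (gen_deg g) (cL g) t) + val bas (wL g t) = 0"
    by (simp flip: val_simps(3) add: nrm_zero)
  then show ?thesis
    by (simp add: pull_rel [OF cyc_mlin [OF cc_cyc] rel_cc] dbl_eqI)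
qed

text \<open>Multiplication by \<open>z\<close> is the periodicity of the resolution.\<close>

lemma FF_cup_Z:
  assumes f: "mlin f" "homogeneous N f" and "length as + n = N" "t \<in> cells n"
  shows "FF (cup f (cc Z)) (n + 4) as (tens 1 t 1) = FF f n as (tens 1 t 1)"
  using assms(3,4)
proof (induction n arbitrary: as t)
  case 0
  have m: "mlin (cup f (cc Z))"
    by (intro mlin_cup f cyc_mlin cc_cyc)
  have t: "t = Pt" using 0 by (simp add: cells_def)
  \<comment> \<open>All \<open>N\<close> arguments of \<open>f\<close> have been collected in
    \<open>as\<close>, so the cup product can only be split at the end of \<open>as\<close>, and the
    last four arguments go to \<open>z\<close>.\<close>
  have c: "cup f (cc Z) (as @ bs) = f as * cc Z bs" for bs
    using cup_homogeneous [OF f(2), of "as @ bs"] 0 by simp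
  have "FF (cup f (cc Z)) 4 as (tens 1 t 1) = val (\<lambda>p. f as * (case p of (ms, e) \<Rightarrow> cc Z (map bas ms) * bas e)) (psi 4 Pt)"
    unfolding FF_psi [OF m] t by (rule val_cong) (auto simp: c mult.assoc) 
  also have "\<dots> = f as * pull 4 (cc Z) Pt"
    unfolding pull_eq_val [OF cyc_mlin [OF cc_cyc]]
    by (rule val_hom [symmetric, where h = "\<lambda>z. f as * z"]) (simp_all add: distrib_left)
  also have "pull 4 (cc Z) Pt = 1"
    using pull_cc [of Pt Z] by (simp add: cells_def bas_simps)
  finally show ?case
    by (simp add: t alg_map_tens)
next
  case (Suc n)
  have m: "mlin (cup f (cc Z))"
    by (intro mlin_cup f cyc_mlin cc_cyc)
  \<comment> \<open>The differentials of degrees \<open>n + 1\<close> and \<open>n + 5\<close>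
    coincide, so both recursions run in parallel.\<close>
  have i: "Suc (n + 4) mod 4 = Suc n mod 4"
    using mod_add_self2 [of "Suc n" 4] by (simp only: add_Suc)
  have "FF (cup f (cc Z)) (Suc (n + 4)) as (tens 1 t 1) = FF f (Suc n) as (tens 1 t 1)"
    unfolding FF_step [OF m] FF_step [OF f(1)] i
  proof (rule val_cong, clarify)
    fix b u c assume "(b, u, c) \<in> set (DL (Suc n mod 4) t)"
    then show "FF (cup f (cc Z)) (n + 4) (as @ [bas b]) (tens 1 u 1) * bas c = FF f n (as @ [bas b]) (tens 1 u 1) * bas c"
      using Suc by (simp add: DL_cells)
  qed
  then show ?case by (simp only: add_Suc)
qed

fun zq :: "gen list \<Rightarrow> nat \<Rightarrow> 'k kQ8 list \<Rightarrow> 'k kQ8" where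
  "zq gs 0 = cm gs"
| "zq gs (Suc q) = cup (zq gs q) (cc Z)"

lemma zq_cyc: "zq gs q \<in> cyc"
  by (induction q) (simp_all add: cm_cyc cc_cyc)

lemma homogeneous_zq: "homogeneous (gsdeg gs + 4 * q) (zq gs q)"
proof (induction q)
  case (Suc q)
  show ?case
    using homogeneous_cup [OF Suc homogeneous_cc [of Z]] by (simp add: add_ac)
qed (simp add: homogeneous_cm)

lemma pull_zq:
  assumes "t \<in> cells (gsdeg gs)"
  shows "pull (gsdeg gs + 4 * q) (zq gs q) t = pull (gsdeg gs) (cm gs) t"
proof (induction q)
  case (Suc q)
  have "t \<in> cells (gsdeg gs + 4 * q)"
  proof -
    have "(gsdeg gs + 4 * q) mod 4 = gsdeg gs mod 4" by simp
    then show ?thesis using assms by (simp only: cells_def)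
  qed
  then have "pull (gsdeg gs + 4 * q + 4) (cup (zq gs q) (cc Z)) t = pull (gsdeg gs + 4 * q) (zq gs q) t"
    using FF_cup_Z [OF cyc_mlin [OF zq_cyc] homogeneous_zq, of "[]"] by (simp add: pull_def)
  then show ?case using Suc by (simp add: add_ac)
qed simp

section \<open>Decomposition of cocycles on the minimal resolution\<close>

definition hv :: "(cell \<times> mon) list \<Rightarrow> cell \<Rightarrow> 'k kQ8" where
  "hv l t = val (\<lambda>(u, m). if u = t then bas m else 0) l"

lemma val_onL: "val bas (onL l t) = hv l t"
  unfolding onL_def hv_def val_bnd by (rule val_cong) auto

lemma val_tagL: "val \<phi> (tagL i W) = val (\<lambda>t. val (\<lambda>m. \<phi> (t, m)) (W t)) (cellL i)"
  by (simp add: tagL_def val_bnd)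

lemma val_cellL: "val \<phi> (cellL (n mod 4)) = (\<Sum>t\<in>cells n. \<phi> t)"
  by (auto simp: cells_def)

lemma hv_tagL: "t \<in> cells n \<Longrightarrow> hv (tagL (n mod 4) W) t = val bas (W t)"
proof -
  assume t: "t \<in> cells n"
  have "hv (tagL (n mod 4) W) t = (\<Sum>u\<in>cells n. if u = t then val bas (W u) else 0)"
    unfolding hv_def val_tagL val_cellL by (rule sum.cong) (auto simp: val_0)
  then show ?thesis using t by simp
qed

lemma val_cobL: "val bas (cobL (n mod 4) l t) = alg_map (hv l) (D n t)"
  by (simp add: cobL_def val_algL D_eq val_onL)

text \<open>The certificate of \<open>table_span\<close> read off at the cell \<open>t\<close>. The
  \<open>TAU\<close> part is written as a linear function of the coboundary of the basis element, so
  that it vanishes once basis elements are summed up to a cocycle.\<close>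

lemma span_identity:
  assumes t: "t \<in> cells n" "t0 \<in> cells n"
  shows "(if t0 = t then bas m else 0) =
      val (\<lambda>gs. val bas (pullL (n mod 4) (cML gs) t)) (LAM (n mod 4) t0 m) +
      alg_map (hv (SIG (n mod 4) t0 m)) (D n t) +
      (\<Sum>u\<in>cells (Suc n). bext (\<lambda>q. hv (TAU (n mod 4) u q) t) (alg_map (hv [(t0, m)]) (D (Suc n) u)))"
proof -
  let ?i = "n mod 4"
  have "?i = 0 \<or> ?i = 1 \<or> ?i = 2 \<or> ?i = 3" by auto
  then have i: "?i \<in> set [0, 1, 2, 3]" by auto
  have si: "Suc ?i mod 4 = Suc n mod 4" by (simp add: mod_Suc_eq)
  have "nrm (tagL ?i (onL [(t0, m)]) @ bnd (\<lambda>gs. tagL ?i (pullL ?i (cML gs))) (LAM ?i t0 m) @ tagL ?i (cobL ?i (SIG ?i t0 m)) @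
       bnd (\<lambda>(u, q). TAU ?i u q) (tagL (Suc ?i mod 4) (cobL (Suc ?i mod 4) [(t0, m)]))) = []"
    using table_span(1) i t(2) all_mons [of m] unfolding list_all_iff cells_eq [symmetric] by blast
  then have "hv (tagL ?i (onL [(t0, m)]) @ bnd (\<lambda>gs. tagL ?i (pullL ?i (cML gs))) (LAM ?i t0 m) @ tagL ?i (cobL ?i (SIG ?i t0 m)) @
       bnd (\<lambda>(u, q). TAU ?i u q) (tagL (Suc n mod 4) (cobL (Suc n mod 4) [(t0, m)]))) t = 0"
    unfolding hv_def si by (rule nrm_zero)
  then have "hv (tagL ?i (onL [(t0, m)])) t + (hv (bnd (\<lambda>gs. tagL ?i (pullL ?i (cML gs))) (LAM ?i t0 m)) t +
      (hv (tagL ?i (cobL ?i (SIG ?i t0 m))) t +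
       hv (bnd (\<lambda>(u, q). TAU ?i u q) (tagL (Suc n mod 4) (cobL (Suc n mod 4) [(t0, m)]))) t)) = 0"
    by (simp only: hv_def val_simps)
  moreover have "hv (tagL ?i (onL [(t0, m)])) t = (if t0 = t then bas m else 0)"
    by (simp add: hv_tagL [OF t(1)] val_onL) (simp add: hv_def)
  moreover have "hv (bnd (\<lambda>gs. tagL ?i (pullL ?i (cML gs))) (LAM ?i t0 m)) t =
      val (\<lambda>gs. val bas (pullL ?i (cML gs) t)) (LAM ?i t0 m)"
    by (simp add: hv_def val_bnd) (simp add: hv_tagL [OF t(1)] flip: hv_def)
  moreover have "hv (tagL ?i (cobL ?i (SIG ?i t0 m))) t = alg_map (hv (SIG ?i t0 m)) (D n t)"
    by (simp add: hv_tagL [OF t(1)] val_cobL)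
  moreover have "hv (bnd (\<lambda>(u, q). TAU ?i u q) (tagL (Suc n mod 4) (cobL (Suc n mod 4) [(t0, m)]))) t =
      (\<Sum>u\<in>cells (Suc n). bext (\<lambda>q. hv (TAU ?i u q) t) (alg_map (hv [(t0, m)]) (D (Suc n) u)))"
  proof -
    let ?B = "\<lambda>u. bext (\<lambda>q. hv (TAU ?i u q) t)"
    have "?B u (alg_map (hv [(t0, m)]) (D (Suc n) u)) =
        val (\<lambda>q. hv (TAU ?i u q) t) (cobL (Suc n mod 4) [(t0, m)] u)" for u
      unfolding val_cobL [symmetric]
    proof (subst val_hom [where h = "?B u"])
      show "?B u 0 = 0" by (rule klin_0 [OF klin_bext])
      show "?B u (a + b) = ?B u a + ?B u b" for a b
        using klin_bext [of "\<lambda>q. hv (TAU ?i u q) t"] by (simp add: klin_iff)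
    qed (simp add: bext_bas)
    then show ?thesis
      unfolding hv_def val_bnd val_tagL val_cellL by (simp add: case_prod_unfold)
  qed
  ultimately show ?thesis
    by - (rule dbl_eqI, simp add: add.assoc)
qed

text \<open>Sum the certificate over the monomial coordinates of \<open>w\<close>. The
  \<open>TAU\<close> parts add up to a linear function of the coboundary of \<open>w\<close>, which
  is zero; products of generators and a coboundary are left.\<close>

lemma cocycle_decomposition:
  assumes w: "\<And>u. alg_map w (D (Suc n) u) = 0"
  obtains c where "n mod 4 = 0 \<Longrightarrow> c = (\<lambda>_. 0)"
    "\<And>t. t \<in> cells n \<Longrightarrow> w t = (\<Sum>t0\<in>cells n. \<Sum>m\<in>UNIV. vscale (cf m (w t0))
       (val (\<lambda>gs. val bas (pullL (n mod 4) (cML gs) t)) (LAM (n mod 4) t0 m))) + alg_map c (D n t)"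
proof -
  let ?i = "n mod 4"
  define c where "c = (\<lambda>t. \<Sum>t0\<in>cells n. \<Sum>m\<in>UNIV. vscale (cf m (w t0)) (hv (SIG ?i t0 m) t))"
  have c0: "c = (\<lambda>_. 0)" if "?i = 0"
  proof -
    have "SIG 0 t0 m = []" if "t0 \<in> cells n" for t0 m
      using table_span(3) all_mons [of m] that \<open>?i = 0\<close> unfolding list_all_iff cells_eq [symmetric] by auto
    then show ?thesis
      by (auto simp: c_def \<open>?i = 0\<close> hv_def intro!: HOL.ext sum.neutral)
  qed
  have decomp: "w t = (\<Sum>t0\<in>cells n. \<Sum>m\<in>UNIV. vscale (cf m (w t0))
       (val (\<lambda>gs. val bas (pullL ?i (cML gs) t)) (LAM ?i t0 m))) + alg_map c (D n t)" if t: "t \<in> cells n" for t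
  proof -
    have fin: "finite (cells n)" by simp
    let ?B = "\<lambda>u. bext (\<lambda>q. hv (TAU ?i u q) t)"
    have B: "klin (?B u)" for u by (rule klin_bext)
    have "w t = (\<Sum>t0\<in>cells n. if t0 = t then w t0 else 0)"
      using t by simp
    also have "\<dots> = (\<Sum>t0\<in>cells n. \<Sum>m\<in>UNIV. vscale (cf m (w t0)) (if t0 = t then bas m else 0))"
    proof (rule sum.cong [OF refl])
      fix t0
      show "(if t0 = t then w t0 else 0) = (\<Sum>m\<in>UNIV. vscale (cf m (w t0)) (if t0 = t then bas m else 0))"
        by (cases "t0 = t") (simp_all add: cf_expand)
    qed
    also have "\<dots> = (\<Sum>t0\<in>cells n. \<Sum>m\<in>UNIV. vscale (cf m (w t0))
         (val (\<lambda>gs. val bas (pullL ?i (cML gs) t)) (LAM ?i t0 m)) +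
         vscale (cf m (w t0)) (alg_map (hv (SIG ?i t0 m)) (D n t)) +
         vscale (cf m (w t0)) (\<Sum>u\<in>cells (Suc n). ?B u (alg_map (hv [(t0, m)]) (D (Suc n) u))))"
      by (intro sum.cong refl) (simp only: span_identity [OF t] vscale_add)
    also have "\<dots> = (\<Sum>t0\<in>cells n. \<Sum>m\<in>UNIV. vscale (cf m (w t0))
         (val (\<lambda>gs. val bas (pullL ?i (cML gs) t)) (LAM ?i t0 m))) +
         (\<Sum>t0\<in>cells n. \<Sum>m\<in>UNIV. vscale (cf m (w t0)) (alg_map (hv (SIG ?i t0 m)) (D n t))) +
         (\<Sum>t0\<in>cells n. \<Sum>m\<in>UNIV. vscale (cf m (w t0)) (\<Sum>u\<in>cells (Suc n). ?B u (alg_map (hv [(t0, m)]) (D (Suc n) u))))"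
      by (simp only: sum.distrib)
    also have "(\<Sum>t0\<in>cells n. \<Sum>m\<in>UNIV. vscale (cf m (w t0)) (alg_map (hv (SIG ?i t0 m)) (D n t))) = alg_map c (D n t)"
      by (simp add: c_def alg_map_sum_left alg_map_linear_left)
    also have "(\<Sum>t0\<in>cells n. \<Sum>m\<in>UNIV. vscale (cf m (w t0)) (\<Sum>u\<in>cells (Suc n). ?B u (alg_map (hv [(t0, m)]) (D (Suc n) u)))) = 0"
    proof -
      have "(\<Sum>t0\<in>cells n. \<Sum>m\<in>UNIV. vscale (cf m (w t0)) (\<Sum>u\<in>cells (Suc n). ?B u (alg_map (hv [(t0, m)]) (D (Suc n) u)))) =
          (\<Sum>t0\<in>cells n. \<Sum>m\<in>UNIV. \<Sum>u\<in>cells (Suc n). ?B u (vscale (cf m (w t0)) (alg_map (hv [(t0, m)]) (D (Suc n) u))))"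
        using B by (simp add: vscale_sum klin_iff)
      also have "\<dots> = (\<Sum>u\<in>cells (Suc n). \<Sum>t0\<in>cells n. \<Sum>m\<in>UNIV. ?B u (vscale (cf m (w t0)) (alg_map (hv [(t0, m)]) (D (Suc n) u))))"
        by (simp only: sum.swap [where A = UNIV and B = "cells (Suc n)"], rule sum.swap)
      also have "\<dots> = (\<Sum>u\<in>cells (Suc n). ?B u (alg_map (\<lambda>t'. \<Sum>t0\<in>cells n. \<Sum>m\<in>UNIV. vscale (cf m (w t0)) (hv [(t0, m)] t')) (D (Suc n) u)))"
        by (simp add: klin_sum [OF B] alg_map_sum_left alg_map_linear_left)
      also have "\<dots> = (\<Sum>u\<in>cells (Suc n). ?B u (alg_map w (D (Suc n) u)))"
      proof (intro sum.cong refl arg_cong [where f = "?B _"] alg_map_res_cong [OF D_res])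
        fix t' assume t': "t' \<in> cells n"
        have "(\<Sum>m\<in>UNIV. vscale (cf m (w t0)) (hv [(t0, m)] t')) = (if t0 = t' then w t0 else 0)" for t0
          by (cases "t0 = t'") (simp_all add: hv_def cf_expand)
        then show "(\<Sum>t0\<in>cells n. \<Sum>m\<in>UNIV. vscale (cf m (w t0)) (hv [(t0, m)] t')) = w t'"
          using t' by simp
      qed
      finally show ?thesis
        by (simp add: w klin_0 [OF B])
    qed
    finally show ?thesis by simp
  qed
  show thesis by (rule that [OF c0 decomp])
qed

end

section \<open>Classes transported by a given comparison map\<close>

locale quat_comparison = quat x y for x y :: "'k::field kQ8" +
  fixes \<Phi> :: "'k kQ8 list \<Rightarrow> 'k bimod"
  assumes comparison: "comparison_map x y \<Phi>"
begin

abbreviation "cl \<equiv> hh_class (vscale :: 'k \<Rightarrow> 'k kQ8 \<Rightarrow> 'k kQ8)"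
abbreviation "R \<equiv> HH (vscale :: 'k \<Rightarrow> 'k kQ8 \<Rightarrow> 'k kQ8)"

lemma comparison_facts:
  "multilinear vscale vscale \<Phi>" "\<Phi> xs \<in> res (length xs)" "alg_map (\<lambda>_. 1) (\<Phi> []) = 1"
  "xs \<noteq> [] \<Longrightarrow> bimod_map (D (length xs)) (\<Phi> xs) = bar_diff (\<lambda>a p. act a p 1) (\<lambda>p a. act 1 p a) \<Phi> xs"
  using comparison by (auto simp: comparison_map_def res_diff_def augmentation_def)

lemma chain: "xs \<noteq> [] \<Longrightarrow> bimod_map (D (length xs)) (\<Phi> xs) =
    act (hd xs) (\<Phi> (tl xs)) 1 + mrg \<Phi> xs + act 1 (\<Phi> (butlast xs)) (last xs)"
  using comparison_facts(4) [of xs] bar_diff_char2 [OF doubleP, of xs _ _ \<Phi>] by simp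

lemma res_class_cong:
  assumes "\<And>t. t \<in> cells n \<Longrightarrow> w t = w' t"
  shows "res_class \<Phi> n w = res_class \<Phi> n w'"
proof -
  have "(if length xs = n then alg_map w (\<Phi> xs) else 0) = (if length xs = n then alg_map w' (\<Phi> xs) else 0)" for xs
    using alg_map_res_cong [OF comparison_facts(2) [of xs], of w w'] assms by auto
  then show ?thesis by (simp add: res_class_def)
qed

lemma class_eq_res_class:
  assumes "f \<in> cyc" "homogeneous n f"
  shows "cl f = res_class \<Phi> n (pull n f)"
  unfolding res_class_def
  by (rule class_eq_pull [OF assms comparison_facts(1,3,4)])

lemma res_coboundary:
  "(\<lambda>xs. if length xs = Suc n then alg_map (\<lambda>t. alg_map c (D (Suc n) t)) (\<Phi> xs) else 0) \<in> coboundaries vscale"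
proof -
  let ?g = "\<lambda>xs. if length xs = n then alg_map c (\<Phi> xs) else 0"
  have "(\<lambda>xs. if length xs = Suc n then alg_map (\<lambda>t. alg_map c (D (Suc n) t)) (\<Phi> xs) else 0) = hoch_diff ?g"
    by (intro HOL.ext) (simp add: hoch_diff_alg_map [OF chain] alg_map_bimod_map)
  then show ?thesis
    using cochain_P0 [OF comparison_facts(1)] by (simp add: coboundaries_def)
qed

text \<open>Both classes are the transports of their pullbacks along \<open>\<Phi>\<close>, and
  \<open>\<Phi>\<close> carries coboundaries to coboundaries. The condition on \<open>c\<close> is
  there because \<open>D 0\<close> is formally the differential of degree 4, while nothing maps into
  degree 0 of the cochain complex.\<close>

lemma class_eqI:
  assumes "f \<in> cyc" "homogeneous n f" "g \<in> cyc" "homogeneous n g"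
    and c: "n = 0 \<Longrightarrow> c = (\<lambda>_. 0)"
    and eq: "\<And>t. t \<in> cells n \<Longrightarrow> pull n f t = pull n g t + alg_map c (D n t)"
  shows "cl f = cl g"
proof -
  have "cl f = res_class \<Phi> n (\<lambda>t. pull n g t + alg_map c (D n t))"
    using class_eq_res_class [OF assms(1,2)] res_class_cong [OF eq] by simp
  also have "\<dots> = res_class \<Phi> n (pull n g)"
  proof (cases n)
    case 0
    then show ?thesis using c by (simp add: bimod_map_0)
  next
    case (Suc m)
    have "(\<lambda>xs. (if length xs = n then alg_map (\<lambda>t. pull n g t + alg_map c (D n t)) (\<Phi> xs) else 0) +
        (if length xs = n then alg_map (pull n g) (\<Phi> xs) else 0)) =
        (\<lambda>xs. if length xs = n then alg_map (\<lambda>t. alg_map c (D n t)) (\<Phi> xs) else 0)"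
      by (auto simp: alg_map_linear_left char2_simps)
    then show ?thesis
      unfolding res_class_def using res_coboundary [of m c, folded Suc] by (intro hh_class_cong) (simp only:)
  qed
  also have "\<dots> = cl g"
    by (rule class_eq_res_class [OF assms(3,4), symmetric])
  finally show ?thesis .
qed

text \<open>The pullback of \<open>cc g\<close> is the map defining the generator, so transport
  along \<open>\<Phi>\<close> returns the class of \<open>cc g\<close>, whichever
  \<open>\<Phi>\<close> is given.\<close>

lemma gen_class_eq: "gen_class x y \<Phi> g = cl (cc g)"
proof -
  have "res_class \<Phi> (gen_deg g) (gen_map x y g) = res_class \<Phi> (gen_deg g) (pull (gen_deg g) (cc g))"
    by (rule res_class_cong) (simp add: pull_cc val_wL)
  then show ?thesis
    by (simp add: gen_class_def class_eq_res_class [OF cc_cyc homogeneous_cc])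
qed

section \<open>Evaluation of the bracket table\<close>

definition SS :: "gen list list \<Rightarrow> 'k kQ8 list \<Rightarrow> 'k kQ8" where
  "SS v xs = val (\<lambda>gs. cm gs xs) v"

lemma SS_simps: "SS [] = (\<lambda>xs. 0)" "SS (gs # v) = (\<lambda>xs. cm gs xs + SS v xs)"
  by (simp_all add: SS_def [abs_def])

lemma SS_cyc: "SS v \<in> cyc"
  by (induction v) (simp_all add: SS_simps cm_cyc)

lemma SS_homogeneous: "\<forall>gs\<in>set v. gsdeg gs = n \<Longrightarrow> homogeneous n (SS v)"
  by (induction v) (use homogeneous_cm in \<open>auto simp: SS_simps homogeneous_def\<close>)

lemma pull_SS: "\<forall>gs\<in>set v. gsdeg gs = n \<Longrightarrow> pull n (SS v) t = val (\<lambda>gs. val bas (pullL n (cML gs) t)) v"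
proof (induction v)
  case (Cons gs v)
  then have "pull n (cm gs) t = val bas (pullL n (cML gs) t)"
    using pull_rel [OF cyc_mlin [OF cm_cyc] rel_cm, of gs t] by simp
  then show ?case
    using Cons by (simp add: SS_simps pull_add cyc_mlin cm_cyc SS_cyc)
qed (simp add: SS_simps pull_0)

lemma bracket_row:
  assumes "(g, h, v, c) \<in> set bracket_rows" "gen_deg g + gen_deg h \<noteq> 0"
  shows "cl (bracket (cc g) (cc h)) = cl (SS v)"
proof -
  define n where "n = gen_deg g + gen_deg h - 1"
  have "row_ok (g, h, v, c)"
    using table_brackets assms(1) unfolding list_all_iff by blast
  then have ok: "\<And>t. t \<in> cells n \<Longrightarrow> nrm (pullL n (brkL g h) t @ bnd (\<lambda>gs. pullL n (cML gs) t) v @ cobL (n mod 4) c t) = []"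
    and v: "\<forall>gs\<in>set v. gsdeg gs = n" and c: "n = 0 \<Longrightarrow> c = []"
    unfolding row_ok_def Let_def n_def [symmetric] prod.case list_all_iff cells_eq by blast+
  have b: "bracket (cc g) (cc h) \<in> cyc" "homogeneous n (bracket (cc g) (cc h))"
    using homogeneous_bracket by (simp_all add: cc_cyc n_def)
  show ?thesis
  proof (rule class_eqI [OF b SS_cyc SS_homogeneous [OF v], where c = "hv c"])
    show "hv c = (\<lambda>_. 0)" if "n = 0"
      using c [OF that] by (simp add: hv_def [abs_def])
    fix t assume "t \<in> cells n"
    from nrm_zero [OF ok [OF this], of bas]
    have "val bas (pullL n (brkL g h) t) + (val (\<lambda>gs. val bas (pullL n (cML gs) t)) v + alg_map (hv c) (D n t)) = 0"
      by (simp add: val_bnd val_cobL)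
    then have "val bas (pullL n (brkL g h) t) = val (\<lambda>gs. val bas (pullL n (cML gs) t)) v + alg_map (hv c) (D n t)"
      by (rule dbl_eqI)
    moreover have "pull n (bracket (cc g) (cc h)) t = val bas (pullL n (brkL g h) t)"
      unfolding n_def by (rule pull_rel [OF cyc_mlin rel_bracket [OF assms(2)]]) (simp add: cc_cyc)
    ultimately show "pull n (bracket (cc g) (cc h)) t = pull n (SS v) t + alg_map (hv c) (D n t)"
      by (simp add: pull_SS [OF v])
  qed
qed

lemma class_SS: "cl (SS []) = \<zero>\<^bsub>R\<^esub>" "cl (SS [[g]]) = cl (cc g)"
  "cl (SS [[g, g], [h]]) = cl (cc g) [^]\<^bsub>R\<^esub> (2::nat) \<oplus>\<^bsub>R\<^esub> cl (cc h)"
proof -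
  have 1: "cm [g] = cc g" for g
    by (rule HOL.ext) (simp add: cup_unit)
  have 2: "cm [g, g] = cup (cc g) (cc g)"
    using 1 by simp
  show "cl (SS []) = \<zero>\<^bsub>R\<^esub>"
    by (simp add: SS_simps hh_class_zero)
  show "cl (SS [[g]]) = cl (cc g)"
    unfolding SS_simps 1 by simp
  have "cl (cc g) [^]\<^bsub>R\<^esub> (2::nat) = cl (cc g) \<otimes>\<^bsub>R\<^esub> cl (cc g)"
    by (simp add: numeral_2_eq_2 cc_cyc)
  then show "cl (SS [[g, g], [h]]) = cl (cc g) [^]\<^bsub>R\<^esub> (2::nat) \<oplus>\<^bsub>R\<^esub> cl (cc h)"
    unfolding SS_simps 1 2 by (simp add: hh_class_mult hh_class_add cc_cyc)
qed

lemma brackets_listed: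
  assumes "(g, h, v) \<in> nonzero_brackets R (\<lambda>g. cl (cc g))"
  shows "cl (bracket (cc g) (cc h)) = v"
proof -
  have "\<exists>u c. (g, h, u, c) \<in> set bracket_rows \<and> gen_deg g + gen_deg h \<noteq> 0 \<and> v = cl (SS u)"
    using assms unfolding nonzero_brackets_def
    by (elim insertE emptyE; simp add: bracket_rows_def class_SS)
  then show ?thesis
    using bracket_row by blast
qed

end

abbreviation "gens \<equiv> [P1, P2, P2', P3, U1, U1', V1, V2, V2', Z]"

text \<open>The pairs of \<open>nonzero_brackets\<close> without their values, so that membership
  can be decided by evaluation.\<close>

abbreviation "listed_pairs \<equiv> [(P1, U1), (P3, U1), (P2, U1'), (P2, U1), (P2', U1'), (P2', U1), (P1, U1'), (P3, U1'),
   (U1, V1), (U1', V2'), (U1', V1), (U1, V2), (U1', V2), (U1, V2')]"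

text \<open>Completeness of the rows up to the order of the arguments, from which the vanishing of
  all unlisted brackets is deduced.\<close>

lemma table_rows:
  "list_all (\<lambda>g. list_all (\<lambda>h. g = h \<or> gen_deg g + gen_deg h = 0 \<or>
     list_ex (\<lambda>(a, b, u, c). a = g \<and> b = h \<or> a = h \<and> b = g) bracket_rows) gens) gens"
  "list_all (\<lambda>(g, h, u, c). u = [] \<or> list_ex (\<lambda>p. p = (g, h)) listed_pairs) bracket_rows"
  by code_simp+

lemma listed_pairs: "(g, h) \<in> set listed_pairs \<Longrightarrow> \<exists>v. (g, h, v) \<in> nonzero_brackets R c"
  unfolding nonzero_brackets_def list.set by (elim insertE emptyE) simp_all

context quat_comparison
begin

lemma brackets_unlisted:
  assumes "\<And>v. (g, h, v) \<notin> nonzero_brackets R (\<lambda>g. cl (cc g)) \<and> (h, g, v) \<notin> nonzero_brackets R (\<lambda>g. cl (cc g))"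
  shows "cl (bracket (cc g) (cc h)) = \<zero>\<^bsub>R\<^esub>"
proof -
  have listed: "u = [] \<or> (\<exists>v. (g, h, v) \<in> nonzero_brackets R (\<lambda>g. cl (cc g)))"
    if "(g, h, u, c) \<in> set bracket_rows" for g h u c
  proof -
    have "case (g, h, u, c) of (g, h, u, c) \<Rightarrow> u = [] \<or> list_ex (\<lambda>p. p = (g, h)) listed_pairs"
      using table_rows(2) that unfolding list_all_iff by (rule bspec)
    then have "u = [] \<or> (g, h) \<in> set listed_pairs"
      unfolding prod.case list_ex_iff by blast
    then show ?thesis
      using listed_pairs by blast
  qed
  have rows: "g = h \<or> gen_deg g + gen_deg h = 0 \<or>
      (\<exists>u c. (g, h, u, c) \<in> set bracket_rows) \<or> (\<exists>u c. (h, g, u, c) \<in> set bracket_rows)" for g h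
    using bspec [OF bspec [OF table_rows(1) [unfolded list_all_iff] all_gens [of g]] all_gens [of h]]
    unfolding list_ex_iff by blast
  have comm: "bracket (cc h) (cc g) = bracket (cc g) (cc h)"
    by (rule HOL.ext) (rule bracket_commute)
  have row0: "cl (bracket (cc g') (cc h')) = \<zero>\<^bsub>R\<^esub>"
    if "(g', h', u, c) \<in> set bracket_rows" "gen_deg g' + gen_deg h' \<noteq> 0"
      "\<And>v. (g', h', v) \<notin> nonzero_brackets R (\<lambda>g. cl (cc g))" for g' h' u c
    using bracket_row [OF that(1,2)] listed [OF that(1)] that(3) by (auto simp: class_SS)
  show ?thesis
  proof (cases "g = h \<or> gen_deg g + gen_deg h = 0")
    case True
    \<comment> \<open>Pairs without a row: for \<open>g = h\<close> the circle product is added to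
      itself, and a cochain of degree 0 has no argument to insert into.\<close>
    have "bracket (cc g) (cc h) xs = 0" for xs
      using True ins_homogeneous [OF cyc_mlin [OF cc_cyc] homogeneous_cc homogeneous_cc]
      by (auto simp: bracket_eq double)
    then have "bracket (cc g) (cc h) = (\<lambda>_. 0)" by (rule HOL.ext)
    then show ?thesis by (simp add: hh_class_zero)
  next
    case False
    then consider u c where "(g, h, u, c) \<in> set bracket_rows" | u c where "(h, g, u, c) \<in> set bracket_rows"
      using rows [of g h] by (elim disjE exE) auto
    then show ?thesis
    proof cases
      case 1
      show ?thesis by (rule row0 [OF 1]) (use False assms in auto)
    next
      case 2
      show ?thesis
        unfolding comm [symmetric] by (rule row0 [OF 2]) (use False assms in auto)
    qed
  qed
qed

lemma table: "bracket_table R (gen_class x y \<Phi>) (hh_bracket vscale)"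
proof -
  have c: "gen_class x y \<Phi> = (\<lambda>g. cl (cc g))"
    by (rule HOL.ext) (rule gen_class_eq)
  have b: "hh_bracket vscale (cl (cc g)) (cl (cc h)) = cl (bracket (cc g) (cc h))" for g h
    by (rule hh_bracket_class) (rule cc_cyc)+
  have comm: "bracket (cc h) (cc g) = bracket (cc g) (cc h)" for g h
    by (rule HOL.ext) (rule bracket_commute)
  show ?thesis
    unfolding bracket_table_def c b
  proof (intro conjI ballI allI impI)
    fix r assume "r \<in> nonzero_brackets R (\<lambda>g. cl (cc g))"
    moreover obtain g h v where "r = (g, h, v)" by (cases r)
    ultimately show "case r of (g, h, v) \<Rightarrow> cl (bracket (cc g) (cc h)) = v \<and> cl (bracket (cc h) (cc g)) = v"
      using brackets_listed [of g h v] comm [of g h] by simp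
  next
    fix g h
    assume "\<forall>v. (g, h, v) \<notin> nonzero_brackets R (\<lambda>g. cl (cc g)) \<and> (h, g, v) \<notin> nonzero_brackets R (\<lambda>g. cl (cc g))"
    then show "cl (bracket (cc g) (cc h)) = \<zero>\<^bsub>R\<^esub>"
      by (intro brackets_unlisted) blast
  qed
qed

section \<open>The generators span the cohomology\<close>

text \<open>Products of generators together with their degrees; the degree is recorded because the
  graded bracket axioms apply to homogeneous elements.\<close>

inductive mn :: "nat \<Rightarrow> ('k kQ8 list \<Rightarrow> 'k kQ8) set \<Rightarrow> bool" where
  mn_one: "mn 0 \<one>\<^bsub>R\<^esub>"
| mn_gen: "mn (gen_deg g) (cl (cc g))"
| mn_mult: "mn n a \<Longrightarrow> mn m b \<Longrightarrow> mn (n + m) (a \<otimes>\<^bsub>R\<^esub> b)"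

lemma mn_class: "mn n a \<Longrightarrow> \<exists>f. f \<in> cyc \<and> homogeneous n f \<and> a = cl f"
proof (induction rule: mn.induct)
  case mn_one
  have "homogeneous 0 unit_cochain" by (simp add: homogeneous_def)
  then show ?case
    unfolding hh_class_one using cyc_closed(5) by blast
next
  case (mn_gen g)
  then show ?case using cc_cyc homogeneous_cc by blast
next
  case (mn_mult n a m b)
  then show ?case
    using hh_class_mult homogeneous_cup cyc_closed(2) by metis
qed

lemma mn_deg: "mn n a \<Longrightarrow> a \<in> HH_deg vscale n"
  using mn_class unfolding HH_deg_def by blast

lemma mn_carrier: "mn n a \<Longrightarrow> a \<in> carrier R"
  by (drule mn_class) auto

lemma mn_cm: "mn (gsdeg gs) (cl (cm gs))"
proof (induction gs)
  case Nil
  show ?case using mn_one by (simp add: hh_class_one)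
next
  case (Cons g gs)
  then show ?case
    using mn_mult [OF mn_gen Cons] by (simp add: hh_class_mult cc_cyc cm_cyc)
qed

lemma mn_zq: "mn (gsdeg gs + 4 * q) (cl (zq gs q))"
proof (induction q)
  case 0
  show ?case using mn_cm by simp
next
  case (Suc q)
  have "mn (gsdeg gs + 4 * q + gen_deg Z) (cl (zq gs q) \<otimes>\<^bsub>R\<^esub> cl (cc Z))"
    by (rule mn_mult [OF Suc mn_gen])
  then show ?case
    by (simp add: hh_class_mult cc_cyc zq_cyc add_ac)
qed

inductive sp :: "('k kQ8 list \<Rightarrow> 'k kQ8) set \<Rightarrow> bool" where
  sp_zero: "sp \<zero>\<^bsub>R\<^esub>"
| sp_mn: "mn n a \<Longrightarrow> sp a"
| sp_add: "sp a \<Longrightarrow> sp b \<Longrightarrow> sp (a \<oplus>\<^bsub>R\<^esub> b)"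
| sp_scale: "sp a \<Longrightarrow> sp (hh_scale vscale t a)"

lemma scale_carrier: "a \<in> carrier R \<Longrightarrow> hh_scale vscale t a \<in> carrier R"
  by (auto simp: carrier_HH hh_scale_class simp del: hh_class_closed)

lemma sp_carrier: "sp a \<Longrightarrow> a \<in> carrier R"
  by (induction rule: sp.induct) (auto simp: mn_carrier scale_carrier)

text \<open>The span lifted to cocycles, where linear combinations can be formed before
  \<open>pull\<close>, which is linear, is applied.\<close>

definition spc :: "('k kQ8 list \<Rightarrow> 'k kQ8) \<Rightarrow> bool" where
  "spc f \<longleftrightarrow> f \<in> cyc \<and> sp (cl f)"

lemma spc_0: "spc (\<lambda>xs. 0)"
  using sp_zero by (simp add: spc_def hh_class_zero)

lemma spc_add: "spc f \<Longrightarrow> spc g \<Longrightarrow> spc (\<lambda>xs. f xs + g xs)"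
  using sp_add by (auto simp: spc_def simp flip: hh_class_add)

lemma spc_scale: "spc f \<Longrightarrow> spc (\<lambda>xs. vscale c (f xs))"
  using sp_scale by (auto simp: spc_def simp flip: hh_scale_class)

lemma spc_sum: "(\<And>i. i \<in> I \<Longrightarrow> spc (f i)) \<Longrightarrow> spc (\<lambda>xs. \<Sum>i\<in>I. f i xs)"
  by (induction I rule: infinite_finite_induct) (simp_all add: spc_0 spc_add)

lemma spc_val: "(\<And>i. i \<in> set l \<Longrightarrow> spc (f i)) \<Longrightarrow> spc (\<lambda>xs. val (\<lambda>i. f i xs) l)"
  by (induction l) (simp_all add: spc_0 spc_add)

lemma spc_zq: "spc (zq gs q)"
  using sp_mn [OF mn_zq] by (simp add: spc_def zq_cyc)

lemma spc_mlin: "spc f \<Longrightarrow> mlin f"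
  by (simp add: spc_def cyc_mlin)

lemma pull_sum: "(\<And>i. i \<in> I \<Longrightarrow> spc (f i)) \<Longrightarrow> pull n (\<lambda>xs. \<Sum>i\<in>I. f i xs) t = (\<Sum>i\<in>I. pull n (f i) t)"
  by (induction I rule: infinite_finite_induct) (simp_all add: pull_0 pull_add spc_mlin spc_sum)

lemma pull_val: "(\<And>i. i \<in> set l \<Longrightarrow> spc (f i)) \<Longrightarrow> pull n (\<lambda>xs. val (\<lambda>i. f i xs) l) t = val (\<lambda>i. pull n (f i) t) l"
  by (induction l) (simp_all add: pull_0 pull_add spc_mlin spc_val)

text \<open>The pullback of \<open>f\<close> is decomposed into pullbacks of products of degree
  \<open>n mod 4\<close>, up to a coboundary. Multiplying these products by \<open>z\<close> to the
  power \<open>n div 4\<close> keeps the pullbacks, so \<open>f\<close> is cohomologous to a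
  combination of monomials in the generators.\<close>

lemma span_homogeneous:
  assumes f: "f \<in> cyc" "homogeneous n f"
  shows "spc f"
proof -
  let ?i = "n mod 4" and ?q = "n div 4" and ?w = "pull n f"
  have "?i = 0 \<or> ?i = 1 \<or> ?i = 2 \<or> ?i = 3" by auto
  then have i: "?i \<in> set [0, 1, 2, 3]" by auto
  have n: "?i + 4 * ?q = n" by simp
  have "alg_map ?w (D (Suc n) u) = 0" for u
    by (rule pull_cocycle) (use f(1) in \<open>simp_all add: cyc_mlin cyc_iff cochains_mlin\<close>)
  then obtain c where c: "?i = 0 \<Longrightarrow> c = (\<lambda>_. 0)"
    "\<And>t. t \<in> cells n \<Longrightarrow> ?w t = (\<Sum>t0\<in>cells n. \<Sum>m\<in>UNIV. vscale (cf m (?w t0))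
       (val (\<lambda>gs. val bas (pullL ?i (cML gs) t)) (LAM ?i t0 m))) + alg_map c (D n t)"
    using cocycle_decomposition by blast
  define G where "G = (\<lambda>xs. \<Sum>t0\<in>cells n. \<Sum>m\<in>UNIV. vscale (cf m (?w t0)) (val (\<lambda>gs. zq gs ?q xs) (LAM ?i t0 m)))"
  have G: "spc G"
    unfolding G_def by (intro spc_sum spc_scale spc_val spc_zq)
  have deg: "gsdeg gs = ?i" if "gs \<in> set (LAM ?i t0 m)" "t0 \<in> cells n" for gs t0 m
    using table_span(2) i all_mons [of m] that unfolding list_all_iff cells_eq [symmetric] by blast
  have hz: "zq gs ?q xs = 0" if "gs \<in> set (LAM ?i t0 m)" "t0 \<in> cells n" "length xs \<noteq> n" for gs t0 m xs
    using homogeneous_zq [of gs ?q] deg [OF that(1,2)] that(3) n by (simp add: homogeneous_def)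
  have "homogeneous n G"
    unfolding homogeneous_def G_def
  proof (intro allI impI sum.neutral ballI)
    fix xs :: "'k kQ8 list" and t0 m assume "length xs \<noteq> n" "t0 \<in> cells n"
    then have "val (\<lambda>gs. zq gs ?q xs) (LAM ?i t0 m) = val (\<lambda>_. 0) (LAM ?i t0 m)"
      using hz by (intro val_cong) blast
    then show "vscale (cf m (?w t0)) (val (\<lambda>gs. zq gs ?q xs) (LAM ?i t0 m)) = 0"
      by (simp add: val_0)
  qed
  moreover have "pull n f t = pull n G t + alg_map c (D n t)" if t: "t \<in> cells n" for t
  proof -
    have "pull n (\<lambda>xs. val (\<lambda>gs. zq gs ?q xs) (LAM ?i t0 m)) t = val (\<lambda>gs. val bas (pullL ?i (cML gs) t)) (LAM ?i t0 m)"
      if t0: "t0 \<in> cells n" for t0 m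
      unfolding pull_val [OF spc_zq]
    proof (rule val_cong)
      fix gs assume gs: "gs \<in> set (LAM ?i t0 m)"
      have d: "gsdeg gs = ?i" by (rule deg [OF gs t0])
      have "t \<in> cells (gsdeg gs)"
        using t unfolding d cells_def by (simp only: mod_mod_trivial)
      from pull_zq [OF this, of ?q] have "pull n (zq gs ?q) t = pull ?i (cm gs) t"
        unfolding d n .
      also have "\<dots> = val bas (pullL ?i (cML gs) t)"
        using pull_rel [OF cyc_mlin [OF cm_cyc] rel_cm [of gs]] unfolding d .
      finally show "pull n (zq gs ?q) t = val bas (pullL ?i (cML gs) t)" .
    qed
    then have "pull n G t = (\<Sum>t0\<in>cells n. \<Sum>m\<in>UNIV. vscale (cf m (?w t0))
       (val (\<lambda>gs. val bas (pullL ?i (cML gs) t)) (LAM ?i t0 m)))"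
      unfolding G_def
      by (simp add: pull_sum spc_sum spc_scale spc_val spc_zq pull_scale spc_mlin)
    then show ?thesis using c(2) [OF t] by simp
  qed
  ultimately have "cl f = cl G"
    using G c(1) by (intro class_eqI [OF f]) (auto simp: spc_def)
  then show ?thesis
    using G f(1) by (simp add: spc_def)
qed

text \<open>The differential is homogeneous, so every component of a cocycle is a cocycle, and only
  finitely many components are nonzero.\<close>

lemma span_all:
  assumes f: "f \<in> cyc"
  shows "spc f"
proof -
  define fn where "fn = (\<lambda>n xs. if length xs = n then f xs else 0)"
  have fm: "mlin f" "hoch_diff f = (\<lambda>_. 0)"
    using f by (simp_all add: cyc_iff cochains_mlin)
  have "spc (fn n)" for n
  proof (rule span_homogeneous)
    show "homogeneous n (fn n)" by (simp add: homogeneous_def fn_def)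
    have "klin (\<lambda>a. fn n (as @ a # cs))" for as cs
      using fm(1) by (auto simp: fn_def multilinear_iff klin_iff)
    then have "mlin (fn n)" unfolding multilinear_iff by blast
    moreover have "hoch_diff (fn n) xs = 0" for xs
    proof (cases "xs = []")
      case False
      have h: "hoch_diff g xs = hd xs * g (tl xs) + mrg g xs + g (butlast xs) * last xs" for g :: "'k kQ8 list \<Rightarrow> 'k kQ8"
        using False by (simp add: hoch_diff_def bar_diff_char2 [OF double])
      have l: "length (tl xs) + 1 = length xs" "length (butlast xs) + 1 = length xs"
        using False by (cases xs; auto)+
      show ?thesis
      proof (cases "length xs = n + 1")
        case True
        then have "hoch_diff (fn n) xs = hoch_diff f xs"
          unfolding h using l mrg_cong [of xs "fn n" f] by (simp add: fn_def)
        then show ?thesis by (simp add: fm(2))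
      next
        case F: False
        have "mrg (fn n) xs = mrg (\<lambda>_. 0) xs"
          by (rule mrg_cong) (use F in \<open>auto simp: fn_def\<close>)
        also have "\<dots> = 0"
          using mrg_hom [of "\<lambda>_. 0 :: 'k kQ8" "\<lambda>_. 0 :: 'k kQ8" xs] by simp
        finally show ?thesis
          unfolding h using l F by (simp add: fn_def)
      qed
    qed (simp add: hoch_diff_def)
    moreover have "bounded_deg (fn n)"
      unfolding bounded_deg_def by (rule exI [of _ n]) (simp add: fn_def)
    ultimately show "fn n \<in> cyc"
      by (simp add: cyc_iff cochains_iff fun_eq_iff)
  qed
  then have "spc (\<lambda>xs. \<Sum>n\<le>N. fn n xs)" for N
    by (rule spc_sum)
  moreover obtain N where N: "\<And>xs. length xs > N \<Longrightarrow> f xs = 0"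
    using f by (auto simp: cyc_iff cochains_iff bounded_deg_def)
  have "f = (\<lambda>xs. \<Sum>n\<le>N. fn n xs)"
  proof
    fix xs
    show "f xs = (\<Sum>n\<le>N. fn n xs)"
      using N [of xs] by (cases "length xs \<le> N") (simp_all add: fn_def)
  qed
  ultimately show ?thesis by metis
qed

lemma sp_all: "a \<in> carrier R \<Longrightarrow> sp a"
  using span_all by (auto simp: carrier_HH spc_def)

section \<open>Uniqueness of the bracket\<close>

lemma uminus_R: "a \<in> carrier R \<Longrightarrow> \<ominus>\<^bsub>R\<^esub> a = a"
  by (rule H.minus_equality) (simp_all add: HH_double)

lemma ralt_R: "a \<in> carrier R \<Longrightarrow> ralt R n a = a"
  by (simp add: ralt_def uminus_R)

text \<open>The product rule at \<open>1 = 1 * 1\<close> gives \<open>d 1 = d 1 + d 1\<close>, which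
  is zero in characteristic two.\<close>

lemma derivation_one:
  assumes "d \<in> carrier R \<rightarrow> carrier R" "d (\<one>\<^bsub>R\<^esub> \<otimes>\<^bsub>R\<^esub> \<one>\<^bsub>R\<^esub>) = (d \<one>\<^bsub>R\<^esub> \<otimes>\<^bsub>R\<^esub> \<one>\<^bsub>R\<^esub>) \<oplus>\<^bsub>R\<^esub> (\<one>\<^bsub>R\<^esub> \<otimes>\<^bsub>R\<^esub> d \<one>\<^bsub>R\<^esub>)"
  shows "d \<one>\<^bsub>R\<^esub> = \<zero>\<^bsub>R\<^esub>"
proof -
  have "d \<one>\<^bsub>R\<^esub> \<in> carrier R" using assms(1) by auto
  then show ?thesis using assms(2) by (simp add: HH_double)
qed

lemma uniqueness:
  assumes G: "is_gerstenhaber_bracket R (hh_scale vscale) (HH_deg vscale) br"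
    and T: "bracket_table R (gen_class x y \<Phi>) br"
    and ab: "a \<in> carrier R" "b \<in> carrier R"
  shows "br a b = hh_bracket vscale a b"
proof -
  let ?hb = "hh_bracket vscale"
  note G' = G [unfolded is_gerstenhaber_bracket_def]
  note G1 = conjunct1 [OF G'] and G2 = conjunct1 [OF conjunct2 [OF G']]
    and G3 = conjunct1 [OF conjunct2 [OF conjunct2 [OF G']]]
    and G5 = conjunct1 [OF conjunct2 [OF conjunct2 [OF conjunct2 [OF conjunct2 [OF G']]]]]
    and G7 = conjunct2 [OF conjunct2 [OF conjunct2 [OF conjunct2 [OF conjunct2 [OF conjunct2 [OF G']]]]]]
  have closed: "br a b \<in> carrier R" if "a \<in> carrier R" "b \<in> carrier R" for a b
    using G1 that by blast
  have add: "br (a \<oplus>\<^bsub>R\<^esub> b) c = br a c \<oplus>\<^bsub>R\<^esub> br b c" "br c (a \<oplus>\<^bsub>R\<^esub> b) = br c a \<oplus>\<^bsub>R\<^esub> br c b"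
    if "a \<in> carrier R" "b \<in> carrier R" "c \<in> carrier R" for a b c
    using bspec [OF bspec [OF bspec [OF G2 that(1)] that(2)] that(3)] by blast+
  have scale: "br (hh_scale vscale t a) b = hh_scale vscale t (br a b)" "br a (hh_scale vscale t b) = hh_scale vscale t (br a b)"
    if "a \<in> carrier R" "b \<in> carrier R" for t a b
    using bspec [OF bspec [OF spec [OF G3] that(1)] that(2)] by blast+
  \<comment> \<open>The symmetry and Poisson axioms are available for products of generators because
    these are homogeneous; their signs vanish in characteristic two.\<close>
  have comm: "br a b = br b a" if "mn n a" "mn m b" for n m a b
  proof -
    have "br a b = \<ominus>\<^bsub>R\<^esub> ralt R ((n + 1) * (m + 1)) (br b a)"
      using G5 mn_deg [OF that(1)] mn_deg [OF that(2)] by blast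
    then show ?thesis
      using closed that by (simp add: ralt_R uminus_R mn_carrier)
  qed
  have mult: "br (a \<otimes>\<^bsub>R\<^esub> b) c = (br a c \<otimes>\<^bsub>R\<^esub> b) \<oplus>\<^bsub>R\<^esub> (a \<otimes>\<^bsub>R\<^esub> br b c)" if "mn n a" "mn m b" "mn l c" for n m l a b c
  proof -
    have "br (a \<otimes>\<^bsub>R\<^esub> b) c = (br a c \<otimes>\<^bsub>R\<^esub> b) \<oplus>\<^bsub>R\<^esub> ralt R (n * (l + 1)) (a \<otimes>\<^bsub>R\<^esub> br b c)"
      using G7 mn_deg [OF that(1)] mn_deg [OF that(2)] mn_deg [OF that(3)] by blast
    then show ?thesis
      using closed that by (simp add: ralt_R mn_carrier)
  qed
  have one: "br \<one>\<^bsub>R\<^esub> c = ?hb \<one>\<^bsub>R\<^esub> c" if "mn l c" for l c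
  proof -
    have c: "c \<in> carrier R" using that by (rule mn_carrier)
    have "br \<one>\<^bsub>R\<^esub> c = \<zero>\<^bsub>R\<^esub>"
    proof (rule derivation_one [of "\<lambda>a. br a c"])
      show "(\<lambda>a. br a c) \<in> carrier R \<rightarrow> carrier R" using closed c by blast
    qed (rule mult [OF mn_one mn_one that])
    moreover have "?hb \<one>\<^bsub>R\<^esub> c = \<zero>\<^bsub>R\<^esub>"
    proof (rule derivation_one [of "\<lambda>a. ?hb a c"])
      show "(\<lambda>a. ?hb a c) \<in> carrier R \<rightarrow> carrier R" using hh_bracket_closed c by blast
    qed (rule hh_bracket_mult [OF H.one_closed H.one_closed c])
    ultimately show ?thesis by simp
  qed
  have gens: "br (cl (cc g)) (cl (cc h)) = ?hb (cl (cc g)) (cl (cc h))" for g h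
  proof -
    have c: "gen_class x y \<Phi> = (\<lambda>g. cl (cc g))"
      by (rule HOL.ext) (rule gen_class_eq)
    let ?N = "nonzero_brackets R (\<lambda>g. cl (cc g))"
    note T' = T [unfolded bracket_table_def c] and B' = table [unfolded bracket_table_def c]
    have t: "br (cl (cc g)) (cl (cc h)) = v \<and> br (cl (cc h)) (cl (cc g)) = v"
        "?hb (cl (cc g)) (cl (cc h)) = v \<and> ?hb (cl (cc h)) (cl (cc g)) = v" if n: "(g, h, v) \<in> ?N" for g h v
      using bspec [OF conjunct1 [OF T'] n] bspec [OF conjunct1 [OF B'] n] by (simp_all only: prod.case)
    have z: "br (cl (cc g)) (cl (cc h)) = \<zero>\<^bsub>R\<^esub>" "?hb (cl (cc g)) (cl (cc h)) = \<zero>\<^bsub>R\<^esub>"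
      if n: "\<forall>v. (g, h, v) \<notin> ?N \<and> (h, g, v) \<notin> ?N"
      by (rule mp [OF spec [OF spec [OF conjunct2 [OF T']]] n], rule mp [OF spec [OF spec [OF conjunct2 [OF B']]] n])
    consider v where "(g, h, v) \<in> ?N" | v where "(h, g, v) \<in> ?N" | "\<forall>v. (g, h, v) \<notin> ?N \<and> (h, g, v) \<notin> ?N"
      by blast
    then show ?thesis
    proof cases
      case 1
      then show ?thesis using t(1) [OF 1] t(2) [OF 1] by simp
    next
      case 2
      then show ?thesis using t(1) [OF 2] t(2) [OF 2] by simp
    next
      case 3
      then show ?thesis by (simp only: z [OF 3])
    qed
  qed
  \<comment> \<open>In the first argument both brackets are derivations, so agreement on generators
    passes to products while \<open>c\<close> stays fixed.\<close>
  have step: "br a c = ?hb a c" if "mn n a" "mn l c" and g: "\<And>g. br (cl (cc g)) c = ?hb (cl (cc g)) c" for n a l c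
    using that(1)
  proof (induction rule: mn.induct)
    case mn_one
    show ?case by (rule one [OF that(2)])
  next
    case (mn_gen h)
    show ?case by (rule g)
  next
    case (mn_mult n a m b)
    then show ?case
      using mult [OF mn_mult(1,2) that(2)] hh_bracket_mult [of a b c] that(2) by (simp add: mn_carrier)
  qed
  have 1: "br a (cl (cc h)) = ?hb a (cl (cc h))" if "mn n a" for n a h
    by (rule step [OF that mn_gen gens])
  \<comment> \<open>Symmetry makes the case of a generator in the second argument serve as the
    hypothesis on generators in the first.\<close>
  have 2: "br a b = ?hb a b" if "mn n a" "mn m b" for n m a b
  proof (rule step [OF that])
    fix g
    have "br (cl (cc g)) b = br b (cl (cc g))"
      by (rule comm [OF mn_gen that(2)])
    also have "\<dots> = ?hb b (cl (cc g))" by (rule 1 [OF that(2)])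
    also have "\<dots> = ?hb (cl (cc g)) b"
      using that(2) by (intro hh_bracket_commute) (simp_all add: mn_carrier cc_cyc)
    finally show "br (cl (cc g)) b = ?hb (cl (cc g)) b" .
  qed
  have zero_l: "br \<zero>\<^bsub>R\<^esub> c = \<zero>\<^bsub>R\<^esub>" "br c \<zero>\<^bsub>R\<^esub> = \<zero>\<^bsub>R\<^esub>" "?hb \<zero>\<^bsub>R\<^esub> c = \<zero>\<^bsub>R\<^esub>" "?hb c \<zero>\<^bsub>R\<^esub> = \<zero>\<^bsub>R\<^esub>" if c: "c \<in> carrier R" for c
  proof -
    note 0 = H.zero_closed
    have "br \<zero>\<^bsub>R\<^esub> c = br \<zero>\<^bsub>R\<^esub> c \<oplus>\<^bsub>R\<^esub> br \<zero>\<^bsub>R\<^esub> c"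
      using add(1) [OF 0 0 c] by (simp only: H.l_zero [OF 0])
    then show "br \<zero>\<^bsub>R\<^esub> c = \<zero>\<^bsub>R\<^esub>"
      using HH_double [OF closed [OF 0 c]] by (rule trans)
    have "br c \<zero>\<^bsub>R\<^esub> = br c \<zero>\<^bsub>R\<^esub> \<oplus>\<^bsub>R\<^esub> br c \<zero>\<^bsub>R\<^esub>"
      using add(2) [OF 0 0 c] by (simp only: H.l_zero [OF 0])
    then show "br c \<zero>\<^bsub>R\<^esub> = \<zero>\<^bsub>R\<^esub>"
      using HH_double [OF closed [OF c 0]] by (rule trans)
    have "?hb \<zero>\<^bsub>R\<^esub> c = ?hb \<zero>\<^bsub>R\<^esub> c \<oplus>\<^bsub>R\<^esub> ?hb \<zero>\<^bsub>R\<^esub> c"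
      using hh_bracket_add [OF 0 0 c] by (simp only: H.l_zero [OF 0])
    then show z: "?hb \<zero>\<^bsub>R\<^esub> c = \<zero>\<^bsub>R\<^esub>"
      using HH_double [OF hh_bracket_closed [OF 0 c]] by (rule trans)
    show "?hb c \<zero>\<^bsub>R\<^esub> = \<zero>\<^bsub>R\<^esub>"
      using hh_bracket_commute [OF c 0] z by (rule trans)
  qed
  have hb_add: "?hb c (a \<oplus>\<^bsub>R\<^esub> b) = ?hb c a \<oplus>\<^bsub>R\<^esub> ?hb c b"
    if a: "a \<in> carrier R" and b: "b \<in> carrier R" and c: "c \<in> carrier R" for a b c
    unfolding hh_bracket_commute [OF c H.add.m_closed [OF a b]] hh_bracket_commute [OF c a] hh_bracket_commute [OF c b]
    by (rule hh_bracket_add [OF a b c])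
  have hb_scale: "?hb c (hh_scale vscale t a) = hh_scale vscale t (?hb c a)"
    if a: "a \<in> carrier R" and c: "c \<in> carrier R" for a c t
    unfolding hh_bracket_commute [OF c scale_carrier [OF a]] hh_bracket_commute [OF c a]
    by (rule hh_bracket_scale [OF a c])
  have 3: "br a b = ?hb a b" if "mn n a" "sp b" for n a b
    using that(2)
  proof (induction rule: sp.induct)
    case sp_zero
    show ?case using mn_carrier [OF that(1)] by (simp add: zero_l)
  next
    case (sp_mn m b)
    then show ?case using 2 that(1) by blast
  next
    case (sp_add b c)
    then show ?case
      using mn_carrier [OF that(1)] by (simp add: add hb_add sp_carrier)
  next
    case (sp_scale b t)
    then show ?case
      using mn_carrier [OF that(1)] by (simp add: scale hb_scale sp_carrier)
  qed
  have 4: "br a b = ?hb a b" if "sp a" "sp b" for a b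
    using that(1)
  proof (induction rule: sp.induct)
    case sp_zero
    show ?case using sp_carrier [OF that(2)] by (simp add: zero_l)
  next
    case (sp_mn m a)
    then show ?case using 3 that(2) by blast
  next
    case (sp_add a c)
    then show ?case
      using sp_carrier [OF that(2)] by (simp add: add hh_bracket_add sp_carrier)
  next
    case (sp_scale a t)
    then show ?case
      using sp_carrier [OF that(2)] by (simp add: scale hh_bracket_scale sp_carrier)
  qed
  show ?thesis
    by (rule 4) (rule sp_all ab)+
qed

end

theorem corollary5p10:
  fixes x y :: "'k::alg_closed_field kQ8"
    and \<Phi> :: "'k kQ8 list \<Rightarrow> 'k bimod"
  assumes "CHAR('k) = 2"
    and "identification x y"
    and "comparison_map x y \<Phi>"
  shows "bracket_table (HH vscale) (gen_class x y \<Phi>) (hh_bracket vscale) \<and>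
    (\<forall>br. is_gerstenhaber_bracket (HH vscale) (hh_scale vscale) (HH_deg vscale) br \<and>
          bracket_table (HH vscale) (gen_class x y \<Phi>) br \<longrightarrow>
          (\<forall>a\<in>carrier (HH vscale). \<forall>b\<in>carrier (HH vscale). br a b = hh_bracket vscale a b))"
proof -
  interpret quat_comparison x y \<Phi>
    using assms by unfold_locales
  show ?thesis
    using table uniqueness by blast
qed

end
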